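(* Let $d\ge 3$ be an integer and let $\xi$ be a random variable with support in $[0,1]$ such that $\mathbb{P}(\xi\in\{0,1\})=0$ and the support of $\xi$ contains at least two distinct points of $(0,1)$. If $d$ is even, assume in addition that, for i.i.d. copies $\xi_1,\dots,\xi_d$ of $\xi$, $$\prod_{i=1}^d\frac{1-\xi_i}{\xi_i}\ne 1\quad\text{almost surely.}$$ Let $(L_n)_{n\ge 0}$ be the sequence of random polygons obtained from a non-degenerate convex $d$-gon $L_0$ by the consecutive random subdivision procedure with splitting variable $\xi$. Then, almost surely, $L_n$ converges to a flat figure as $n\to\infty$.
   Context: Subdivision procedure. Let $L_0=A_1^{(0)}A_2^{(0)}\cdots A_d^{(0)}$ be a non-degenerate convex polygon with $d$ sides in the plane. Let $\xi_j^{(n)}$, $1\le j\le d$, $n\ge 1$, be i.i.d. copies of $\xi$. Given $L_{n}=A_1^{(n)}\cdots A_d^{(n)}$ (with the convention $A_{d+1}^{(n)}=A_1^{(n)}$), let $A_j^{(n+1)}$ be the point of the segment $A_j^{(n)}A_{j+1}^{(n)}$ with $|A_j^{(n)}A_j^{(n+1)}|/|A_j^{(n)}A_{j+1}^{(n)}|=\xi_j^{(n+1)}$, and set $L_{n+1}=A_1^{(n+1)}\cdots A_d^{(n+1)}$. Let $l_j^{(n)}$ denote the vector from $A_j^{(n)}$ to $A_{j+1}^{(n)}$. The sequence $L_n$ converges to a flat figure if $\lim_{n\to\infty}\dfrac{\mathrm{Area}(L_n)}{\left(\max_{1\le j\le d}\|l_j^{(n)}\|\right)^2}=0$, where $\|\cdot\|$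 is the Euclidean norm. *)

theory Defs
  imports "HOL-Probability.Probability"
begin

definition law_support :: "real measure \<Rightarrow> real set" where
  "law_support \<mu> = {x. \<forall>U. open U \<and> x \<in> U \<longrightarrow> emeasure \<mu> U > 0}"

text \<open>Vertices and splitting ratios are indexed by \<open>{1..d}\<close>; values at other
  indices are irrelevant. The cyclic successor of \<open>j \<in> {1..d}\<close> is \<open>j mod d + 1\<close>
  (so \<open>d\<close> is followed by \<open>1\<close>).\<close>

definition side :: "nat \<Rightarrow> (nat \<Rightarrow> real^2) \<Rightarrow> nat \<Rightarrow> real^2" where
  "side d A j = A (j mod d + 1) - A j"

definition polygon_region :: "nat \<Rightarrow> (nat \<Rightarrow> real^2) \<Rightarrow> (real^2) set" where
  "polygon_region d A = convex hull (A ` {1..d})"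

text \<open>A convex \<open>d\<close>-gon \<open>A 1, \<dots>, A d\<close>, listed in cyclic order: the vertices are distinct,
  joining consecutive ones gives edges of their convex hull, and every vertex is a genuine corner
  (no straight angles).\<close>

definition convex_polygon :: "nat \<Rightarrow> (nat \<Rightarrow> real^2) \<Rightarrow> bool" where
  "convex_polygon d A \<longleftrightarrow>
     inj_on A {1..d} \<and>
     (\<forall>j\<in>{1..d}. A j extreme_point_of polygon_region d A) \<and>
     (\<forall>j\<in>{1..d}. closed_segment (A j) (A (j mod d + 1)) edge_of polygon_region d A) \<and>
     interior (polygon_region d A) \<noteq> {}"

text \<open>\<open>subdivision d x A n\<close> is the vertex list of the \<open>n\<close>-th polygon, obtained from \<open>A\<close> with
  splitting ratios \<open>x n j\<close> (for \<open>n \<ge> 1\<close>).\<close>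

primrec subdivision ::
  "nat \<Rightarrow> (nat \<Rightarrow> nat \<Rightarrow> real) \<Rightarrow> (nat \<Rightarrow> real^2) \<Rightarrow> nat \<Rightarrow> nat \<Rightarrow> real^2" where
  "subdivision d x A 0 = A"
| "subdivision d x A (Suc n) =
     (\<lambda>j. subdivision d x A n j + x (Suc n) j *\<^sub>R side d (subdivision d x A n) j)"

text \<open>The area is that of the convex hull of the vertices. Subdividing a convex polygon with ratios
  in \<open>{0..1}\<close> yields a convex polygon again, for which the hull is the enclosed region.\<close>

definition converges_to_flat_figure :: "nat \<Rightarrow> (nat \<Rightarrow> nat \<Rightarrow> real^2) \<Rightarrow> bool" where
  "converges_to_flat_figure d L \<longleftrightarrow>
     (\<lambda>n. measure lebesgue (polygon_region d (L n)) / (MAX j\<in>{1..d}. norm (side d (L n) j))\<^sup>2)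
       \<longlonglongrightarrow> 0"

end

theory Submission
  imports Defs "HOL-Library.Function_Algebras"
begin

text \<open>
  One subdivision moves every vertex linearly: \<open>a\<^sub>i\<close> becomes
  \<open>(1 - x\<^sub>i) a\<^sub>i + x\<^sub>i a\<^sub>i\<^sub>+\<^sub>1\<close> (\<open>step\<close>). The
  same random map \<open>evolve\<close> therefore acts on the first and on the second coordinates of the vertices,
  and it commutes with translations, scalings and rotations of the plane. Identify the plane with the complex
  numbers, let \<open>osc\<close> be the largest difference between two entries of a sequence, and call a polygon
  \<open>\<delta>\<close>-flat if in some direction its oscillation is less than \<open>\<delta>\<close> times the
  oscillation in the perpendicular direction. Such a polygon lies in a thin rectangle, so its area is at most
  \<open>\<delta>\<close> times a constant times the square of its longest side (\<open>area_le_of_flat\<close>). The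
  theorem thus says that for every \<open>\<delta>\<close> the polygons are almost surely
  \<open>\<delta>\<close>-flat from some time on, and it follows from two facts.

  (1) A flat polygon tends to stay flat (\<open>stays_flat\<close>). Let \<open>gain\<close> be the largest
  oscillation to which one of the unit sequences has grown at a given time; up to a factor \<open>d\<close> it bounds
  the growth of every real sequence. The point is a converse, \<open>nondegenerate\<close>: with probability near
  one, the oscillation of a \<^emph>\<open>given\<close> sequence is at all times at least a fixed multiple of the
  gain. The long coordinate of a flat polygon then grows at the maximal rate, so the thin one cannot catch up.

  (2) From every nonconstant configuration \<open>\<delta>\<close>-flatness is reached almost surely
  (\<open>hits_flat\<close>). By compactness and the Markov property it suffices to reach it with positive
  probability, and this is a deterministic question about steps whose ratios are \<open>p\<close> or
  \<open>q\<close>, two points of the support (\<open>flat_free_family_empty\<close>). Equal ratios \<open>p\<close>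
  multiply the discrete Fourier modes by fixed factors and drive a polygon to an affine image
  \<open>a \<zeta>\<^sup>i + b cnj (\<zeta>\<^sup>i)\<close> of the regular one, where \<open>\<zeta>\<close> is
  a primitive \<open>d\<close>-th root of unity. Replacing one ratio by \<open>q\<close> at a suitable vertex mixes
  the two dominant modes so that
  \<open>\<bar>\<bar>a\<bar>\<^sup>2 - \<bar>b\<bar>\<^sup>2\<bar> / (\<bar>a\<bar>\<^sup>2 + \<bar>b\<bar>\<^sup>2)\<close>
  strictly decreases. In a closed family of polygons from which flatness is out of reach this quantity would have a
  positive minimum, which is impossible.

  The converse in (1) is the harder half. Run the step on linear forms instead of sequences (\<open>adj\<close>). The
  main claim, \<open>max_mass_tendsto_0\<close>, is that for \<open>n \<ge> 1\<close> the probability that the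
  evolved sequence is annihilated by an \<open>n\<close>-dimensional space of forms tends to \<open>0\<close>,
  uniformly in the space and in the initial nonconstant sequence. It is proved by downward induction on
  \<open>n\<close>. Suppose that the suprema of these probabilities decrease to \<open>s > 0\<close>. Two distinct
  \<open>n\<close>-dimensional spaces contain an \<open>(n + 1)\<close>-dimensional space in their sum, so the
  corresponding events are almost disjoint and only boundedly many spaces can have probability close to
  \<open>s\<close> simultaneously. Take a family of such spaces of the maximal possible size. Moving it one step back
  in time, with ratios \<open>x\<close> or with \<open>x\<close> changed at one vertex, gives near-maximal families
  again, hence one and the same family. The two maps differ by a rank-one perturbation, and a rank-one perturbation
  that permutes finitely many spaces puts the form \<open>a\<^sub>j\<^sub>+\<^sub>1 - a\<^sub>j\<close> into them
  (\<open>side_form_in_image\<close>). After \<open>d\<close> steps all these forms lie in one space, so that only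
  constant sequences are annihilated. But a nonconstant sequence almost surely stays nonconstant: the assumption on
  the product of the \<open>(1 - \<xi>\<^sub>i) / \<xi>\<^sub>i\<close> makes the step invertible. This
  contradicts \<open>s > 0\<close>.

  For \<open>n = 1\<close> a compactness argument turns this into a small-ball estimate
  (\<open>small_ball\<close>). At a fixed late time \<open>k\<close> the last \<open>k - j\<close> steps,
  conditioned on, provide a linear form that realises their gain, while the first \<open>j\<close> steps make the
  sequence unlikely to be nearly annihilated by it; this is \<open>nondegenerate_fixed_time\<close>. A maximal
  inequality of Ottaviani type (\<open>first_passage\<close>) extends the estimate to all times at once.
\<close>

section \<open>Subdivision steps and their adjoints\<close>

text \<open>The pointwise vector space structure makes the dimension theory of spans and independent sets available for linear
  forms, which are represented by their coefficient sequences.\<close>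

instantiation "fun" :: (type, real_vector) real_vector
begin

definition scaleR_fun :: "real \<Rightarrow> ('a \<Rightarrow> 'b) \<Rightarrow> 'a \<Rightarrow> 'b" where
  "scaleR_fun r f = (\<lambda>x. r *\<^sub>R f x)"

instance
  by standard (auto simp: scaleR_fun_def fun_eq_iff algebra_simps)

end

lemma scaleR_fun_apply [simp]: "(r *\<^sub>R f) x = r *\<^sub>R f x"
  by (simp add: scaleR_fun_def)

definition step :: "nat \<Rightarrow> (nat \<Rightarrow> real) \<Rightarrow> (nat \<Rightarrow> 'v::real_vector) \<Rightarrow> nat \<Rightarrow> 'v" where
  "step d x a i = (1 - x i) *\<^sub>R a i + x i *\<^sub>R a (i mod d + 1)"

text \<open>Time is indexed so that \<open>\<omega> n\<close> holds the ratios of the step from time \<open>n\<close> to time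
  \<open>n + 1\<close>.\<close>

primrec evolve :: "nat \<Rightarrow> (nat \<Rightarrow> nat \<Rightarrow> real) \<Rightarrow> nat \<Rightarrow> (nat \<Rightarrow> 'v::real_vector) \<Rightarrow> nat \<Rightarrow> 'v" where
  "evolve d \<omega> 0 a = a"
| "evolve d \<omega> (Suc n) a = step d (\<omega> n) (evolve d \<omega> n a)"

lemma cyc_mem: "i mod d + 1 \<in> {1..d}" if "i \<in> {1..d}" for i d :: nat
  using that by (auto simp: Suc_le_eq)

lemma cyc_bij: "bij_betw (\<lambda>i. i mod d + 1) {1..d} {1..d::nat}"
proof -
  have "inj_on (\<lambda>i. i mod d + 1) {1..d}"
  proof (rule inj_onI)
    fix i j assume "i \<in> {1..d}" "j \<in> {1..d}" "i mod d + 1 = j mod d + 1"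
    then show "i = j"
      by (cases "i = d"; cases "j = d") auto
  qed
  moreover have "(\<lambda>i. i mod d + 1) ` {1..d} \<subseteq> {1..d}"
    using cyc_mem by blast
  ultimately show ?thesis
    by (simp add: bij_betw_def endo_inj_surj)
qed

definition pred_cyc :: "nat \<Rightarrow> nat \<Rightarrow> nat" where
  "pred_cyc d i = (if i = 1 then d else i - 1)"

lemma pred_cyc_succ: "i \<in> {1..d} \<Longrightarrow> pred_cyc d (i mod d + 1) = i"
  by (cases "i = d") (auto simp: pred_cyc_def)

lemma succ_pred_cyc: "i \<in> {1..d} \<Longrightarrow> pred_cyc d i mod d + 1 = i"
  by (auto simp: pred_cyc_def)

text \<open>Going once around the polygon multiplies a solution of a cyclic two-term recursion by the product of the quotients;
  a nonzero solution has to return to itself.\<close>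

lemma cyc_chain_product:
  fixes y \<alpha> \<beta> :: "nat \<Rightarrow> real"
  assumes rel: "\<And>i. i \<in> {1..d} \<Longrightarrow> \<alpha> i * y i + \<beta> i * y (i mod d + 1) = 0"
    and nz: "\<And>i. i \<in> {1..d} \<Longrightarrow> \<beta> i \<noteq> 0"
    and y: "i\<^sub>0 \<in> {1..d}" "y i\<^sub>0 \<noteq> 0"
  shows "(\<Prod>i=1..d. - (\<alpha> i / \<beta> i)) = 1"
proof -
  have step: "y (i mod d + 1) = - (\<alpha> i / \<beta> i) * y i" if "i \<in> {1..d}" for i
  proof -
    have "\<beta> i * y (i mod d + 1) = - \<alpha> i * y i"
      using rel[OF that] by linarith
    then show ?thesis using nz[OF that] by (simp add: field_simps)
  qed
  have val: "y (Suc k) = (\<Prod>i=1..k. - (\<alpha> i / \<beta> i)) * y 1" if "k < d" for k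
    using that
  proof (induction k)
    case (Suc k)
    have "y (Suc (Suc k)) = - (\<alpha> (Suc k) / \<beta> (Suc k)) * y (Suc k)"
      using step[of "Suc k"] Suc.prems by simp
    then show ?case
      using Suc by (simp add: mult.assoc mult.left_commute)
  qed simp
  from y have "d \<ge> 1" by auto
  then obtain k where k: "d = Suc k" by (cases d) auto
  have "y 1 \<noteq> 0"
  proof
    assume "y 1 = 0"
    have "i\<^sub>0 - 1 < d" "Suc (i\<^sub>0 - 1) = i\<^sub>0" using y by auto
    with val[of "i\<^sub>0 - 1"] \<open>y 1 = 0\<close> have "y i\<^sub>0 = 0" by simp
    with y show False by simp
  qed
  moreover have "y 1 = - (\<alpha> d / \<beta> d) * y d"
    using step[of d] \<open>d \<ge> 1\<close> by simp
  then have "y 1 = (\<Prod>i=1..d. - (\<alpha> i / \<beta> i)) * y 1"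
    using val[of k] k by (simp add: mult.assoc mult.left_commute)
  ultimately show ?thesis by simp
qed

text \<open>Besides ratios strictly inside the unit interval, this demands that the step with these ratios be injective. For
  odd \<open>d\<close> positivity of the quotients suffices, because of the sign \<open>(-1) ^ d\<close>.\<close>

definition regular :: "nat \<Rightarrow> (nat \<Rightarrow> real) \<Rightarrow> bool" where
  "regular d x \<longleftrightarrow> (\<forall>i\<in>{1..d}. x i \<in> {0<..<1}) \<and> (even d \<longrightarrow> (\<Prod>i=1..d. (1 - x i) / x i) \<noteq> 1)"

lemma prod_minus_quot:
  "(\<Prod>i\<in>{1..d::nat}. - (f i :: real)) = (-1) ^ d * (\<Prod>i=1..d. f i)"
  by (induction d) (auto simp: mult_ac)

lemma regularD_prod:
  assumes "regular d x" "d \<ge> 1"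
  shows "(-1) ^ d * (\<Prod>i=1..d. (1 - x i) / x i) \<noteq> (1::real)"
proof (cases "even d")
  case True
  then show ?thesis using assms by (simp add: regular_def)
next
  case False
  have "(\<Prod>i=1..d. (1 - x i) / x i) > 0"
    using assms by (intro prod_pos) (auto simp: regular_def)
  then show ?thesis using False by (simp add: not_less[symmetric])
qed

lemma step_injective:
  fixes a :: "nat \<Rightarrow> real"
  assumes "regular d x" and "\<And>i. i \<in> {1..d} \<Longrightarrow> step d x a i = 0" and "i \<in> {1..d}"
  shows "a i = 0"
proof (rule ccontr)
  assume "a i \<noteq> 0"
  have "x k \<noteq> 0" if "k \<in> {1..d}" for k
    using assms(1) that by (force simp: regular_def)
  with \<open>a i \<noteq> 0\<close> have "(\<Prod>i=1..d. - ((1 - x i) / x i)) = 1"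
    using assms by (intro cyc_chain_product[where y = a and i\<^sub>0 = i])
      (auto simp: step_def)
  then show False
    using regularD_prod[OF assms(1)] assms(3) by (simp only: prod_minus_quot) auto
qed

text \<open>Linear forms on sequences indexed by \<open>{1..d}\<close>, normalised to vanish at the other indices so that
  equality of forms is equality of functions.\<close>

definition vecs :: "nat \<Rightarrow> (nat \<Rightarrow> real) set" where
  "vecs d = {c. \<forall>i. i \<notin> {1..d} \<longrightarrow> c i = 0}"

text \<open>The transpose of the step: it moves a linear form one step back in time, see \<open>pairing_step\<close>.\<close>

definition adj :: "nat \<Rightarrow> (nat \<Rightarrow> real) \<Rightarrow> (nat \<Rightarrow> real) \<Rightarrow> nat \<Rightarrow> real" where
  "adj d x c i = (if i \<in> {1..d} then (1 - x i) * c i + x (pred_cyc d i) * c (pred_cyc d i) else 0)"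

definition pairing :: "nat \<Rightarrow> (nat \<Rightarrow> real) \<Rightarrow> (nat \<Rightarrow> real) \<Rightarrow> real" where
  "pairing d c a = (\<Sum>i=1..d. c i * a i)"

lemma sum_cyc: "(\<Sum>i=1..d. f (i mod d + 1)) = (\<Sum>i=1..d. f i)" for f :: "nat \<Rightarrow> 'b::comm_monoid_add"
  using sum.reindex_bij_betw[OF cyc_bij, of f d] by simp

lemma prod_cyc: "(\<Prod>i=1..d. f (i mod d + 1)) = (\<Prod>i=1..d. f i)" for f :: "nat \<Rightarrow> 'b::comm_monoid_mult"
  using prod.reindex_bij_betw[OF cyc_bij, of f d] by simp

lemma pairing_step: "pairing d c (step d x a) = pairing d (adj d x c) a"
proof -
  have "pairing d (adj d x c) a =
    (\<Sum>i=1..d. (1 - x i) * c i * a i) + (\<Sum>i=1..d. x (pred_cyc d i) * c (pred_cyc d i) * a i)"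
    unfolding pairing_def sum.distrib[symmetric]
    by (intro sum.cong refl) (simp add: adj_def algebra_simps)
  also have "(\<Sum>i=1..d. x (pred_cyc d i) * c (pred_cyc d i) * a i) =
      (\<Sum>i=1..d. x i * c i * a (i mod d + 1))"
    by (subst sum_cyc[symmetric]) (intro sum.cong refl, simp only: pred_cyc_succ)
  finally show ?thesis
    by (simp add: pairing_def step_def algebra_simps sum.distrib sum_subtractf)
qed

lemma adj_in_vecs: "adj d x c \<in> vecs d"
  by (auto simp: vecs_def adj_def)

lemma linear_adj: "linear (adj d x)"
  by (rule linearI) (auto simp: adj_def fun_eq_iff algebra_simps)

text \<open>The same cyclic argument as for the step itself, applied to the transposed recursion; the product is the reciprocal
  one up to a cyclic relabelling.\<close>

lemma adj_kernel:
  assumes "regular d x" and "adj d x c = 0" and "c \<in> vecs d"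
  shows "c = 0"
proof (rule ccontr)
  assume "c \<noteq> 0"
  then obtain i where i: "c i \<noteq> 0" by (auto simp: fun_eq_iff)
  with assms(3) have im: "i \<in> {1..d}" by (auto simp: vecs_def)
  have "(\<Prod>k=1..d. - (x k / (1 - x (k mod d + 1)))) = 1"
  proof (rule cyc_chain_product[where y = c and i\<^sub>0 = i])
    fix k assume k: "k \<in> {1..d}"
    have "adj d x c (k mod d + 1) = 0" using assms(2) by simp
    note this[unfolded adj_def pred_cyc_succ[OF k]]
    then show "x k * c k + (1 - x (k mod d + 1)) * c (k mod d + 1) = 0"
      using cyc_mem[OF k] by (simp only: if_True add.commute)
    show "1 - x (k mod d + 1) \<noteq> 0"
      using assms(1) cyc_mem[OF k] unfolding regular_def by fastforce
  qed (use i im in auto)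
  then have "1 = (-1) ^ d * (\<Prod>k=1..d. x k / (1 - x (k mod d + 1)))"
    by (simp only: prod_minus_quot)
  also have "(\<Prod>k=1..d. x k / (1 - x (k mod d + 1))) = (\<Prod>k=1..d. x k) / (\<Prod>k=1..d. 1 - x k)"
    using prod_cyc[of "\<lambda>k. 1 - x k" d] by (simp only: prod_dividef)
  also have "\<dots> = inverse (\<Prod>i=1..d. (1 - x i) / x i)"
    by (simp only: prod_dividef) simp
  finally have eq: "1 = (-1) ^ d * inverse (\<Prod>i=1..d. (1 - x i) / x i)" .
  have "(\<Prod>i=1..d. (1 - x i) / x i) \<noteq> 0"
    using assms(1) by (auto simp: regular_def)
  with eq have "(-1) ^ d * (\<Prod>i=1..d. (1 - x i) / x i) = 1"
    by (cases "even d") (auto simp: field_simps)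
  then show False using regularD_prod[OF assms(1)] im by auto
qed

lemma adj_inj: "regular d x \<Longrightarrow> inj_on (adj d x) (vecs d)"
proof (rule inj_onI)
  fix c c' assume r: "regular d x" and c: "c \<in> vecs d" "c' \<in> vecs d" "adj d x c = adj d x c'"
  have "adj d x (c - c') = adj d x c - adj d x c'"
    by (rule linear_diff[OF linear_adj])
  with c have "adj d x (c - c') = 0" by simp
  then have "c - c' = 0" by (rule adj_kernel[OF r]) (use c in \<open>auto simp: vecs_def\<close>)
  then show "c = c'" by simp
qed

lemma subspace_vecs: "subspace (vecs d)"
  by (auto simp: subspace_def vecs_def)

definition unit_vec :: "nat \<Rightarrow> nat \<Rightarrow> real" where
  "unit_vec j i = (if i = j then 1 else 0)"

text \<open>The form \<open>a \<mapsto> a\<^sub>j\<^sub>+\<^sub>1 - a\<^sub>j\<close>; see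
  \<open>pairing_side_form\<close>.\<close>

definition side_form :: "nat \<Rightarrow> nat \<Rightarrow> nat \<Rightarrow> real" where
  "side_form d j = unit_vec (j mod d + 1) - unit_vec j"

text \<open>Changing the ratio at a single vertex is a rank-one perturbation with range spanned by the form of the side at that
  vertex.\<close>

lemma adj_update:
  assumes "d \<ge> 2" "j \<in> {1..d}"
  shows "adj d (x(j := y)) c = adj d x c + ((y - x j) * c j) *\<^sub>R side_form d j"
proof
  fix i
  have "pred_cyc d i = j \<longleftrightarrow> i = j mod d + 1" if "i \<in> {1..d}"
    using that assms pred_cyc_succ succ_pred_cyc by metis
  moreover have "j mod d + 1 \<noteq> j" using assms by (cases "j = d") auto
  moreover have "j mod d + 1 \<in> {1..d}" using cyc_mem assms by blast
  ultimately show "adj d (x(j := y)) c i = (adj d x c + ((y - x j) * c j) *\<^sub>R side_form d j) i"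
    using assms by (auto simp: adj_def side_form_def unit_vec_def algebra_simps)
qed

section \<open>Rank-one perturbations that permute finitely many subspaces\<close>

text \<open>An injective self-map of a finite set is a permutation, hence every point is periodic.\<close>

lemma self_map_returns:
  assumes "finite A" "inj_on f A" "f ` A \<subseteq> A" "a \<in> A"
  shows "\<exists>n\<ge>1. (f ^^ n) a = a"
proof -
  have mem: "(f ^^ k) a \<in> A" for k
    by (induction k) (use assms in auto)
  have "\<not> inj_on (\<lambda>k. (f ^^ k) a) UNIV"
    using finite_subset[OF _ assms(1), of "range (\<lambda>k. (f ^^ k) a)"] mem
    by (auto dest: finite_imageD)
  then obtain k l where kl: "k < l" "(f ^^ k) a = (f ^^ l) a"
    by (auto simp: inj_on_def) (metis linorder_neqE_nat)
  have inj_k: "(f ^^ k) b = (f ^^ k) c \<Longrightarrow> b \<in> A \<Longrightarrow> c \<in> A \<Longrightarrow> b = c" for b c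
  proof (induction k arbitrary: b c)
    case (Suc k)
    have "f b \<in> A" "f c \<in> A" using Suc.prems(2,3) assms(3) by blast+
    moreover have "(f ^^ k) (f b) = (f ^^ k) (f c)"
      using Suc.prems(1) by (simp only: funpow_Suc_right comp_apply)
    ultimately have "f b = f c" by (metis Suc.IH)
    then show ?case by (rule inj_onD[OF assms(2)]) (rule Suc.prems)+
  qed simp
  have "l = k + (l - k)" using kl(1) by simp
  then have "(f ^^ l) a = (f ^^ k) ((f ^^ (l - k)) a)"
    by (metis comp_apply funpow_add)
  with kl(2) have "(f ^^ k) a = (f ^^ k) ((f ^^ (l - k)) a)" by simp
  then have "(f ^^ (l - k)) a = a"
    using inj_k[OF _ assms(4) mem] by metis
  then show ?thesis using kl(1) by (intro exI[of _ "l - k"]) auto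
qed

text \<open>The iterates stay in the line \<open>c + \<real> \<psi>\<close>, because the map only adds multiples of a fixed
  vector; the factors form a geometric series.\<close>

lemma transvection_power:
  fixes c \<psi> :: "nat \<Rightarrow> real" and j :: nat
  defines "h \<equiv> \<lambda>c. c + c j *\<^sub>R \<psi>"
  shows "(h ^^ n) c = c + ((\<Sum>k<n. (1 + \<psi> j) ^ k) * c j) *\<^sub>R \<psi>"
proof (induction n)
  case (Suc n)
  have "(1 + \<psi> j) ^ n = 1 + (\<Sum>k<n. (1 + \<psi> j) ^ k) * \<psi> j"
    using power_diff_1_eq[of "1 + \<psi> j" n] by (simp add: algebra_simps)
  note pow = this
  have "(h ^^ Suc n) c = h (c + ((\<Sum>k<n. (1 + \<psi> j) ^ k) * c j) *\<^sub>R \<psi>)"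
    by (simp only: funpow.simps comp_apply Suc)
  also have "\<dots> = c + ((\<Sum>k<Suc n. (1 + \<psi> j) ^ k) * c j) *\<^sub>R \<psi>"
    unfolding sum.lessThan_Suc pow by (simp add: h_def fun_eq_iff algebra_simps)
  finally show ?case .
qed simp

lemma geometric_sum_nonzero:
  fixes r :: real
  assumes "r \<noteq> -1" "n \<ge> 1"
  shows "(\<Sum>k<n. r ^ k) \<noteq> 0"
proof
  assume 0: "(\<Sum>k<n. r ^ k) = 0"
  then have 1: "r ^ n = 1" using power_diff_1_eq[of r n] by simp
  then have "\<bar>r\<bar> ^ n = 1" by (simp flip: power_abs)
  then have "\<bar>r\<bar> = 1" using assms(2) power_eq_imp_eq_base[of "\<bar>r\<bar>" n 1] by simp
  then have "r = 1" using assms by linarith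
  with 0 assms show False by simp
qed

text \<open>Suppose that two adjoint steps, differing only in the ratio at vertex \<open>j\<close>, both map a finite family of
  spaces into a family of the same size. Undoing one of them after the other gives a transvection
  \<open>c \<mapsto> c + c\<^sub>j \<psi>\<close> that permutes the family, so a power of it fixes
  \<open>X\<close>. That power adds a multiple of \<open>\<psi>\<close> to \<open>c\<close>; when the multiple is
  nonzero, \<open>\<psi>\<close> itself lies in \<open>X\<close>, and its image is proportional to the side form. The
  multiple can only vanish if the transvection is a reflection, \<open>\<psi>\<^sub>j = -2\<close>. In that case
  \<open>\<psi>\<close> would be in the kernel of the adjoint step whose ratio at \<open>j\<close> is the midpoint of
  the two, which the regularity assumption on the midpoint excludes.\<close>

lemma side_form_in_image:
  assumes d: "d \<ge> 2" and j: "j \<in> {1..d}" and ne: "y \<noteq> x j"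
    and reg: "regular d x" "regular d (x(j := y))" "regular d (x(j := (x j + y) / 2))"
    and fin: "finite \<X>" "finite \<X>'" "card \<X>' = card \<X>"
    and sub: "\<And>X. X \<in> \<X> \<Longrightarrow> subspace X \<and> X \<subseteq> vecs d"
    and img: "\<And>X. X \<in> \<X> \<Longrightarrow> adj d x ` X \<in> \<X>'"
      "\<And>X. X \<in> \<X> \<Longrightarrow> adj d (x(j := y)) ` X \<in> \<X>'"
    and X: "X \<in> \<X>" "c \<in> X" "c j \<noteq> 0"
  shows "side_form d j \<in> adj d x ` X"
proof -
  let ?T = "adj d x" and ?T' = "adj d (x(j := y))"
  have inj: "inj_on ((`) ?T) \<X>" "inj_on ((`) ?T') \<X>"
    using sub by (auto simp: inj_on_def inj_on_image_eq_iff[OF adj_inj] reg)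
  have surj: "((`) ?T) ` \<X> = \<X>'"
    using img(1) fin by (intro card_subset_eq) (auto simp: card_image[OF inj(1)])
  have "\<exists>X''\<in>\<X>. ?T' ` X' = ?T ` X''" if "X' \<in> \<X>" for X'
    using surj img(2)[OF that] by auto
  \<comment> \<open>Both maps are bijections between the families, so the perturbed image of X is also an
    unperturbed image. This makes the side form a value of the unperturbed map.\<close>
  from this[OF X(1)] obtain X'' where X'': "X'' \<in> \<X>" "?T' ` X = ?T ` X''" by blast
  have upd: "?T' c = ?T c + ((y - x j) * c j) *\<^sub>R side_form d j" for c
    by (rule adj_update[OF d j])
  have "?T' c \<in> ?T ` X''" using X X'' by blast
  then obtain c'' where c'': "c'' \<in> X''" "?T' c = ?T c''" by auto
  define t where "t = (y - x j) * c j"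
  have t: "t \<noteq> 0" using X ne by (auto simp: t_def)
  define \<phi> where "\<phi> = (1 / t) *\<^sub>R (c'' - c)"
  have \<phi>V: "\<phi> \<in> vecs d"
    using X X'' c'' sub subspace_vecs unfolding \<phi>_def
    by (meson in_mono subspace_diff subspace_scale)
  have T\<phi>: "?T \<phi> = side_form d j"
  proof -
    have "?T \<phi> = (1 / t) *\<^sub>R (?T c'' - ?T c)"
      unfolding \<phi>_def linear_scale[OF linear_adj] linear_diff[OF linear_adj] ..
    also have "?T c'' - ?T c = t *\<^sub>R side_form d j"
      unfolding c''(2)[symmetric] upd t_def by simp
    finally show ?thesis using t by simp
  qed
  define \<psi> where "\<psi> = (y - x j) *\<^sub>R \<phi>"
  have \<psi>V: "\<psi> \<in> vecs d" using \<phi>V subspace_vecs unfolding \<psi>_def by (rule subspace_scale[rotated])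
  \<comment> \<open>h is the unperturbed map's inverse composed with the perturbed map.\<close>
  define h where "h = (\<lambda>c. c + c j *\<^sub>R \<psi>)"
  have T\<psi>: "?T \<psi> = (y - x j) *\<^sub>R side_form d j"
    unfolding \<psi>_def linear_scale[OF linear_adj] T\<phi> ..
  have Th: "?T (h c) = ?T' c" for c
    unfolding h_def linear_add[OF linear_adj] linear_scale[OF linear_adj] T\<psi> upd
    by (simp add: mult.commute)
  have hV: "c \<in> vecs d \<Longrightarrow> h c \<in> vecs d" for c
    using \<psi>V by (auto simp: h_def vecs_def)
  have h_img: "h ` Y \<in> \<X>" if Y: "Y \<in> \<X>" for Y
  proof -
    obtain Y' where Y': "Y' \<in> \<X>" "?T' ` Y = ?T ` Y'" using surj img(2)[OF Y] by auto
    have "?T ` (h ` Y) = ?T ` Y'" using Y'(2) Th by (simp add: image_image)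
    then have "h ` Y = Y'"
      by (subst (asm) inj_on_image_eq_iff[OF adj_inj[OF reg(1)]]) (use sub Y Y' hV in auto)
    with Y' show ?thesis by simp
  qed
  have "inj_on ((`) h) \<X>"
  proof (rule inj_onI)
    fix Y Z assume "Y \<in> \<X>" "Z \<in> \<X>" "h ` Y = h ` Z"
    then have "?T ` (h ` Y) = ?T ` (h ` Z)" by simp
    then have "?T' ` Y = ?T' ` Z" by (simp only: image_image Th)
    then show "Y = Z" using \<open>Y \<in> \<X>\<close> \<open>Z \<in> \<X>\<close> by (rule inj_onD[OF inj(2)])
  qed
  then obtain n where n: "n \<ge> 1" "(((`) h) ^^ n) X = X"
    using self_map_returns[OF fin(1) _ _ X(1)] h_img by blast
  have "(((`) h) ^^ k) Y = (h ^^ k) ` Y" for k Y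
    by (induction k) (auto simp: image_image)
  with n have hn: "(h ^^ n) ` X = X" by simp
  define s where "s = (\<Sum>k<n. (1 + \<psi> j) ^ k)"
  have "(h ^^ n) c \<in> X" using hn X by blast
  then have "c + (s * c j) *\<^sub>R \<psi> \<in> X"
    by (simp add: h_def transvection_power s_def)
  then have "(c + (s * c j) *\<^sub>R \<psi>) - c \<in> X"
    using X sub by (blast intro: subspace_diff)
  then have mem: "(s * c j) *\<^sub>R \<psi> \<in> X" by simp
  \<comment> \<open>If \<psi> j = -2, then half of the perturbation cancels the unperturbed image of \<psi>.\<close>
  have "1 + \<psi> j \<noteq> -1"
  proof
    assume "1 + \<psi> j = -1"
    then have "\<psi> j = -2" by simp
    let ?Ta = "adj d (x(j := (x j + y) / 2))"
    have "?Ta \<psi> = ?T \<psi> + (((x j + y) / 2 - x j) * \<psi> j) *\<^sub>R side_form d j"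
      by (rule adj_update[OF d j])
    also have "\<dots> = 0"
      unfolding T\<psi> \<open>\<psi> j = -2\<close> by (simp add: fun_eq_iff field_simps)
    finally have "\<psi> = 0" by (rule adj_kernel[OF reg(3) _ \<psi>V])
    with \<open>\<psi> j = -2\<close> show False by simp
  qed
  then have "s \<noteq> 0" unfolding s_def using n by (intro geometric_sum_nonzero)
  then have "\<phi> = (1 / (s * c j * (y - x j))) *\<^sub>R (s * c j) *\<^sub>R \<psi>"
    using X ne by (simp add: \<psi>_def)
  then have "\<phi> \<in> X" using mem X sub by (metis subspace_scale)
  with T\<phi> show ?thesis by (metis imageI)
qed

section \<open>Spaces of linear forms\<close>

text \<open>Dimension is expressed by a basis, which also makes the annihilation events finite intersections.\<close>

definition subspaces_of_dim :: "nat \<Rightarrow> nat \<Rightarrow> (nat \<Rightarrow> real) set set" where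
  "subspaces_of_dim d n = {span F |F. F \<subseteq> vecs d \<and> finite F \<and> independent F \<and> card F = n}"

lemma subspaces_of_dimE:
  assumes "X \<in> subspaces_of_dim d n"
  obtains F where "X = span F" "F \<subseteq> vecs d" "finite F" "independent F" "card F = n"
  using assms by (auto simp: subspaces_of_dim_def)

lemma subspaces_of_dim_subspace:
  "X \<in> subspaces_of_dim d n \<Longrightarrow> subspace X \<and> X \<subseteq> vecs d"
  by (auto simp: subspaces_of_dim_def intro: span_minimal[THEN subsetD, OF _ subspace_vecs])

lemma subspaces_of_dim_nontrivial:
  assumes "X \<in> subspaces_of_dim d n" "n \<ge> 1" shows "X \<noteq> {0}"
proof
  assume "X = {0}"
  moreover obtain F where F: "X = span F" "independent F" "card F = n"
    by (rule subspaces_of_dimE[OF assms(1)])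
  ultimately have "F \<subseteq> {0}" using span_superset[of F] by simp
  moreover have "0 \<notin> F" using F(2) dependent_zero by blast
  ultimately have "F = {}" by blast
  with F(3) assms(2) show False by simp
qed

lemma vecs_span: "vecs d \<subseteq> span (unit_vec ` {1..d})"
proof
  fix c assume c: "c \<in> vecs d"
  have "c = (\<Sum>i\<in>{1..d}. c i *\<^sub>R unit_vec i)"
  proof
    fix k
    have *: "(\<Sum>i\<in>I. c i *\<^sub>R unit_vec i) k = (\<Sum>i\<in>I. if k = i then c i else 0)" if "finite I" for I
      using that by (induction I rule: finite_induct) (auto simp: unit_vec_def)
    show "c k = (\<Sum>i\<in>{1..d}. c i *\<^sub>R unit_vec i) k"
      unfolding *[OF finite_atLeastAtMost] using c by (auto simp: vecs_def)
  qed
  then show "c \<in> span (unit_vec ` {1..d})"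
    by (metis (no_types, lifting) imageI span_base span_scale span_sum)
qed

lemma subspaces_of_dim_bound:
  assumes "X \<in> subspaces_of_dim d n" shows "n \<le> d"
proof -
  from assms obtain F where F: "F \<subseteq> vecs d" "independent F" "card F = n"
    by (auto elim: subspaces_of_dimE)
  have "card F \<le> card (unit_vec ` {1..d})"
    using independent_span_bound[of "unit_vec ` {1..d}" F] F vecs_span by blast
  also have "\<dots> \<le> d" using card_image_le[of "{1..d}" unit_vec] by simp
  finally show ?thesis using F by simp
qed

lemma subspaces_of_dim_adj:
  assumes X: "X \<in> subspaces_of_dim d n" and "regular d x"
  shows "adj d x ` X \<in> subspaces_of_dim d n"
proof -
  obtain F where F: "X = span F" "F \<subseteq> vecs d" "finite F" "independent F" "card F = n"
    by (rule subspaces_of_dimE[OF X])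
  have inj: "inj_on (adj d x) (span F)"
    using adj_inj[OF assms(2)] subspaces_of_dim_subspace[OF X] F(1) by (blast intro: inj_on_subset)
  have "adj d x ` X = span (adj d x ` F)"
    unfolding F(1) by (rule linear_span_image[symmetric, OF linear_adj])
  moreover have "independent (adj d x ` F)"
    using linear_independent_injective_image[OF linear_adj F(4) inj] .
  moreover have "card (adj d x ` F) = n"
    using card_image[of "adj d x" F] inj F(5) span_superset by (metis inj_on_subset)
  ultimately show ?thesis
    unfolding subspaces_of_dim_def using F(3) adj_in_vecs by blast
qed

text \<open>A basis of \<open>X\<close> together with one basis vector of \<open>Y\<close> outside \<open>X\<close>; if there
  were none, then \<open>Y\<close> would be contained in \<open>X\<close> and, having the same dimension, be equal to
  it.\<close>

lemma subspaces_of_dim_join: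
  assumes X: "X \<in> subspaces_of_dim d n" and Y: "Y \<in> subspaces_of_dim d n" and "X \<noteq> Y"
  obtains Z where "Z \<in> subspaces_of_dim d (Suc n)" "Z \<subseteq> span (X \<union> Y)"
proof -
  obtain F where F: "X = span F" "F \<subseteq> vecs d" "finite F" "independent F" "card F = n"
    by (rule subspaces_of_dimE[OF X])
  obtain G where G: "Y = span G" "G \<subseteq> vecs d" "finite G" "independent G" "card G = n"
    by (rule subspaces_of_dimE[OF Y])
  have "\<exists>g\<in>G. g \<notin> span F"
  proof (rule ccontr)
    assume "\<not> ?thesis"
    then have GF: "G \<subseteq> span F" by blast
    have "F \<subseteq> span G"
    proof (rule ccontr)
      assume "\<not> F \<subseteq> span G"
      then obtain f where f: "f \<in> F" "f \<notin> span G" by blast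
      then have "f \<notin> G" using span_superset by blast
      have "independent (insert f G)" using f G by (intro independent_insertI)
      moreover have "insert f G \<subseteq> span F" using f GF span_superset by blast
      ultimately have "card (insert f G) \<le> card F"
        using independent_span_bound[OF F(3)] by blast
      with \<open>f \<notin> G\<close> F G show False by simp
    qed
    with GF have "span F = span G"
      by (intro equalityI span_minimal subspace_span) auto
    with F G \<open>X \<noteq> Y\<close> show False by simp
  qed
  then obtain g where g: "g \<in> G" "g \<notin> span F" by blast
  then have gF: "g \<notin> F" using span_superset by blast
  show ?thesis
  proof
    show "span (insert g F) \<in> subspaces_of_dim d (Suc n)"
      unfolding subspaces_of_dim_def
      using g F G gF independent_insertI[OF g(2) F(4)] by (auto intro!: exI[of _ "insert g F"])
    show "span (insert g F) \<subseteq> span (X \<union> Y)"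
      using g F(1) G(1) span_superset by (intro span_mono) blast
  qed
qed

lemma pairing_linear1: "linear (\<lambda>c. pairing d c a)"
  by (rule linearI) (simp_all add: pairing_def algebra_simps sum.distrib sum_distrib_left)

lemma pairing_zero_on_span:
  "(\<forall>c\<in>span F. pairing d c a = 0) \<longleftrightarrow> (\<forall>c\<in>F. pairing d c a = 0)"
proof
  assume *: "\<forall>c\<in>F. pairing d c a = 0"
  have "subspace {c. pairing d c a = 0}"
    using linear_subspace_kernel[OF pairing_linear1] .
  then have "span F \<subseteq> {c. pairing d c a = 0}"
    using * by (intro span_minimal) auto
  then show "\<forall>c\<in>span F. pairing d c a = 0" by blast
qed (simp add: span_base)

lemma pairing_side_form:
  assumes "j \<in> {1..d}" shows "pairing d (side_form d j) a = a (j mod d + 1) - a j"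
proof -
  have "pairing d (unit_vec k) a = a k" if "k \<in> {1..d}" for k
    using that by (simp add: pairing_def unit_vec_def if_distrib[of "\<lambda>t. t * _"] cong: if_cong)
  from this[OF assms] this[OF cyc_mem[OF assms]] show ?thesis
    unfolding side_form_def linear_diff[OF pairing_linear1] by simp
qed

lemma cyclic_constant:
  fixes d :: nat
  assumes "\<And>j. j \<in> {1..d} \<Longrightarrow> a (j mod d + 1) = a j" and "i \<in> {1..d}"
  shows "a i = a 1"
proof -
  have "k < d \<Longrightarrow> a (Suc k) = a 1" for k
  proof (induction k)
    case (Suc k)
    then show ?case using assms(1)[of "Suc k"] by simp
  qed simp
  from this[of "i - 1"] assms(2) show ?thesis by auto
qed

section \<open>The random evolution\<close>

text \<open>Vertices are numbered from \<open>1\<close>; keeping this numeral in intervals \<open>{1..d}\<close> gives them one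
  syntactic form.\<close>

declare One_nat_def [simp del]

lemma evolve_add:
  "evolve d \<omega> (n + k) a = evolve d (\<lambda>m. \<omega> (n + m)) k (evolve d \<omega> n a)"
  by (induction k) auto

lemma evolve_cong:
  assumes "\<And>m. m < n \<Longrightarrow> \<omega> m = \<omega>' m"
  shows "evolve d \<omega> n a = evolve d \<omega>' n a"
  using assms by (induction n) auto

lemma evolve_comb_seq_past: "k \<le> n \<Longrightarrow> evolve d (comb_seq n \<omega> \<omega>') k a = evolve d \<omega> k a"
  by (intro evolve_cong) (simp add: comb_seq_less)

text \<open>With \<open>comb_seq n \<omega> \<omega>'\<close>, which follows \<open>\<omega>\<close> up to time
  \<open>n\<close> and \<open>\<omega>'\<close> afterwards, this is the Markov property on the level of paths.\<close>

lemma evolve_comb_seq: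
  "evolve d (comb_seq n \<omega> \<omega>') (n + k) a = evolve d \<omega>' k (evolve d \<omega> n a)"
proof -
  have "(\<lambda>m. comb_seq n \<omega> \<omega>' (n + m)) = \<omega>'"
    by (simp add: fun_eq_iff comb_seq_def)
  then show ?thesis by (simp add: evolve_add evolve_comb_seq_past)
qed

lemma evolve_local:
  assumes "\<And>i. i \<in> {1..d} \<Longrightarrow> a i = b i" "i \<in> {1..d}"
  shows "evolve d \<omega> n a i = evolve d \<omega> n b i"
  using assms(2)
proof (induction n arbitrary: i)
  case (Suc n)
  then show ?case using Suc.IH[OF Suc.prems] Suc.IH[OF cyc_mem[OF Suc.prems]]
    by (simp add: step_def)
qed (use assms in auto)

lemma step_linear: "linear (step d x)"
  by (rule linearI) (auto simp: step_def fun_eq_iff algebra_simps)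

lemma evolve_linear: "linear (evolve d \<omega> n :: (nat \<Rightarrow> 'v::real_vector) \<Rightarrow> _)"
proof (induction n)
  case 0
  show ?case by (rule linearI) auto
next
  case (Suc n)
  have "(evolve d \<omega> (Suc n) :: (nat \<Rightarrow> 'v) \<Rightarrow> _) = step d (\<omega> n) \<circ> evolve d \<omega> n"
    by (simp add: fun_eq_iff)
  then show ?case by (simp only:) (rule linear_compose[OF Suc step_linear])
qed

lemma evolve_const: "evolve d \<omega> n (\<lambda>_. c) = (\<lambda>_. c)"
  by (induction n) (auto simp: step_def fun_eq_iff algebra_simps)

text \<open>The law \<open>\<mu>\<close> of a splitting ratio, on the canonical space of independent ratio sequences. Steps
  whose ratios are near the support points \<open>p\<close> and \<open>q\<close> are the ones that can be steered.\<close>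

locale subdivision_law = prob_space \<mu> for \<mu> :: "real measure" +
  fixes d :: nat and p q :: real
  assumes d3: "d \<ge> 3"
    and sets_mu [measurable_cong, simp]: "sets \<mu> = sets borel"
    and mu_unit: "AE t in \<mu>. t \<in> {0<..<1}"
    and prod_ne: "even d \<Longrightarrow> AE x in PiM {1..d} (\<lambda>_. \<mu>). (\<Prod>i=1..d. (1 - x i) / x i) \<noteq> 1"
    and pq: "p \<in> {0<..<1}" "q \<in> {0<..<1}" "p \<noteq> q"
    and p_charged: "\<And>U. open U \<Longrightarrow> p \<in> U \<Longrightarrow> measure \<mu> U > 0"
    and q_charged: "\<And>U. open U \<Longrightarrow> q \<in> U \<Longrightarrow> measure \<mu> U > 0"
begin

abbreviation ratios :: "(nat \<Rightarrow> real) measure" where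
  "ratios \<equiv> PiM {1..d} (\<lambda>_. \<mu>)"

sublocale ratios: prob_space ratios
  by (intro prob_space_PiM prob_space_axioms)

sublocale seqs: sequence_space ratios ..

abbreviation seqs :: "(nat \<Rightarrow> nat \<Rightarrow> real) measure" where
  "seqs \<equiv> PiM UNIV (\<lambda>_. ratios)"

sublocale seqs: prob_space seqs
  by (intro prob_space_PiM ratios.prob_space_axioms)

lemma AE_regular: "AE x in ratios. regular d x"
proof -
  have "AE x in ratios. x i \<in> {0<..<1}" if "i \<in> {1..d}" for i
    using that mu_unit prob_space_axioms by (intro AE_PiM_component) auto
  then have "AE x in ratios. \<forall>i\<in>{1..d}. x i \<in> {0<..<1}"
    by (intro AE_finite_allI) auto
  moreover have "AE x in ratios. even d \<longrightarrow> (\<Prod>i=1..d. (1 - x i) / x i) \<noteq> 1"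
    using prod_ne by (cases "even d") auto
  ultimately show ?thesis
    unfolding regular_def by eventually_elim blast
qed

lemma AE_seqs_regular: "AE \<omega> in seqs. \<forall>n. regular d (\<omega> n)"
proof -
  have "AE \<omega> in seqs. regular d (\<omega> n)" for n
    using AE_regular ratios.prob_space_axioms by (intro AE_PiM_component) auto
  then show ?thesis by (simp add: AE_all_countable)
qed

lemma evolve_meas [measurable]:
  fixes a :: "nat \<Rightarrow> 'v::{real_normed_vector, second_countable_topology}"
  assumes "i \<in> {1..d}"
  shows "(\<lambda>\<omega>. evolve d \<omega> n a i) \<in> borel_measurable seqs"
  using assms
proof (induction n arbitrary: i)
  case (Suc n)
  have "(\<lambda>\<omega>. \<omega> n i) \<in> measurable seqs \<mu>"
    using Suc.prems
    by (intro measurable_compose[of "\<lambda>\<omega>. \<omega> n" seqs ratios "\<lambda>x. x i"] measurable_component_singleton) auto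
  then have [measurable]: "(\<lambda>\<omega>. \<omega> n i) \<in> borel_measurable seqs"
    by (simp cong: measurable_cong_sets)
  have [measurable]: "(\<lambda>\<omega>. evolve d \<omega> n a i) \<in> borel_measurable seqs"
    "(\<lambda>\<omega>. evolve d \<omega> n a (i mod d + 1)) \<in> borel_measurable seqs"
    by (intro Suc cyc_mem)+
  show ?case by (simp only: evolve.simps step_def) measurable
qed simp

lemma comb_seq_section:
  assumes "\<omega> \<in> space seqs" and B: "{\<omega>\<in>space seqs. B \<omega>} \<in> sets seqs"
  shows "{\<omega>'\<in>space seqs. B (comb_seq k \<omega> \<omega>')} \<in> sets seqs"
proof -
  have "(\<lambda>\<omega>'. comb_seq k \<omega> \<omega>') = (\<lambda>(\<omega>, \<omega>'). comb_seq k \<omega> \<omega>') \<circ> (\<lambda>\<omega>'. (\<omega>, \<omega>'))" by auto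
  also have "\<dots> \<in> measurable seqs seqs"
    by (rule measurable_comp[OF measurable_Pair1'[OF assms(1)] measurable_comb_seq])
  finally have cm: "(\<lambda>\<omega>'. comb_seq k \<omega> \<omega>') \<in> measurable seqs seqs" .
  have "{\<omega>'\<in>space seqs. B (comb_seq k \<omega> \<omega>')} = (\<lambda>\<omega>'. comb_seq k \<omega> \<omega>') -` {\<omega>\<in>space seqs. B \<omega>} \<inter> space seqs"
    using measurable_space[OF cm] by auto
  then show ?thesis using measurable_sets[OF cm B] by simp
qed

text \<open>Fubini for the path up to time \<open>n\<close> and the independent path after it.\<close>

lemma split_past:
  assumes [measurable]: "{\<omega>\<in>space seqs. Q \<omega>} \<in> sets seqs"
  shows "(\<lambda>\<omega>. seqs.prob {\<omega>'\<in>space seqs. Q (comb_seq n \<omega> \<omega>')}) \<in> borel_measurable seqs"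
    and "seqs.prob {\<omega>\<in>space seqs. Q \<omega>} =
      (\<integral>\<omega>. seqs.prob {\<omega>'\<in>space seqs. Q (comb_seq n \<omega> \<omega>')} \<partial>seqs)"
proof -
  let ?P = "seqs \<Otimes>\<^sub>M seqs"
  interpret pair: pair_prob_space seqs seqs ..
  let ?A = "{z\<in>space ?P. Q (comb_seq n (fst z) (snd z))}"
  have A: "?A = (\<lambda>(\<omega>, \<omega>'). comb_seq n \<omega> \<omega>') -` {\<omega>\<in>space seqs. Q \<omega>} \<inter> space ?P"
    using measurable_space[OF measurable_comb_seq[of n ratios]] by (auto simp: case_prod_beta)
  have [measurable]: "?A \<in> sets ?P"
    unfolding A by (rule measurable_sets[OF measurable_comb_seq assms])
  have sec: "Pair \<omega> -` ?A = {\<omega>'\<in>space seqs. Q (comb_seq n \<omega> \<omega>')}" if "\<omega> \<in> space seqs" for \<omega>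
    using that by (auto simp: space_pair_measure)
  have m: "(\<lambda>\<omega>. seqs.prob (Pair \<omega> -` ?A)) \<in> borel_measurable seqs"
    unfolding measure_def
    by (intro borel_measurable_enn2real seqs.measurable_emeasure_Pair) measurable
  show m': "(\<lambda>\<omega>. seqs.prob {\<omega>'\<in>space seqs. Q (comb_seq n \<omega> \<omega>')}) \<in> borel_measurable seqs"
    using m by (rule measurable_cong[THEN iffD1, rotated]) (simp only: sec)
  have "emeasure seqs {\<omega>\<in>space seqs. Q \<omega>} =
      emeasure (distr ?P seqs (\<lambda>(\<omega>, \<omega>'). comb_seq n \<omega> \<omega>')) {\<omega>\<in>space seqs. Q \<omega>}"
    by (simp only: seqs.PiM_comb_seq)
  also have "\<dots> = emeasure ?P ?A"
    unfolding A by (rule emeasure_distr[OF measurable_comb_seq assms])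
  also have "\<dots> = (\<integral>\<^sup>+\<omega>. emeasure seqs (Pair \<omega> -` ?A) \<partial>seqs)"
    by (rule seqs.emeasure_pair_measure_alt) measurable
  also have "\<dots> = (\<integral>\<^sup>+\<omega>. ennreal (seqs.prob {\<omega>'\<in>space seqs. Q (comb_seq n \<omega> \<omega>')}) \<partial>seqs)"
    by (intro nn_integral_cong) (simp only: sec seqs.emeasure_eq_measure)
  also have "\<dots> = ennreal (\<integral>\<omega>. seqs.prob {\<omega>'\<in>space seqs. Q (comb_seq n \<omega> \<omega>')} \<partial>seqs)"
    by (intro nn_integral_eq_integral seqs.integrable_const_bound[where B = 1] AE_I2 m')
      (simp_all only: measure_nonneg real_norm_def abs_of_nonneg seqs.prob_le_1)
  finally show "seqs.prob {\<omega>\<in>space seqs. Q \<omega>} =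
      (\<integral>\<omega>. seqs.prob {\<omega>'\<in>space seqs. Q (comb_seq n \<omega> \<omega>')} \<partial>seqs)"
    by (simp add: seqs.emeasure_eq_measure)
qed

lemma distr_first: "distr seqs ratios (\<lambda>\<omega>. \<omega> 0) = ratios"
  using seqs.PiM_component[of 0] by simp

text \<open>Conditioning on the ratios of step \<open>n\<close> alone, for an event that otherwise depends only on earlier
  steps. The next ratios are the first ones of an independent copy of the path, so the pair of the past and these
  ratios has the product law.\<close>

lemma split_last:
  assumes meas: "{z\<in>space (seqs \<Otimes>\<^sub>M ratios). Q (fst z) (snd z)} \<in> sets (seqs \<Otimes>\<^sub>M ratios)"
    and past: "\<And>\<omega> \<omega>' x. Q (comb_seq n \<omega> \<omega>') x = Q \<omega> x"
  shows "(\<lambda>x. seqs.prob {\<omega>\<in>space seqs. Q \<omega> x}) \<in> borel_measurable ratios"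
    and "seqs.prob {\<omega>\<in>space seqs. Q \<omega> (\<omega> n)} = (\<integral>x. seqs.prob {\<omega>\<in>space seqs. Q \<omega> x} \<partial>ratios)"
proof -
  interpret sr: pair_prob_space seqs ratios ..
  let ?P = "seqs \<Otimes>\<^sub>M seqs" and ?A = "{z\<in>space (seqs \<Otimes>\<^sub>M ratios). Q (fst z) (snd z)}"
  let ?f = "\<lambda>(\<omega>, \<omega>'). (\<omega>, \<omega>' 0) :: (nat \<Rightarrow> nat \<Rightarrow> real) \<times> (nat \<Rightarrow> real)"
  let ?g = "\<lambda>(\<omega>, \<omega>'). comb_seq n \<omega> \<omega>' :: nat \<Rightarrow> nat \<Rightarrow> real"
  have [measurable]: "?A \<in> sets (seqs \<Otimes>\<^sub>M ratios)" by (rule meas)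
  have [measurable]: "(\<lambda>\<omega>. \<omega> k) \<in> measurable seqs ratios" for k
    by (rule measurable_component_singleton) simp
  have f [measurable]: "?f \<in> measurable ?P (seqs \<Otimes>\<^sub>M ratios)"
    unfolding case_prod_beta by measurable
  have g [measurable]: "?g \<in> measurable ?P seqs" by (rule measurable_comb_seq)
  have sec: "(\<lambda>\<omega>. (\<omega>, x)) -` ?A = {\<omega>\<in>space seqs. Q \<omega> x}" if "x \<in> space ratios" for x
    using that by (auto simp: space_pair_measure)
  have m: "(\<lambda>x. emeasure seqs ((\<lambda>\<omega>. (\<omega>, x)) -` ?A)) \<in> borel_measurable ratios"
    by (rule sr.measurable_emeasure_Pair2) measurable
  have m': "(\<lambda>x. emeasure seqs {\<omega>\<in>space seqs. Q \<omega> x}) \<in> borel_measurable ratios"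
    using m by (rule measurable_cong[THEN iffD1, rotated]) (simp only: sec)
  then show m'': "(\<lambda>x. seqs.prob {\<omega>\<in>space seqs. Q \<omega> x}) \<in> borel_measurable ratios"
    unfolding measure_def by (rule borel_measurable_enn2real)
  have Qs: "{\<omega>\<in>space seqs. Q \<omega> (\<omega> n)} = (\<lambda>\<omega>. (\<omega>, \<omega> n)) -` ?A \<inter> space seqs"
    using measurable_space[of "\<lambda>\<omega>. \<omega> n" seqs ratios] by (auto simp: space_pair_measure)
  have Qm: "{\<omega>\<in>space seqs. Q \<omega> (\<omega> n)} \<in> sets seqs"
    unfolding Qs by (rule measurable_sets[of _ _ "seqs \<Otimes>\<^sub>M ratios"]) measurable
  have "emeasure seqs {\<omega>\<in>space seqs. Q \<omega> (\<omega> n)} =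
      emeasure (distr ?P seqs ?g) {\<omega>\<in>space seqs. Q \<omega> (\<omega> n)}"
    by (simp only: seqs.PiM_comb_seq)
  also have "\<dots> = emeasure ?P (?g -` {\<omega>\<in>space seqs. Q \<omega> (\<omega> n)} \<inter> space ?P)"
    by (rule emeasure_distr[OF g Qm])
  also have "?g -` {\<omega>\<in>space seqs. Q \<omega> (\<omega> n)} \<inter> space ?P = ?f -` ?A \<inter> space ?P"
    using measurable_space[OF g] measurable_space[OF f]
    by (auto simp: past comb_seq_def case_prod_beta)
  also have "emeasure ?P (?f -` ?A \<inter> space ?P) = emeasure (distr ?P (seqs \<Otimes>\<^sub>M ratios) ?f) ?A"
    by (rule emeasure_distr[symmetric, OF f meas])
  also have "distr ?P (seqs \<Otimes>\<^sub>M ratios) ?f = seqs \<Otimes>\<^sub>M ratios"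
  proof -
    have "distr seqs seqs (\<lambda>\<omega>. \<omega>) \<Otimes>\<^sub>M distr seqs ratios (\<lambda>\<omega>. \<omega> 0) =
        distr ?P (seqs \<Otimes>\<^sub>M ratios) (\<lambda>(\<omega>, \<omega>'). (\<omega>, \<omega>' 0))"
      by (rule pair_measure_distr) (simp, simp, unfold distr_first, rule ratios.sigma_finite_measure_axioms)
    then show ?thesis unfolding distr_first distr_id by simp
  qed
  also have "emeasure (seqs \<Otimes>\<^sub>M ratios) ?A = (\<integral>\<^sup>+x. emeasure seqs ((\<lambda>\<omega>. (\<omega>, x)) -` ?A) \<partial>ratios)"
    by (rule sr.emeasure_pair_measure_alt2) measurable
  also have "\<dots> = (\<integral>\<^sup>+x. ennreal (seqs.prob {\<omega>\<in>space seqs. Q \<omega> x}) \<partial>ratios)"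
    by (intro nn_integral_cong) (simp only: sec seqs.emeasure_eq_measure)
  also have "\<dots> = ennreal (\<integral>x. seqs.prob {\<omega>\<in>space seqs. Q \<omega> x} \<partial>ratios)"
    by (intro nn_integral_eq_integral ratios.integrable_const_bound[where B = 1] AE_I2 m'')
      (simp_all only: measure_nonneg real_norm_def abs_of_nonneg seqs.prob_le_1)
  finally show "seqs.prob {\<omega>\<in>space seqs. Q \<omega> (\<omega> n)} = (\<integral>x. seqs.prob {\<omega>\<in>space seqs. Q \<omega> x} \<partial>ratios)"
    by (simp add: seqs.emeasure_eq_measure)
qed

section \<open>Probability of being annihilated by a space of forms\<close>

definition nonconstant :: "(nat \<Rightarrow> 'v) \<Rightarrow> bool" where
  "nonconstant a \<longleftrightarrow> (\<exists>i\<in>{1..d}. a i \<noteq> a 1)"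

lemma step_nonconstant:
  fixes a :: "nat \<Rightarrow> real"
  assumes "nonconstant a" "regular d x" shows "nonconstant (step d x a)"
proof (rule ccontr)
  assume *: "\<not> nonconstant (step d x a)"
  have eq: "step d x (\<lambda>i. a i - step d x a 1) k = step d x a k - step d x a 1" for k
    by (simp add: step_def algebra_simps)
  have z: "step d x (\<lambda>i. a i - step d x a 1) k = 0" if "k \<in> {1..d}" for k
    unfolding eq using * that unfolding nonconstant_def by (metis diff_self)
  have all: "a i = step d x a 1" if "i \<in> {1..d}" for i
    using step_injective[OF assms(2) z that] by simp
  have "a i = a 1" if "i \<in> {1..d}" for i
    using all[OF that] all[of 1] d3 by simp
  then show False using assms(1) unfolding nonconstant_def by blast
qed

lemma AE_evolve_nonconstant:
  assumes "nonconstant (w :: nat \<Rightarrow> real)"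
  shows "AE \<omega> in seqs. \<forall>j. nonconstant (evolve d \<omega> j w)"
  using AE_seqs_regular
proof eventually_elim
  case (elim \<omega>)
  have "nonconstant (evolve d \<omega> j w)" for j
    by (induction j) (use assms elim step_nonconstant in auto)
  then show ?case by blast
qed

definition mass :: "nat \<Rightarrow> (nat \<Rightarrow> real) \<Rightarrow> (nat \<Rightarrow> real) set \<Rightarrow> real" where
  "mass j w X = seqs.prob {\<omega>\<in>space seqs. \<forall>c\<in>X. pairing d c (evolve d \<omega> j w) = 0}"

lemma pairing_evolve_meas [measurable]:
  "(\<lambda>\<omega>. pairing d c (evolve d \<omega> j w)) \<in> borel_measurable seqs"
  unfolding pairing_def
  by (intro borel_measurable_sum borel_measurable_times borel_measurable_const evolve_meas)

lemma mass_event: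
  assumes "X \<in> subspaces_of_dim d n"
  shows "{\<omega>\<in>space seqs. \<forall>c\<in>X. pairing d c (evolve d \<omega> j w) = 0} \<in> sets seqs"
proof -
  obtain F where F: "X = span F" "finite F" by (rule subspaces_of_dimE[OF assms])
  show ?thesis
    unfolding F(1) pairing_zero_on_span using F(2) by measurable
qed

text \<open>Transposing the last step: the evolved sequence is annihilated by \<open>X\<close> at time \<open>j + 1\<close>
  if and only if it is annihilated by the random space \<open>adj d x ` X\<close> at time \<open>j\<close>.\<close>

lemma mass_Suc:
  assumes X: "X \<in> subspaces_of_dim d n"
  shows "(\<lambda>x. mass j w (adj d x ` X)) \<in> borel_measurable ratios"
    and "mass (Suc j) w X = (\<integral>x. mass j w (adj d x ` X) \<partial>ratios)"
proof -
  obtain F where F: "X = span F" "finite F" by (rule subspaces_of_dimE[OF assms])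
  let ?Q = "\<lambda>\<omega> x. \<forall>c\<in>X. pairing d c (step d x (evolve d \<omega> j w)) = 0"
  have [measurable]: "(\<lambda>x. x i) \<in> borel_measurable ratios" if "i \<in> {1..d}" for i
    using measurable_component_singleton[of i "{1..d}" "\<lambda>_. \<mu>"] that
    by (simp cong: measurable_cong_sets)
  have m: "(\<lambda>z. step d (snd z) (evolve d (fst z) j w) i) \<in> borel_measurable (seqs \<Otimes>\<^sub>M ratios)"
    if "i \<in> {1..d}" for i
  proof -
    have [measurable]: "(\<lambda>z. evolve d (fst z) j w i) \<in> borel_measurable (seqs \<Otimes>\<^sub>M ratios)"
      if "i \<in> {1..d}" for i
      by (rule measurable_compose[OF measurable_fst evolve_meas[OF that]])
    note [measurable] = this[OF that] this[OF cyc_mem[OF that]]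
    have [measurable]: "(\<lambda>z. snd z i) \<in> borel_measurable (seqs \<Otimes>\<^sub>M ratios)"
      by (rule measurable_compose[OF measurable_snd]) (use that in measurable)
    show ?thesis unfolding step_def by measurable
  qed
  have "(\<lambda>z. pairing d c (step d (snd z) (evolve d (fst z) j w))) \<in> borel_measurable (seqs \<Otimes>\<^sub>M ratios)" for c
    unfolding pairing_def by (intro borel_measurable_sum borel_measurable_times borel_measurable_const m)
  note [measurable] = this
  have meas: "{z\<in>space (seqs \<Otimes>\<^sub>M ratios). ?Q (fst z) (snd z)} \<in> sets (seqs \<Otimes>\<^sub>M ratios)"
    unfolding F(1) pairing_zero_on_span using F(2) by measurable
  have eq: "mass j w (adj d x ` X) = seqs.prob {\<omega>\<in>space seqs. ?Q \<omega> x}" for x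
    by (simp add: mass_def pairing_step)
  show "(\<lambda>x. mass j w (adj d x ` X)) \<in> borel_measurable ratios"
    unfolding eq by (rule split_last(1)[OF meas, of j]) (simp add: evolve_comb_seq_past)
  show "mass (Suc j) w X = (\<integral>x. mass j w (adj d x ` X) \<partial>ratios)"
    unfolding eq unfolding mass_def evolve.simps
    by (rule split_last(2)[OF meas, of j]) (simp add: evolve_comb_seq_past)
qed

lemma mass_bounds: "0 \<le> mass j w X" "mass j w X \<le> 1"
  by (auto simp: mass_def)

lemma mass_integrable:
  assumes "X \<in> subspaces_of_dim d n"
  shows "integrable ratios (\<lambda>x. mass j w (adj d x ` X))"
  by (rule ratios.integrable_const_bound[where B = 1]) (use mass_Suc(1)[OF assms] mass_bounds in auto)

text \<open>The extra \<open>0\<close> keeps the supremum meaningful for \<open>n > d\<close>, where there are no spaces.\<close>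

definition max_mass :: "nat \<Rightarrow> nat \<Rightarrow> real" where
  "max_mass n j = Sup (insert 0 {mass j w X |w X. nonconstant w \<and> X \<in> subspaces_of_dim d n})"

lemma max_mass_bdd:
  "bdd_above (insert 0 {mass j w X |w X. nonconstant w \<and> X \<in> subspaces_of_dim d n})"
  by (rule bdd_aboveI[of _ 1]) (auto simp: mass_bounds)

lemma mass_le_max_mass:
  "nonconstant w \<Longrightarrow> X \<in> subspaces_of_dim d n \<Longrightarrow> mass j w X \<le> max_mass n j"
  unfolding max_mass_def by (rule cSup_upper[OF _ max_mass_bdd]) blast

lemma max_mass_nonneg: "0 \<le> max_mass n j"
  unfolding max_mass_def by (rule cSup_upper[OF _ max_mass_bdd]) blast

text \<open>An average of masses at time \<open>j\<close> over spaces of the same dimension.\<close>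

lemma max_mass_Suc: "max_mass n (Suc j) \<le> max_mass n j"
  unfolding max_mass_def[of n "Suc j"]
proof (rule cSup_least)
  fix v assume "v \<in> insert 0 {mass (Suc j) w X |w X. nonconstant w \<and> X \<in> subspaces_of_dim d n}"
  then consider "v = 0"
    | w X where "v = mass (Suc j) w X" "nonconstant w" "X \<in> subspaces_of_dim d n" by blast
  then show "v \<le> max_mass n j"
  proof cases
    case 2
    have "AE x in ratios. mass j w (adj d x ` X) \<le> max_mass n j"
      using AE_regular by eventually_elim (intro mass_le_max_mass 2 subspaces_of_dim_adj)
    then have "(\<integral>x. mass j w (adj d x ` X) \<partial>ratios) \<le> (\<integral>x. max_mass n j \<partial>ratios)"
      by (intro integral_mono_AE mass_integrable[OF 2(3)]) auto
    then show ?thesis by (simp add: 2(1) mass_Suc(2)[OF 2(3)] ratios.prob_space)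
  qed (simp add: max_mass_nonneg)
qed simp

lemma max_mass_decreasing: "j \<le> k \<Longrightarrow> max_mass n k \<le> max_mass n j"
  by (rule lift_Suc_antimono_le[of "max_mass n"]) (rule max_mass_Suc)

end

text \<open>If \<open>S\<close> counts the events that occur, then \<open>S \<le> 1 + S (S - 1)\<close>, because
  \<open>(S - 1)\<^sup>2 \<ge> 0\<close>; this is the expectation of that inequality. Events whose pairwise
  intersections are negligible behave as if they were disjoint.\<close>

lemma (in prob_space) sum_prob_le_pairwise:
  assumes "finite I" and [measurable]: "\<And>i. i \<in> I \<Longrightarrow> E i \<in> events"
  shows "(\<Sum>i\<in>I. prob (E i)) \<le> 1 + (\<Sum>i\<in>I. \<Sum>j\<in>I - {i}. prob (E i \<inter> E j))"
proof -
  let ?f = "\<lambda>i \<omega>. indicator (E i) \<omega> :: real"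
  have int: "integrable M (?f i)" if "i \<in> I" for i
    using that by (simp add: integrable_indicator_iff emeasure_eq_measure)
  have int2: "integrable M (indicat_real (E i \<inter> E j))" if "i \<in> I" "j \<in> I - {i}" for i j
    using that by (simp add: integrable_indicator_iff emeasure_eq_measure)
  have int3: "integrable M (\<lambda>\<omega>. \<Sum>i\<in>I. \<Sum>j\<in>I - {i}. indicat_real (E i \<inter> E j) \<omega>)"
    by (intro Bochner_Integration.integrable_sum int2)
  have point: "(\<Sum>i\<in>I. ?f i \<omega>) \<le> 1 + (\<Sum>i\<in>I. \<Sum>j\<in>I - {i}. indicat_real (E i \<inter> E j) \<omega>)" for \<omega>
  proof -
    let ?S = "\<Sum>i\<in>I. ?f i \<omega>"
    have "(\<Sum>j\<in>I - {i}. indicat_real (E i \<inter> E j) \<omega>) = ?f i \<omega> * ?S - ?f i \<omega>" if "i \<in> I" for i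
    proof -
      have "?f i \<omega> * ?S = ?f i \<omega> * ?f i \<omega> + ?f i \<omega> * (\<Sum>j\<in>I - {i}. ?f j \<omega>)"
        using assms(1) that by (subst sum.remove[of I i]) (auto simp: algebra_simps)
      moreover have "?f i \<omega> * ?f i \<omega> = ?f i \<omega>" by (simp add: indicator_def)
      moreover have "?f i \<omega> * (\<Sum>j\<in>I - {i}. ?f j \<omega>) = (\<Sum>j\<in>I - {i}. indicat_real (E i \<inter> E j) \<omega>)"
        by (simp add: sum_distrib_left indicator_inter_arith)
      ultimately show ?thesis by simp
    qed
    then have "(\<Sum>i\<in>I. \<Sum>j\<in>I - {i}. indicat_real (E i \<inter> E j) \<omega>) = ?S * ?S - ?S"
      by (simp add: sum_subtractf sum_distrib_right)
    moreover have "0 \<le> (?S - 1)\<^sup>2" by simp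
    ultimately show ?thesis by (simp add: power2_eq_square algebra_simps)
  qed
  have "(\<Sum>i\<in>I. prob (E i)) = (\<integral>\<omega>. (\<Sum>i\<in>I. ?f i \<omega>) \<partial>M)"
    using int by (subst Bochner_Integration.integral_sum) (auto intro!: sum.cong)
  also have "\<dots> \<le> (\<integral>\<omega>. 1 + (\<Sum>i\<in>I. \<Sum>j\<in>I - {i}. indicat_real (E i \<inter> E j) \<omega>) \<partial>M)"
    by (intro integral_mono point Bochner_Integration.integrable_sum Bochner_Integration.integrable_add int int3) auto
  also have "\<dots> = 1 + (\<Sum>i\<in>I. \<Sum>j\<in>I - {i}. prob (E i \<inter> E j))"
  proof -
    have "(\<integral>\<omega>. (\<Sum>i\<in>I. \<Sum>j\<in>I - {i}. indicat_real (E i \<inter> E j) \<omega>) \<partial>M) =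
        (\<Sum>i\<in>I. \<integral>\<omega>. (\<Sum>j\<in>I - {i}. indicat_real (E i \<inter> E j) \<omega>) \<partial>M)"
      by (intro Bochner_Integration.integral_sum Bochner_Integration.integrable_sum int2)
    also have "\<dots> = (\<Sum>i\<in>I. \<Sum>j\<in>I - {i}. \<integral>\<omega>. indicat_real (E i \<inter> E j) \<omega> \<partial>M)"
      by (intro sum.cong refl Bochner_Integration.integral_sum int2)
    also have "\<dots> = (\<Sum>i\<in>I. \<Sum>j\<in>I - {i}. prob (E i \<inter> E j))"
      by (intro sum.cong refl) simp
    finally show ?thesis
      using Bochner_Integration.integral_add[OF _ int3, of "\<lambda>_. 1"] by (simp add: prob_space)
  qed
  finally show ?thesis .
qed

context subdivision_law
begin

section \<open>Maximal families of heavy subspaces\<close>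

text \<open>The transvection argument needs base ratios \<open>x\<close>, an alternative \<open>y\<close> for one of them, and
  a regular midpoint. With all base ratios near \<open>r\<close> and \<open>y\<close> near \<open>r'\<close>, where
  \<open>{r, r'} = {p, q}\<close>, the product for the midpoint configuration is near
  \<open>\<phi> r ^ (d - 1) * \<phi> ((p + q) / 2)\<close> with the strictly decreasing function
  \<open>\<phi> t = (1 - t) / t\<close>. It cannot be \<open>1\<close> both for \<open>r = p\<close> and for
  \<open>r = q\<close>, so one of the two choices works, and it works on whole neighbourhoods by continuity.\<close>

lemma exists_good_base:
  obtains U V where "open U" "open V" "measure \<mu> U > 0" "measure \<mu> V > 0"
    "\<And>x y j. (\<And>i. i \<in> {1..d} \<Longrightarrow> x i \<in> U) \<Longrightarrow> y \<in> V \<Longrightarrow> j \<in> {1..d} \<Longrightarrow>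
       y \<noteq> x j \<and> regular d (x(j := (x j + y) / 2))"
proof -
  define \<phi> where "\<phi> = (\<lambda>t::real. (1 - t) / t)"
  define m where "m = (p + q) / 2"
  have m: "m \<in> {0<..<1}" using pq by (auto simp: m_def)
  have phi_pos: "\<phi> t > 0" if "t \<in> {0<..<1}" for t using that by (simp add: \<phi>_def)
  have phi_mono: "\<phi> t < \<phi> s" if "s \<in> {0<..<1}" "t \<in> {0<..<1}" "s < t" for s t
    using that by (simp add: \<phi>_def field_simps)
  have "\<exists>r\<in>{p, q}. \<phi> r ^ (d - 1) * \<phi> m \<noteq> 1"
  proof (rule ccontr)
    assume "\<not> ?thesis"
    then have "\<phi> p ^ (d - 1) * \<phi> m = \<phi> q ^ (d - 1) * \<phi> m" by simp
    then have "\<phi> p ^ (d - 1) = \<phi> q ^ (d - 1)" using phi_pos[OF m] by simp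
    then have "\<phi> p = \<phi> q"
      by (rule power_eq_imp_eq_base) (use phi_pos pq d3 in \<open>auto intro: less_imp_le\<close>)
    then show False using phi_mono[of p q] phi_mono[of q p] pq by (cases p q rule: linorder_cases) auto
  qed
  then obtain r where r: "r \<in> {p, q}" "\<phi> r ^ (d - 1) * \<phi> m \<noteq> 1" by blast
  define r' where "r' = p + q - r"
  have r': "r' \<in> {p, q}" "r \<noteq> r'" "m = (r + r') / 2" using r pq by (auto simp: r'_def m_def)
  have rr: "r \<in> {0<..<1}" "r' \<in> {0<..<1}" using r r' pq by auto
  \<comment> \<open>By monotonicity of \<phi>, the products for ratios within e of r and a midpoint within e of m lie
    between F e and F (- e).\<close>
  define F where "F = (\<lambda>e. \<phi> (r + e) ^ (d - 1) * \<phi> (m + e))"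
  have cont: "isCont F 0"
    unfolding F_def \<phi>_def using rr m by (intro continuous_intros) auto
  have "\<exists>e>0. (\<forall>t. \<bar>t\<bar> \<le> e \<longrightarrow> F t < 1) \<or> (\<forall>t. \<bar>t\<bar> \<le> e \<longrightarrow> F t > 1)"
  proof -
    have "F 0 \<noteq> 1" using r by (simp add: F_def)
    then obtain e where "e > 0" "\<And>t. \<bar>t - 0\<bar> < e \<Longrightarrow> \<bar>F t - F 0\<bar> < \<bar>F 0 - 1\<bar>"
      using cont[unfolded continuous_at_eps_delta, rule_format, of "\<bar>F 0 - 1\<bar>"]
      by (auto simp: dist_real_def)
    then show ?thesis
    proof (intro exI[of _ "e / 2"] conjI)
      have near: "\<bar>F t - F 0\<bar> < \<bar>F 0 - 1\<bar>" if "\<bar>t\<bar> \<le> e / 2" for t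
        using \<open>e > 0\<close> that by (intro \<open>\<And>t. \<bar>t - 0\<bar> < e \<Longrightarrow> \<bar>F t - F 0\<bar> < \<bar>F 0 - 1\<bar>\<close>) simp
      show "(\<forall>t. \<bar>t\<bar> \<le> e / 2 \<longrightarrow> F t < 1) \<or> (\<forall>t. \<bar>t\<bar> \<le> e / 2 \<longrightarrow> 1 < F t)"
      proof (cases "F 0 < 1")
        case True
        have "F t < 1" if "\<bar>t\<bar> \<le> e / 2" for t using near[OF that] True by linarith
        then show ?thesis by blast
      next
        case False
        have "F t > 1" if "\<bar>t\<bar> \<le> e / 2" for t using near[OF that] False \<open>F 0 \<noteq> 1\<close> by linarith
        then show ?thesis by blast
      qed
    qed (use \<open>e > 0\<close> in simp)
  qed
  then obtain e\<^sub>1 where e1: "e\<^sub>1 > 0" "(\<forall>t. \<bar>t\<bar> \<le> e\<^sub>1 \<longrightarrow> F t < 1) \<or> (\<forall>t. \<bar>t\<bar> \<le> e\<^sub>1 \<longrightarrow> F t > 1)"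
    by blast
  define e where "e = Min {e\<^sub>1, r / 2, (1 - r) / 2, r' / 2, (1 - r') / 2, \<bar>r - r'\<bar> / 3}"
  have e: "e > 0" "e \<le> e\<^sub>1" "r - e > 0" "r + e < 1" "r' - e > 0" "r' + e < 1" "2 * e < \<bar>r - r'\<bar>"
  proof -
    have "e \<le> e\<^sub>1" "e \<le> r / 2" "e \<le> (1 - r) / 2" "e \<le> r' / 2" "e \<le> (1 - r') / 2" "e \<le> \<bar>r - r'\<bar> / 3"
      unfolding e_def by (rule Min_le; simp)+
    moreover show "e > 0"
      unfolding e_def by (subst Min_gr_iff) (use e1 rr r' in auto)
    ultimately show "e \<le> e\<^sub>1" "r - e > 0" "r + e < 1" "r' - e > 0" "r' + e < 1" "2 * e < \<bar>r - r'\<bar>"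
      using rr r' by auto
  qed
  have me: "m - e > 0" "m + e < 1" using e unfolding r' by (auto simp: field_simps)
  define U V where "U = {r - e<..<r + e}" and "V = {r' - e<..<r' + e}"
  show ?thesis
  proof
    show "open U" "open V" by (auto simp: U_def V_def)
    show "measure \<mu> U > 0" using p_charged[of U] q_charged[of U] r e by (auto simp: U_def)
    show "measure \<mu> V > 0" using p_charged[of V] q_charged[of V] r' e by (auto simp: V_def)
    fix x y j assume x: "\<And>i. i \<in> {1..d} \<Longrightarrow> x i \<in> U" and y: "y \<in> V" and j: "j \<in> {1..d}"
    have "\<bar>x j - r\<bar> < e" "\<bar>y - r'\<bar> < e" using x[OF j] y by (auto simp: U_def V_def)
    then have "y \<noteq> x j" using e by linarith
    define z where "z = x(j := (x j + y) / 2)"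
    have mid: "z j \<in> {m - e<..<m + e}"
      using x[OF j] y unfolding r' U_def V_def z_def by (auto simp: field_simps)
    have oth: "z i \<in> {r - e<..<r + e}" if "i \<in> {1..d} - {j}" for i
      using x[of i] that by (auto simp: U_def z_def)
    have unit: "z i \<in> {0<..<1}" if "i \<in> {1..d}" for i
    proof (cases "i = j")
      case True
      then show ?thesis using mid me by auto
    next
      case False
      then show ?thesis using oth[of i] e that by auto
    qed
    have ends: "r - e \<in> {0<..<1}" "r + e \<in> {0<..<1}" "m - e \<in> {0<..<1}" "m + e \<in> {0<..<1}"
      using e me by auto
    have prod: "(\<Prod>i=1..d. (1 - z i) / z i) = (\<Prod>i\<in>{1..d} - {j}. \<phi> (z i)) * \<phi> (z j)"
      using j by (subst prod.remove[of _ j]) (auto simp: \<phi>_def mult.commute)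
    have cd: "card ({1..d} - {j}) = d - 1" using j by simp
    have b1: "\<phi> (z i) \<le> \<phi> (r - e)" "\<phi> (r + e) \<le> \<phi> (z i)" "0 \<le> \<phi> (z i)" if "i \<in> {1..d} - {j}" for i
      using phi_mono[OF ends(1), of "z i"] phi_mono[OF _ ends(2), of "z i"] phi_pos[of "z i"]
        oth[OF that] unit[of i] that by auto
    have b2: "\<phi> (z j) \<le> \<phi> (m - e)" "\<phi> (m + e) \<le> \<phi> (z j)" "0 \<le> \<phi> (z j)"
      using phi_mono[OF ends(3), of "z j"] phi_mono[OF _ ends(4), of "z j"] phi_pos[of "z j"]
        mid unit[OF j] by auto
    have b3: "0 \<le> \<phi> (r + e)" "0 \<le> \<phi> (m + e)" "0 \<le> \<phi> (r - e)"
      using phi_pos ends by (simp_all add: less_imp_le)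
    have nonneg: "0 \<le> (\<Prod>i\<in>{1..d} - {j}. \<phi> (z i))"
      by (intro prod_nonneg b1)
    have "(\<Prod>i\<in>{1..d} - {j}. \<phi> (z i)) \<le> (\<Prod>i\<in>{1..d} - {j}. \<phi> (r - e))"
      by (intro prod_mono conjI b1)
    then have up: "(\<Prod>i\<in>{1..d} - {j}. \<phi> (z i)) * \<phi> (z j) \<le> F (- e)"
      using b2 b3 nonneg by (auto simp: F_def cd intro!: mult_mono)
    have "(\<Prod>i\<in>{1..d} - {j}. \<phi> (r + e)) \<le> (\<Prod>i\<in>{1..d} - {j}. \<phi> (z i))"
      by (intro prod_mono conjI b1 b3)
    then have low: "F e \<le> (\<Prod>i\<in>{1..d} - {j}. \<phi> (z i)) * \<phi> (z j)"
      using b2 b3 nonneg by (auto simp: F_def cd intro!: mult_mono)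
    have "F (- e) < 1 \<or> F e > 1" using e1 e by auto
    then have "(\<Prod>i=1..d. (1 - z i) / z i) \<noteq> 1"
      unfolding prod using up low by linarith
    then have "regular d z" unfolding regular_def using unit by blast
    then show "y \<noteq> x j \<and> regular d (x(j := (x j + y) / 2))"
      using \<open>y \<noteq> x j\<close> unfolding z_def by blast
  qed
qed

text \<open>Resampling coordinate \<open>i\<close> by an independent ratio; the index \<open>0\<close>, which is no vertex,
  stands for leaving the ratios as they are.\<close>

definition resample :: "nat \<Rightarrow> real \<times> (nat \<Rightarrow> real) \<Rightarrow> nat \<Rightarrow> real" where
  "resample i z = (if i = 0 then snd z else (snd z)(i := fst z))"

text \<open>Resampling a coordinate from its own law preserves the product law. This lets the \<open>d + 1\<close> perturbed
  and unperturbed steps be treated by one estimate.\<close>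

lemma resample_distr:
  assumes "i \<le> d"
  shows "resample i \<in> measurable (\<mu> \<Otimes>\<^sub>M ratios) ratios"
    and "distr (\<mu> \<Otimes>\<^sub>M ratios) ratios (resample i) = ratios"
proof -
  have "resample i \<in> measurable (\<mu> \<Otimes>\<^sub>M ratios) ratios \<and>
      distr (\<mu> \<Otimes>\<^sub>M ratios) ratios (resample i) = ratios"
  proof (cases "i = 0")
    case True
    have [simp]: "resample 0 = snd" by (auto simp: resample_def)
    have "distr (\<mu> \<Otimes>\<^sub>M ratios) ratios snd = ratios"
    proof (rule measure_eqI)
      fix A assume "A \<in> sets (distr (\<mu> \<Otimes>\<^sub>M ratios) ratios snd)"
      then have A: "A \<in> sets ratios" by simp
      have "snd -` A \<inter> space (\<mu> \<Otimes>\<^sub>M ratios) = space \<mu> \<times> A"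
        using sets.sets_into_space[OF A] by (auto simp: space_pair_measure)
      then show "emeasure (distr (\<mu> \<Otimes>\<^sub>M ratios) ratios snd) A = emeasure ratios A"
        using ratios.emeasure_pair_measure_Times[OF sets.top[of \<mu>] A] A
        by (simp add: emeasure_distr emeasure_space_1)
    qed simp
    then show ?thesis using True by simp
  next
    case False
    then have i: "insert i {1..d} = {1..d}" using assms by auto
    have eq: "resample i = (\<lambda>(y, x). x(i := y))" using False by (auto simp: resample_def)
    have m: "(\<lambda>(y, x). x(i := y)) \<in> measurable (\<mu> \<Otimes>\<^sub>M ratios) (PiM (insert i {1..d}) (\<lambda>_. \<mu>))"
      unfolding case_prod_beta by (rule measurable_fun_upd[where J = "{1..d}"]) auto
    have "distr (\<mu> \<Otimes>\<^sub>M ratios) (PiM (insert i {1..d}) (\<lambda>_. \<mu>)) (\<lambda>(y, x). x(i := y)) =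
        PiM (insert i {1..d}) (\<lambda>_. \<mu>)"
      by (rule distr_pair_PiM_eq_PiM) (rule prob_space_axioms)+
    with m show ?thesis unfolding i eq by blast
  qed
  then show "resample i \<in> measurable (\<mu> \<Otimes>\<^sub>M ratios) ratios"
    and "distr (\<mu> \<Otimes>\<^sub>M ratios) ratios (resample i) = ratios" by auto
qed

text \<open>Ratios \<open>x\<close> and an alternative \<open>y\<close> for which \<open>side_form_in_image\<close> applies at
  every vertex.\<close>

definition good_pair :: "(nat \<Rightarrow> real) \<Rightarrow> real \<Rightarrow> bool" where
  "good_pair x y \<longleftrightarrow> regular d x \<and>
     (\<forall>i\<in>{1..d}. y \<noteq> x i \<and> regular d (x(i := y)) \<and> regular d (x(i := (x i + y) / 2)))"

definition heavy_family :: "nat \<Rightarrow> nat \<Rightarrow> real \<Rightarrow> nat \<Rightarrow> (nat \<Rightarrow> real) \<Rightarrow> (nat \<Rightarrow> real) set set \<Rightarrow> bool" where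
  "heavy_family n N t j w \<X> \<longleftrightarrow> nonconstant w \<and> \<X> \<subseteq> subspaces_of_dim d n \<and> finite \<X> \<and> card \<X> = N \<and>
     (\<forall>X\<in>\<X>. t \<le> mass j w X)"

text \<open>The mass at time \<open>j + 1\<close> is an average of masses at time \<open>j\<close>, none of which exceeds the
  limit \<open>s\<close> by more than \<open>\<delta>\<close> for late \<open>j\<close>. If the average is at least
  \<open>s - \<delta>\<close>, then by Markov's inequality the mass falls below \<open>s - e\<close> with
  probability at most \<open>2 \<delta> / e\<close>. For \<open>\<delta>\<close> small, the
  \<open>N (d + 1)\<close> exceptional events (one for each space and each of the unperturbed and perturbed steps)
  cannot cover the set of good ratios provided by \<open>exists_good_base\<close>, which has positive probability.\<close>

lemma heavy_images:
  assumes lim: "max_mass n \<longlonglongrightarrow> s" and e: "e > 0"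
  shows "\<exists>\<delta>>0. \<exists>j\<^sub>0. \<forall>j\<ge>j\<^sub>0. \<forall>w \<X>. heavy_family n N (s - \<delta>) (Suc j) w \<X> \<longrightarrow>
    (\<exists>x y. good_pair x y \<and> (\<forall>X\<in>\<X>. s - e \<le> mass j w (adj d x ` X) \<and>
       (\<forall>i\<in>{1..d}. s - e \<le> mass j w (adj d (x(i := y)) ` X))))"
proof -
  obtain U V where UV: "open U" "open V" "measure \<mu> U > 0" "measure \<mu> V > 0"
    and good: "\<And>x y j. (\<And>i. i \<in> {1..d} \<Longrightarrow> x i \<in> U) \<Longrightarrow> y \<in> V \<Longrightarrow> j \<in> {1..d} \<Longrightarrow>
       y \<noteq> x j \<and> regular d (x(j := (x j + y) / 2))"
    using exists_good_base by (metis (no_types, lifting))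
  let ?P = "\<mu> \<Otimes>\<^sub>M ratios"
  interpret P: pair_prob_space \<mu> ratios ..
  define box where "box = V \<times> PiE {1..d} (\<lambda>_. U)"
  have UVm [measurable]: "U \<in> sets \<mu>" "V \<in> sets \<mu>" using UV by auto
  have boxm: "box \<in> sets ?P" unfolding box_def by (intro pair_measureI sets_PiM_I_finite UVm) auto
  interpret pp: product_prob_space "\<lambda>_. \<mu>" "{1..d}" ..
  define \<gamma> where "\<gamma> = measure ?P box"
  have "emeasure ?P box = emeasure \<mu> V * (\<Prod>i\<in>{1..d}. emeasure \<mu> U)"
    unfolding box_def pp.emeasure_PiM[OF finite_atLeastAtMost UVm(1), symmetric]
    by (intro ratios.emeasure_pair_measure_Times UVm sets_PiM_I_finite) auto
  also have "\<dots> = ennreal (measure \<mu> V * measure \<mu> U ^ d)"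
    by (simp add: emeasure_eq_measure ennreal_power ennreal_mult)
  finally have \<gamma>: "\<gamma> > 0"
    using UV by (simp add: \<gamma>_def measure_def)
  \<comment> \<open>Small enough for N * (d + 1) exceptional events of probability 2 * \<delta> / e to have total
    probability less than \<gamma>; the term N + 1 avoids division by zero.\<close>
  define \<delta> where "\<delta> = \<gamma> * e / (4 * real (N + 1) * real (d + 1))"
  have \<delta>: "\<delta> > 0" using \<gamma> e by (simp add: \<delta>_def)
  obtain j\<^sub>0 where j0: "\<And>j. j \<ge> j\<^sub>0 \<Longrightarrow> max_mass n j \<le> s + \<delta>"
    using order_tendstoD(2)[OF lim, of "s + \<delta>"] \<delta>
    by (force simp: eventually_sequentially intro: less_imp_le)
  have "\<exists>x y. good_pair x y \<and> (\<forall>X\<in>\<X>. s - e \<le> mass j w (adj d x ` X) \<and>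
       (\<forall>i\<in>{1..d}. s - e \<le> mass j w (adj d (x(i := y)) ` X)))"
    if j: "j \<ge> j\<^sub>0" and heavy: "heavy_family n N (s - \<delta>) (Suc j) w \<X>" for j w \<X>
  proof (rule ccontr)
    assume none: "\<not> ?thesis"
    have H: "nonconstant w" "\<X> \<subseteq> subspaces_of_dim d n" "finite \<X>" "card \<X> = N"
      "\<And>X. X \<in> \<X> \<Longrightarrow> s - \<delta> \<le> mass (Suc j) w X"
      using heavy by (auto simp: heavy_family_def)
    define B where "B X = {x \<in> space ratios. mass j w (adj d x ` X) < s - e}" for X
    have Bm: "B X \<in> sets ratios" if "X \<in> \<X>" for X
      unfolding B_def using mass_Suc(1)[of X n j w] H(2) that by (auto intro: borel_measurable_less)
    have Bp: "measure ratios (B X) \<le> 2 * \<delta> / e" if X: "X \<in> \<X>" for X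
    proof -
      have Xn: "X \<in> subspaces_of_dim d n" using H(2) X by blast
      have "AE x in ratios. mass j w (adj d x ` X) \<le> (s + \<delta>) - (e + \<delta>) * indicator (B X) x"
        using AE_regular AE_space
      proof eventually_elim
        case (elim x)
        have "mass j w (adj d x ` X) \<le> s + \<delta>"
          using mass_le_max_mass[OF H(1) subspaces_of_dim_adj[OF Xn elim(1)], of j] j0[OF j] by linarith
        then show ?case using elim by (auto simp: B_def indicator_def)
      qed
      then have "mass (Suc j) w X \<le> (\<integral>x. (s + \<delta>) - (e + \<delta>) * indicator (B X) x \<partial>ratios)"
        unfolding mass_Suc(2)[OF Xn]
        using Bm[OF X]
        by (intro integral_mono_AE mass_integrable[OF Xn] Bochner_Integration.integrable_diff
            integrable_mult_right) (auto simp: integrable_indicator_iff ratios.emeasure_eq_measure)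
      also have "\<dots> = (s + \<delta>) - (e + \<delta>) * measure ratios (B X)"
        using Bm[OF X]
        by (subst Bochner_Integration.integral_diff)
          (auto simp: integrable_indicator_iff ratios.emeasure_eq_measure ratios.prob_space)
      finally have "(e + \<delta>) * measure ratios (B X) \<le> 2 * \<delta>" using H(5)[OF X] by linarith
      moreover have "e * measure ratios (B X) \<le> (e + \<delta>) * measure ratios (B X)"
        using \<delta> by (intro mult_right_mono) auto
      ultimately show ?thesis using e by (simp add: field_simps)
    qed
    define C where "C = (\<lambda>(X, i). resample i -` B X \<inter> space ?P)"
    have Cm: "C k \<in> sets ?P" and Cp: "measure ?P (C k) \<le> 2 * \<delta> / e" if "k \<in> \<X> \<times> {0..d}" for k
    proof -
      obtain X i where k: "k = (X, i)" "X \<in> \<X>" "i \<le> d" using \<open>k \<in> \<X> \<times> {0..d}\<close> by auto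
      show "C k \<in> sets ?P"
        unfolding k C_def prod.case by (rule measurable_sets[OF resample_distr(1)[OF k(3)] Bm[OF k(2)]])
      have "measure ?P (C k) = measure (distr ?P ratios (resample i)) (B X)"
        unfolding k C_def prod.case
        by (rule measure_distr[symmetric, OF resample_distr(1)[OF k(3)] Bm[OF k(2)]])
      then show "measure ?P (C k) \<le> 2 * \<delta> / e"
        using Bp[OF k(2)] resample_distr(2)[OF k(3)] by simp
    qed
    have "AE z in ?P. \<forall>i\<in>{0..d}. regular d (resample i z)"
    proof (intro AE_finite_allI)
      fix i assume "i \<in> {0..d}"
      then have i: "i \<le> d" by simp
      have "AE x in distr ?P ratios (resample i). regular d x"
        unfolding resample_distr(2)[OF i] by (rule AE_regular)
      then show "AE z in ?P. regular d (resample i z)"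
        by (rule AE_distrD[OF resample_distr(1)[OF i]])
    qed simp
    then have "AE z in ?P. z \<in> box \<longrightarrow> z \<in> (\<Union>k\<in>\<X> \<times> {0..d}. C k)"
      using AE_space
    proof eventually_elim
      case (elim z)
      show ?case
      proof (rule impI, rule ccontr)
        assume z: "z \<in> box" "z \<notin> (\<Union>k\<in>\<X> \<times> {0..d}. C k)"
        let ?x = "snd z" and ?y = "fst z"
        have l: "resample i z = ?x(i := ?y)" if "i \<in> {1..d}" for i using that by (simp add: resample_def)
        have l0: "resample 0 z = ?x" by (simp add: resample_def)
        have "good_pair ?x ?y"
          unfolding good_pair_def
        proof (intro conjI ballI)
          show "regular d ?x" using elim(1)[THEN bspec, of 0] l0 by simp
          fix i assume i: "i \<in> {1..d}"
          show "regular d (?x(i := ?y))" using elim(1)[THEN bspec, of i] l[OF i] i by simp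
          have U: "?x k \<in> U" if "k \<in> {1..d}" for k using z(1) that by (auto simp: box_def)
          have "?y \<in> V" using z(1) by (auto simp: box_def)
          from good[of "snd z", OF U this i] show "?y \<noteq> ?x i" "regular d (?x(i := (?x i + ?y) / 2))" by auto
        qed
        moreover have "s - e \<le> mass j w (adj d (resample i z) ` X)" if "X \<in> \<X>" "i \<le> d" for X i
          using z(2) that elim(2) measurable_space[OF resample_distr(1)[OF that(2)] elim(2)]
          by (force simp: C_def B_def)
        ultimately show False using none l l0 by (metis atLeastAtMost_iff le0)
      qed
    qed
    then have "\<gamma> \<le> measure ?P (\<Union>k\<in>\<X> \<times> {0..d}. C k)"
      unfolding \<gamma>_def using H(3) Cm
      by (intro P.finite_measure_mono_AE sets.finite_UN) auto
    also have "\<dots> \<le> (\<Sum>k\<in>\<X> \<times> {0..d}. measure ?P (C k))"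
      using H(3) Cm by (intro measure_UNION_le) auto
    also have "\<dots> \<le> (\<Sum>k\<in>\<X> \<times> {0..d}. 2 * \<delta> / e)" using Cp by (rule sum_mono)
    also have "\<dots> = real N * real (d + 1) * (2 * \<delta> / e)"
      using H(4) by (simp add: card_cartesian_product algebra_simps)
    also have "\<dots> = \<gamma> / 2 * (real N / real (N + 1))"
    proof -
      have "a * D * (2 * (g * b / (4 * M * D)) / b) = g / 2 * (a / M)" if "D > 0" "M > 0" "b > 0"
        for a b D M g :: real using that by (simp add: field_simps)
      from this[of "real (d + 1)" "real (N + 1)" e] show ?thesis using e by (simp add: \<delta>_def)
    qed
    also have "\<dots> < \<gamma>"
    proof -
      have "real N / real (N + 1) \<le> 1" by simp
      then have "\<gamma> / 2 * (real N / real (N + 1)) \<le> \<gamma> / 2 * 1" using \<gamma> by (intro mult_left_mono) auto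
      then show ?thesis using \<gamma> by linarith
    qed
    finally show False by simp
  qed
  then show ?thesis using \<delta> by blast
qed

lemma subspaces_of_dim_index:
  assumes "X \<in> subspaces_of_dim d n" "n \<ge> 1"
  shows "\<exists>i\<in>{1..d}. \<exists>c\<in>X. c i \<noteq> 0"
proof -
  have X: "subspace X" "X \<subseteq> vecs d" using subspaces_of_dim_subspace[OF assms(1)] by auto
  then have "0 \<in> X" by (simp add: subspace_0)
  with subspaces_of_dim_nontrivial[OF assms] obtain c where c: "c \<in> X" "c \<noteq> 0" by auto
  then obtain i where i: "c i \<noteq> 0" by (auto simp: fun_eq_iff)
  with c X have "i \<in> {1..d}" by (auto simp: vecs_def)
  with i c show ?thesis by blast
qed

text \<open>If near-maximal families of more than \<open>N\<close> spaces do not exist, then the images of a heavy family under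
  the unperturbed step and under all \<open>d\<close> perturbed steps have to coincide, for together they form a
  heavy family. So \<open>side_form_in_image\<close> applies at every vertex.\<close>

lemma heavy_family_step:
  assumes lim: "max_mass n \<longlonglongrightarrow> s" and e: "e > 0"
    and maximal: "\<delta>\<^sub>1 > 0" "\<forall>j\<ge>j\<^sub>1. \<forall>w \<X>. \<not> heavy_family n (Suc N) (s - \<delta>\<^sub>1) j w \<X>"
  shows "\<exists>\<delta>>0. \<exists>j\<^sub>0. \<forall>j\<ge>j\<^sub>0. \<forall>w \<X> X. heavy_family n N (s - \<delta>) (Suc j) w \<X> \<and> X \<in> \<X> \<longrightarrow>
    (\<exists>\<X>' X'. heavy_family n N (s - e) j w \<X>' \<and> X' \<in> \<X>' \<and>
       (\<forall>i\<in>{1..d}. (\<exists>c\<in>X. c i \<noteq> 0) \<longrightarrow> side_form d i \<in> X'))"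
proof -
  define e' where "e' = min e \<delta>\<^sub>1"
  have e': "e' > 0" "e' \<le> e" "e' \<le> \<delta>\<^sub>1" using e maximal(1) by (auto simp: e'_def)
  obtain \<delta> j\<^sub>0 where \<delta>: "\<delta> > 0" and choose_all: "\<forall>j\<ge>j\<^sub>0. \<forall>w \<X>. heavy_family n N (s - \<delta>) (Suc j) w \<X> \<longrightarrow>
      (\<exists>x y. good_pair x y \<and> (\<forall>X\<in>\<X>. s - e' \<le> mass j w (adj d x ` X) \<and>
       (\<forall>i\<in>{1..d}. s - e' \<le> mass j w (adj d (x(i := y)) ` X))))"
    using heavy_images[OF lim e'(1), of N] by (elim exE conjE) (rule that; assumption)
  note choose = choose_all[THEN spec, THEN mp, THEN spec, THEN spec, THEN mp]
  have "\<exists>\<X>' X'. heavy_family n N (s - e) j w \<X>' \<and> X' \<in> \<X>' \<and>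
       (\<forall>i\<in>{1..d}. (\<exists>c\<in>X. c i \<noteq> 0) \<longrightarrow> side_form d i \<in> X')"
    if j: "j \<ge> max j\<^sub>0 j\<^sub>1" and h: "heavy_family n N (s - \<delta>) (Suc j) w \<X>" and X: "X \<in> \<X>" for j w \<X> X
  proof -
    have H: "nonconstant w" "\<X> \<subseteq> subspaces_of_dim d n" "finite \<X>" "card \<X> = N"
      using h by (auto simp: heavy_family_def)
    have "j\<^sub>0 \<le> j" using j by simp
    from choose[OF this h] obtain x y where g: "good_pair x y"
      and xy: "\<forall>X\<in>\<X>. s - e' \<le> mass j w (adj d x ` X) \<and>
         (\<forall>i\<in>{1..d}. s - e' \<le> mass j w (adj d (x(i := y)) ` X))"
      by (elim exE conjE) (rule that; assumption)
    have m: "\<And>X. X \<in> \<X> \<Longrightarrow> s - e' \<le> mass j w (adj d x ` X)"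
        "\<And>X i. X \<in> \<X> \<Longrightarrow> i \<in> {1..d} \<Longrightarrow> s - e' \<le> mass j w (adj d (x(i := y)) ` X)"
      using xy by blast+
    have reg: "regular d x" "\<And>i. i \<in> {1..d} \<Longrightarrow> regular d (x(i := y))"
      "\<And>i. i \<in> {1..d} \<Longrightarrow> regular d (x(i := (x i + y) / 2))" "\<And>i. i \<in> {1..d} \<Longrightarrow> y \<noteq> x i"
      using g by (auto simp: good_pair_def)
    define \<X>' where "\<X>' = ((`) (adj d x)) ` \<X> \<union> (\<Union>i\<in>{1..d}. ((`) (adj d (x(i := y)))) ` \<X>)"
    have fin: "finite \<X>'" using H(3) by (auto simp: \<X>'_def)
    have sub: "\<X>' \<subseteq> subspaces_of_dim d n"
      using H(2) reg subspaces_of_dim_adj by (auto simp: \<X>'_def)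
    have ms: "s - e' \<le> mass j w Y" if "Y \<in> \<X>'" for Y
      using that m by (auto simp: \<X>'_def)
    have "inj_on ((`) (adj d x)) \<X>"
    proof (rule inj_onI)
      fix Y Z assume YZ: "Y \<in> \<X>" "Z \<in> \<X>" "adj d x ` Y = adj d x ` Z"
      then show "Y = Z"
        using inj_on_image_eq_iff[OF adj_inj[OF reg(1)], of Y Z] H(2) subspaces_of_dim_subspace by blast
    qed
    then have "N = card (((`) (adj d x)) ` \<X>)" using H(4) by (simp add: card_image)
    also have "\<dots> \<le> card \<X>'" using fin by (intro card_mono) (auto simp: \<X>'_def)
    finally have "N \<le> card \<X>'" .
    moreover have "\<not> Suc N \<le> card \<X>'"
    proof
      assume "Suc N \<le> card \<X>'"
      then obtain \<Y> where Y: "\<Y> \<subseteq> \<X>'" "card \<Y> = Suc N" "finite \<Y>"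
        by (meson obtain_subset_with_card_n)
      have "s - \<delta>\<^sub>1 \<le> mass j w Z" if "Z \<in> \<Y>" for Z using ms[of Z] Y that e' by auto
      with Y sub H(1) have "heavy_family n (Suc N) (s - \<delta>\<^sub>1) j w \<Y>"
        unfolding heavy_family_def by blast
      with maximal(2) j show False by auto
    qed
    ultimately have card: "card \<X>' = N" by simp
    have "s - e \<le> mass j w Z" if "Z \<in> \<X>'" for Z using ms[OF that] e' by auto
    with fin sub card H(1) have "heavy_family n N (s - e) j w \<X>'"
      by (auto simp: heavy_family_def)
    moreover have "adj d x ` X \<in> \<X>'" using X by (auto simp: \<X>'_def)
    moreover have "side_form d i \<in> adj d x ` X" if i: "i \<in> {1..d}" and c: "c \<in> X" "c i \<noteq> 0" for i c
    proof (rule side_form_in_image[where \<X> = \<X> and \<X>' = \<X>' and y = y and c = c])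
      show "2 \<le> d" using d3 by simp
      show "subspace Y \<and> Y \<subseteq> vecs d" if "Y \<in> \<X>" for Y
        using that H(2) subspaces_of_dim_subspace by blast
      show "adj d (x(i := y)) ` Y \<in> \<X>'" if "Y \<in> \<X>" for Y
        using that i unfolding \<X>'_def by blast
    qed (use i c X reg fin card H \<X>'_def in auto)
    ultimately show ?thesis by blast
  qed
  then show ?thesis using \<delta> by blast
qed

lemma cyc_power:
  assumes "i \<in> {1..d}"
  shows "((\<lambda>i. i mod d + 1) ^^ k) i \<in> {1..d}"
  by (induction k) (use assms cyc_mem in \<open>auto simp del: atLeastAtMost_iff\<close>)

lemma cyc_reaches:
  assumes "i \<in> {1..d}" "j \<in> {1..d}"
  shows "\<exists>k<d. ((\<lambda>i. i mod d + 1) ^^ k) i = j"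
proof -
  have pow: "((\<lambda>i. i mod d + 1) ^^ k) i = (i - 1 + k) mod d + 1" for k
  proof (induction k)
    case 0
    then show ?case using assms by auto
  next
    case (Suc k)
    then show ?case using mod_Suc_eq[of "i - 1 + k" d] by (simp flip: Suc_eq_plus1)
  qed
  define k where "k = (j + d - i) mod d"
  have "(i - 1 + k) mod d = (i - 1 + (j + d - i)) mod d"
    by (simp add: k_def mod_add_right_eq)
  also have "i - 1 + (j + d - i) = (j - 1) + d" using assms by auto
  also have "(j - 1 + d) mod d = (j - 1) mod d" by (rule mod_add_self2)
  also have "\<dots> = j - 1" by (rule mod_less) (use assms in auto)
  finally have "((\<lambda>i. i mod d + 1) ^^ k) i = j" using assms by (simp add: pow)
  moreover have "k < d" using d3 by (simp add: k_def)
  ultimately show ?thesis by blast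
qed

lemma side_form_nonzero:
  assumes "j \<in> {1..d}"
  shows "side_form d j j \<noteq> 0" "side_form d j (j mod d + 1) \<noteq> 0"
  using assms d3 by (cases "j = d"; auto simp: side_form_def unit_vec_def)+

text \<open>Each step back in time adds the side form of one more vertex: a space containing the form of side \<open>i\<close>
  has an element that does not vanish at the next vertex, so the following step also produces the next side form.\<close>

lemma heavy_family_iterate:
  assumes lim: "max_mass n \<longlonglongrightarrow> s"
    and maximal: "\<delta>\<^sub>1 > 0" "\<forall>j\<ge>j\<^sub>1. \<forall>w \<X>. \<not> heavy_family n (Suc N) (s - \<delta>\<^sub>1) j w \<X>"
    and "e > 0"
  shows "\<exists>\<delta>>0. \<exists>j\<^sub>0. \<forall>j\<ge>j\<^sub>0. \<forall>w \<X> X i. heavy_family n N (s - \<delta>) (j + k) w \<X> \<and> X \<in> \<X> \<and>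
      i \<in> {1..d} \<and> (\<exists>c\<in>X. c i \<noteq> 0) \<longrightarrow>
    (\<exists>\<X>' X'. heavy_family n N (s - e) j w \<X>' \<and> X' \<in> \<X>' \<and>
       (\<forall>l\<le>k. \<exists>c\<in>X'. c (((\<lambda>i. i mod d + 1) ^^ l) i) \<noteq> 0) \<and>
       (\<forall>l<k. side_form d (((\<lambda>i. i mod d + 1) ^^ l) i) \<in> X'))"
  using \<open>e > 0\<close>
proof (induction k arbitrary: e)
  case 0
  show ?case
  proof (intro exI[of _ e] conjI exI[of _ "0::nat"] allI impI 0)
    fix j w \<X> X i
    assume *: "heavy_family n N (s - e) (j + 0) w \<X> \<and> X \<in> \<X> \<and> i \<in> {1..d} \<and> (\<exists>c\<in>X. c i \<noteq> 0)"
    show "\<exists>\<X>' X'. heavy_family n N (s - e) j w \<X>' \<and> X' \<in> \<X>' \<and>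
        (\<forall>l\<le>0. \<exists>c\<in>X'. c (((\<lambda>i. i mod d + 1) ^^ l) i) \<noteq> 0) \<and>
        (\<forall>l<0. side_form d (((\<lambda>i. i mod d + 1) ^^ l) i) \<in> X')"
      by (rule exI[of _ \<X>], rule exI[of _ X]) (use * in simp)
  qed
next
  case (Suc k)
  let ?cyc = "\<lambda>l i. ((\<lambda>i. i mod d + 1) ^^ l) i"
  obtain \<delta> j\<^sub>0 where \<delta>: "\<delta> > 0" and step_all: "\<forall>j\<ge>j\<^sub>0. \<forall>w \<X> X.
      heavy_family n N (s - \<delta>) (Suc j) w \<X> \<and> X \<in> \<X> \<longrightarrow>
      (\<exists>\<X>' X'. heavy_family n N (s - e) j w \<X>' \<and> X' \<in> \<X>' \<and>
       (\<forall>i\<in>{1..d}. (\<exists>c\<in>X. c i \<noteq> 0) \<longrightarrow> side_form d i \<in> X'))"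
    using heavy_family_step[OF lim Suc.prems maximal] by (elim exE conjE) (rule that; assumption)
  note step = step_all[THEN spec, THEN mp, THEN spec, THEN spec, THEN spec, THEN mp, OF _ conjI]
  obtain \<delta>' j\<^sub>0' where \<delta>': "\<delta>' > 0" and IH_all: "\<forall>j\<ge>j\<^sub>0'. \<forall>w \<X> X i.
      heavy_family n N (s - \<delta>') (j + k) w \<X> \<and> X \<in> \<X> \<and> i \<in> {1..d} \<and> (\<exists>c\<in>X. c i \<noteq> 0) \<longrightarrow>
      (\<exists>\<X>' X'. heavy_family n N (s - \<delta>) j w \<X>' \<and> X' \<in> \<X>' \<and>
       (\<forall>l\<le>k. \<exists>c\<in>X'. c (?cyc l i) \<noteq> 0) \<and> (\<forall>l<k. side_form d (?cyc l i) \<in> X'))"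
    using Suc.IH[OF \<delta>] by (elim exE conjE) (rule that; assumption)
  note IH = IH_all[THEN spec, THEN mp, THEN spec, THEN spec, THEN spec, THEN spec, THEN mp,
      OF _ conjI[OF _ conjI[OF _ conjI]]]
  have "\<exists>\<X>' X'. heavy_family n N (s - e) j w \<X>' \<and> X' \<in> \<X>' \<and>
       (\<forall>l\<le>Suc k. \<exists>c\<in>X'. c (?cyc l i) \<noteq> 0) \<and> (\<forall>l<Suc k. side_form d (?cyc l i) \<in> X')"
    if j: "j \<ge> max j\<^sub>0 j\<^sub>0'" and h: "heavy_family n N (s - \<delta>') (j + Suc k) w \<X>" "X \<in> \<X>"
      "i \<in> {1..d}" "\<exists>c\<in>X. c i \<noteq> 0" for j w \<X> X i
  proof -
    obtain \<X>1 X1 where 1: "heavy_family n N (s - \<delta>) (Suc j) w \<X>1" "X1 \<in> \<X>1"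
      "\<And>l. l \<le> k \<Longrightarrow> \<exists>c\<in>X1. c (?cyc l i) \<noteq> 0"
      using IH[of "Suc j" w \<X> X i] j h by auto
    obtain \<X>2 X2 where 2: "heavy_family n N (s - e) j w \<X>2" "X2 \<in> \<X>2"
      "\<And>i. i \<in> {1..d} \<Longrightarrow> \<exists>c\<in>X1. c i \<noteq> 0 \<Longrightarrow> side_form d i \<in> X2"
      using step[OF _ 1(1,2)] j by auto
    have sf: "side_form d (?cyc l i) \<in> X2" if "l < Suc k" for l
      using 2(3)[OF cyc_power[OF h(3)] 1(3)] that by simp
    have "\<exists>c\<in>X2. c (?cyc l i) \<noteq> 0" if "l \<le> Suc k" for l
    proof (cases l)
      case 0
      then show ?thesis using sf[of 0] side_form_nonzero(1)[OF cyc_power[OF h(3), of 0]] by auto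
    next
      case (Suc m)
      then have "?cyc l i = ?cyc m i mod d + 1" by simp
      with side_form_nonzero(2)[OF cyc_power[OF h(3), of m]] sf[of m] Suc that show ?thesis by auto
    qed
    with 2(1,2) sf show ?thesis by blast
  qed
  then show ?case using \<delta>' by blast
qed

text \<open>Only constant sequences are annihilated by all side forms, and a nonconstant sequence almost surely stays so.\<close>

lemma mass_side_forms:
  assumes w: "nonconstant w" and X: "X \<in> subspaces_of_dim d n"
    and sf: "\<And>i. i \<in> {1..d} \<Longrightarrow> side_form d i \<in> X"
  shows "mass j w X = 0"
proof -
  have "AE \<omega> in seqs. \<not> (\<forall>c\<in>X. pairing d c (evolve d \<omega> j w) = 0)"
    using AE_evolve_nonconstant[OF w]
  proof eventually_elim
    case (elim \<omega>)
    show ?case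
    proof
      assume *: "\<forall>c\<in>X. pairing d c (evolve d \<omega> j w) = 0"
      have "evolve d \<omega> j w (i mod d + 1) = evolve d \<omega> j w i" if "i \<in> {1..d}" for i
        using pairing_side_form[OF that, of "evolve d \<omega> j w"] * sf[OF that] by simp
      then have "evolve d \<omega> j w i = evolve d \<omega> j w 1" if "i \<in> {1..d}" for i
        using that by (rule cyclic_constant)
      with elim show False unfolding nonconstant_def by blast
    qed
  qed
  then show ?thesis
    unfolding mass_def using mass_event[OF X] by (subst seqs.prob_eq_0) (auto elim: AE_mp)
qed

text \<open>If the limit \<open>s\<close> were positive, then families of spaces with mass near \<open>s\<close> at arbitrarily
  late times would have bounded size: two distinct spaces are jointly annihilating only with the vanishing
  probability of dimension \<open>n + 1\<close>. Going \<open>d\<close> steps back from a family of maximal size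
  \<open>N\<close> leads to a space containing all side forms and having positive mass, a contradiction.\<close>

lemma max_mass_tendsto_step:
  assumes n: "n \<ge> 1" and next_dim: "max_mass (Suc n) \<longlonglongrightarrow> 0"
  shows "max_mass n \<longlonglongrightarrow> 0"
proof -
  have bdd: "bdd_below (range (max_mass n))" by (rule bdd_belowI[of _ 0]) (auto simp: max_mass_nonneg)
  define s where "s = (INF j. max_mass n j)"
  have lim: "max_mass n \<longlonglongrightarrow> s"
    unfolding s_def by (rule LIMSEQ_decseq_INF[OF bdd]) (simp add: decseq_def max_mass_decreasing)
  have s_le: "s \<le> max_mass n j" for j unfolding s_def by (rule cINF_lower[OF bdd]) simp
  have "s = 0"
  proof (rule ccontr)
    assume "s \<noteq> 0"
    moreover have "s \<ge> 0" unfolding s_def by (rule cINF_greatest) (auto simp: max_mass_nonneg)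
    ultimately have s: "s > 0" by simp
    \<comment> \<open>Families of N spaces with masses arbitrarily close to s exist at arbitrarily late times.\<close>
    define rich where "rich N \<longleftrightarrow> (\<forall>\<delta>>0. \<forall>j\<^sub>0. \<exists>j\<ge>j\<^sub>0. \<exists>w \<X>. heavy_family n N (s - \<delta>) j w \<X>)" for N
    have rich1: "rich 1"
      unfolding rich_def
    proof (intro allI impI)
      fix \<delta> :: real and j\<^sub>0 :: nat assume \<delta>: "\<delta> > 0"
      let ?S = "insert 0 {mass j\<^sub>0 w X |w X. nonconstant w \<and> X \<in> subspaces_of_dim d n}"
      have "max 0 (s - \<delta>) < Sup ?S" using s_le[of j\<^sub>0] \<delta> s by (simp add: max_mass_def)
      then obtain v where v: "v \<in> ?S" "max 0 (s - \<delta>) < v"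
        using less_cSup_iff[OF _ max_mass_bdd] by blast
      then obtain w X where wX: "v = mass j\<^sub>0 w X" "nonconstant w" "X \<in> subspaces_of_dim d n" by auto
      then have "heavy_family n 1 (s - \<delta>) j\<^sub>0 w {X}" using v by (auto simp: heavy_family_def)
      then show "\<exists>j\<ge>j\<^sub>0. \<exists>w \<X>. heavy_family n 1 (s - \<delta>) j w \<X>" by blast
    qed
    have bound: "real N < 4 / s" if N: "rich N" for N
    proof (cases "N = 0")
      case False
      \<comment> \<open>With this bound on the intersections, N * s / 2 is at most 1 + N * N * \<kappa> = 3 / 2.\<close>
      define \<kappa> where "\<kappa> = 1 / (2 * real N * real N)"
      have "\<kappa> > 0" using False by (simp add: \<kappa>_def)
      then obtain j\<^sub>0 where j0: "\<And>j. j \<ge> j\<^sub>0 \<Longrightarrow> max_mass (Suc n) j < \<kappa>"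
        using order_tendstoD(2)[OF next_dim] by (auto simp: eventually_sequentially)
      obtain j w \<X> where j: "j \<ge> j\<^sub>0" and h: "heavy_family n N (s - s / 2) j w \<X>"
      proof -
        have "\<exists>j\<ge>j\<^sub>0. \<exists>w \<X>. heavy_family n N (s - s / 2) j w \<X>"
          using N half_gt_zero[OF s] unfolding rich_def by blast
        then show ?thesis using that by blast
      qed
      define E where "E X = {\<omega>\<in>space seqs. \<forall>c\<in>X. pairing d c (evolve d \<omega> j w) = 0}" for X
      have H: "nonconstant w" "\<And>X. X \<in> \<X> \<Longrightarrow> X \<in> subspaces_of_dim d n" "finite \<X>" "card \<X> = N"
        "\<And>X. X \<in> \<X> \<Longrightarrow> s / 2 \<le> seqs.prob (E X)"
        using h by (auto simp: heavy_family_def mass_def E_def)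
      have pair: "seqs.prob (E X \<inter> E Y) \<le> \<kappa>" if XY: "X \<in> \<X>" "Y \<in> \<X> - {X}" for X Y
      proof -
        obtain Z where Z: "Z \<in> subspaces_of_dim d (Suc n)" "Z \<subseteq> span (X \<union> Y)"
          using subspaces_of_dim_join[of X d n Y] H(2) XY by blast
        have "E X \<inter> E Y \<subseteq> E Z"
        proof
          fix \<omega> assume "\<omega> \<in> E X \<inter> E Y"
          then have "\<omega> \<in> space seqs" "\<forall>c\<in>X \<union> Y. pairing d c (evolve d \<omega> j w) = 0" by (auto simp: E_def)
          then show "\<omega> \<in> E Z"
            using Z(2) pairing_zero_on_span[of "X \<union> Y" d "evolve d \<omega> j w"] by (auto simp: E_def)
        qed
        then have "seqs.prob (E X \<inter> E Y) \<le> seqs.prob (E Z)"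
          unfolding E_def using mass_event[OF Z(1)] by (intro seqs.finite_measure_mono) auto
        also have "\<dots> \<le> max_mass (Suc n) j"
          using mass_le_max_mass[OF H(1) Z(1), of j] by (simp add: mass_def E_def)
        finally show ?thesis using j0[OF j] by simp
      qed
      have "real N * (s / 2) = (\<Sum>X\<in>\<X>. s / 2)" using H(4) by simp
      also have "\<dots> \<le> (\<Sum>X\<in>\<X>. seqs.prob (E X))" by (intro sum_mono H(5))
      also have "\<dots> \<le> 1 + (\<Sum>X\<in>\<X>. \<Sum>Y\<in>\<X> - {X}. seqs.prob (E X \<inter> E Y))"
        using H(3) mass_event[OF H(2)] by (intro seqs.sum_prob_le_pairwise) (auto simp: E_def)
      also have "\<dots> \<le> 1 + (\<Sum>X\<in>\<X>. \<Sum>Y\<in>\<X>. \<kappa>)"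
      proof (intro add_left_mono sum_mono)
        fix X assume X: "X \<in> \<X>"
        have "(\<Sum>Y\<in>\<X> - {X}. seqs.prob (E X \<inter> E Y)) \<le> (\<Sum>Y\<in>\<X> - {X}. \<kappa>)"
          using pair[OF X] by (rule sum_mono)
        also have "\<dots> \<le> (\<Sum>Y\<in>\<X>. \<kappa>)"
          using \<open>\<kappa> > 0\<close> H(3) by (intro sum_mono2) auto
        finally show "(\<Sum>Y\<in>\<X> - {X}. seqs.prob (E X \<inter> E Y)) \<le> (\<Sum>Y\<in>\<X>. \<kappa>)" .
      qed
      also have "\<dots> = 3 / 2" using H(4) False by (simp add: \<kappa>_def)
      finally show ?thesis using s by (simp add: field_simps)
    qed (use s in simp)
    define N where "N = Greatest rich"
    have fin: "N' \<le> nat \<lceil>4 / s\<rceil>" if "rich N'" for N' using bound[OF that] by linarith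
    have N: "rich N" unfolding N_def using rich1 fin by (rule GreatestI_nat)
    have N_max: "N' \<le> N" if "rich N'" for N' unfolding N_def using that fin by (rule Greatest_le_nat)
    have "N \<ge> 1" using N_max[OF rich1] .
    have "\<not> rich (Suc N)" using N_max[of "Suc N"] by auto
    then obtain \<delta>\<^sub>1 j\<^sub>1 where maximal: "\<delta>\<^sub>1 > 0"
      "\<forall>j\<ge>j\<^sub>1. \<forall>w \<X>. \<not> heavy_family n (Suc N) (s - \<delta>\<^sub>1) j w \<X>"
      unfolding rich_def by blast
    obtain \<delta> j\<^sub>0 where \<delta>: "\<delta> > 0" and iter_all: "\<forall>j\<ge>j\<^sub>0. \<forall>w \<X> X i.
        heavy_family n N (s - \<delta>) (j + d) w \<X> \<and> X \<in> \<X> \<and> i \<in> {1..d} \<and> (\<exists>c\<in>X. c i \<noteq> 0) \<longrightarrow>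
        (\<exists>\<X>' X'. heavy_family n N (s - s / 2) j w \<X>' \<and> X' \<in> \<X>' \<and>
         (\<forall>l\<le>d. \<exists>c\<in>X'. c (((\<lambda>i. i mod d + 1) ^^ l) i) \<noteq> 0) \<and>
         (\<forall>l<d. side_form d (((\<lambda>i. i mod d + 1) ^^ l) i) \<in> X'))"
      using heavy_family_iterate[OF lim maximal half_gt_zero[OF s], of d]
      by (elim exE conjE) (rule that; assumption)
    note iter = iter_all[THEN spec, THEN mp, THEN spec, THEN spec, THEN spec, THEN spec, THEN mp,
        OF _ conjI[OF _ conjI[OF _ conjI]]]
    obtain j' w \<X> where h: "j' \<ge> j\<^sub>0 + d" "heavy_family n N (s - \<delta>) j' w \<X>"
      using N \<delta> unfolding rich_def by blast
    then have "card \<X> = N" "\<X> \<subseteq> subspaces_of_dim d n" by (auto simp: heavy_family_def)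
    then obtain X where X: "X \<in> \<X>" "X \<in> subspaces_of_dim d n"
    proof -
      have "\<X> \<noteq> {}" using \<open>card \<X> = N\<close> \<open>N \<ge> 1\<close> by auto
      then show ?thesis using that \<open>\<X> \<subseteq> subspaces_of_dim d n\<close> by blast
    qed
    obtain i where i: "i \<in> {1..d}" "\<exists>c\<in>X. c i \<noteq> 0"
      using subspaces_of_dim_index[OF X(2) n] by blast
    define j where "j = j' - d"
    have j: "j' = j + d" "j \<ge> j\<^sub>0" using h(1) by (auto simp: j_def)
    obtain \<X>' X' where X': "heavy_family n N (s - s / 2) j w \<X>'" "X' \<in> \<X>'"
      "\<And>l. l < d \<Longrightarrow> side_form d (((\<lambda>i. i mod d + 1) ^^ l) i) \<in> X'"
      using iter[OF j(2) h(2)[unfolded j(1)] X(1) i] by blast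
    have "side_form d k \<in> X'" if "k \<in> {1..d}" for k
      using cyc_reaches[OF i(1) that] X'(3) by auto
    moreover have "nonconstant w" "X' \<in> subspaces_of_dim d n" "s / 2 \<le> mass j w X'"
      using X'(1,2) by (auto simp: heavy_family_def)
    ultimately show False using mass_side_forms[of w X' n j] s by simp
  qed
  with lim show ?thesis by simp
qed

text \<open>Downward induction, starting above dimension \<open>d\<close>, where there are no spaces at all.\<close>

lemma max_mass_tendsto_0:
  assumes "n \<ge> 1" shows "max_mass n \<longlonglongrightarrow> 0"
proof -
  have empty: "max_mass m \<longlonglongrightarrow> 0" if "m > d" for m
  proof -
    have "subspaces_of_dim d m = {}" using subspaces_of_dim_bound[of _ d m] that by force
    then have "max_mass m = (\<lambda>_. 0)" by (simp add: max_mass_def fun_eq_iff)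
    then show ?thesis by simp
  qed
  show ?thesis
  proof (cases "n \<le> Suc d")
    case True
    then show ?thesis
      using assms
    proof (induction n rule: inc_induct)
      case base
      show ?case by (rule empty) simp
    next
      case (step m)
      have "1 \<le> m" "max_mass (Suc m) \<longlonglongrightarrow> 0" using step by auto
      then show ?case by (rule max_mass_tendsto_step)
    qed
  qed (simp add: empty)
qed

end

section \<open>Oscillation and gain\<close>

lemma finite_coords_convergent_subsequence:
  fixes a :: "nat \<Rightarrow> 'i \<Rightarrow> 'b::heine_borel"
  assumes "finite I" and "\<And>i. i \<in> I \<Longrightarrow> bounded (range (\<lambda>m. a m i))"
  shows "\<exists>r. strict_mono r \<and> (\<forall>i\<in>I. convergent (\<lambda>m. a (r m) i))"
  using assms
proof (induction I rule: finite_induct)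
  case empty
  show ?case by (rule exI[of _ id]) (simp add: strict_mono_def)
next
  case (insert k I)
  then obtain r where r: "strict_mono r" "\<And>i. i \<in> I \<Longrightarrow> convergent (\<lambda>m. a (r m) i)" by auto
  have "bounded (range (\<lambda>m. a (r m) k))"
    by (rule bounded_subset[OF insert.prems[of k]]) auto
  then obtain l r' where r': "strict_mono r'" "((\<lambda>m. a (r m) k) \<circ> r') \<longlonglongrightarrow> l"
    using bounded_imp_convergent_subsequence by blast
  have "convergent (\<lambda>m. a (r (r' m)) i)" if "i \<in> insert k I" for i
  proof (cases "i = k")
    case True
    then show ?thesis using r'(2) by (auto simp: convergent_def comp_def)
  next
    case False
    then show ?thesis
      using convergent_subseq_convergent[OF r(2) r'(1)] that by (auto simp: comp_def)
  qed
  with strict_mono_compose[OF r(1) r'(1)] show ?case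
    by (intro exI[of _ "\<lambda>m. r (r' m)"]) (auto simp: comp_def)
qed

definition osc :: "nat \<Rightarrow> (nat \<Rightarrow> 'v::real_normed_vector) \<Rightarrow> real" where
  "osc d a = Max ((\<lambda>(i, j). norm (a i - a j)) ` ({1..d} \<times> {1..d}))"

lemma osc_ge: "i \<in> {1..d} \<Longrightarrow> j \<in> {1..d} \<Longrightarrow> norm (a i - a j) \<le> osc d a"
  unfolding osc_def by (rule Max_ge) auto

lemma osc_attained:
  assumes "d \<ge> 1"
  obtains i j where "i \<in> {1..d}" "j \<in> {1..d}" "osc d a = norm (a i - a j)"
proof -
  have "osc d a \<in> (\<lambda>(i, j). norm (a i - a j)) ` ({1..d} \<times> {1..d})"
    unfolding osc_def by (rule Max_in) (use assms in auto)
  then show ?thesis using that by auto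
qed

lemma osc_le:
  assumes "d \<ge> 1" "\<And>i j. i \<in> {1..d} \<Longrightarrow> j \<in> {1..d} \<Longrightarrow> norm (a i - a j) \<le> B"
  shows "osc d a \<le> B"
  using assms osc_attained[OF assms(1), of a] by metis

lemma osc_nonneg: "d \<ge> 1 \<Longrightarrow> 0 \<le> osc d a"
  using osc_ge[of 1 d 1 a] by simp

lemma osc_scale:
  assumes "d \<ge> 1" shows "osc d (\<lambda>i. c *\<^sub>R a i) = \<bar>c\<bar> * osc d a"
proof (rule antisym)
  have eq: "norm (c *\<^sub>R a i - c *\<^sub>R a j) = \<bar>c\<bar> * norm (a i - a j)" for i j
    by (simp flip: scaleR_diff_right)
  show "osc d (\<lambda>i. c *\<^sub>R a i) \<le> \<bar>c\<bar> * osc d a"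
    by (rule osc_le[OF assms]) (simp add: eq mult_left_mono osc_ge)
  obtain i j where ij: "i \<in> {1..d}" "j \<in> {1..d}" "osc d a = norm (a i - a j)"
    by (rule osc_attained[OF assms])
  show "\<bar>c\<bar> * osc d a \<le> osc d (\<lambda>i. c *\<^sub>R a i)"
    unfolding ij(3) eq[symmetric] by (rule osc_ge[OF ij(1,2)])
qed

lemma osc_cong: "(\<And>i. i \<in> {1..d} \<Longrightarrow> a i = b i) \<Longrightarrow> osc d a = osc d b"
  unfolding osc_def by (intro arg_cong[of _ _ Max] image_cong) auto

lemma osc_shift: "osc d (\<lambda>i. a i - c) = osc d a"
  by (simp add: osc_def)

lemma osc_evolve_scale:
  assumes "d \<ge> 1"
  shows "osc d (evolve d \<omega> n (\<lambda>i. c *\<^sub>R a i)) = \<bar>c\<bar> * osc d (evolve d \<omega> n a)"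
proof -
  have "(\<lambda>i. c *\<^sub>R a i) = c *\<^sub>R a" by (simp add: fun_eq_iff)
  then have "evolve d \<omega> n (\<lambda>i. c *\<^sub>R a i) = c *\<^sub>R evolve d \<omega> n a"
    by (simp only: linear_scale[OF evolve_linear])
  also have "\<dots> = (\<lambda>i. c *\<^sub>R evolve d \<omega> n a i)" by (simp add: fun_eq_iff)
  finally show ?thesis by (simp only: osc_scale[OF assms])
qed

lemma step_norm_le:
  assumes "0 \<le> x i" "x i \<le> 1" "norm (a i - b) \<le> K" "norm (a (i mod d + 1) - b) \<le> K"
  shows "norm (step d x a i - b) \<le> K"
proof -
  have "step d x a i - b = (1 - x i) *\<^sub>R (a i - b) + x i *\<^sub>R (a (i mod d + 1) - b)"
    by (simp add: step_def algebra_simps)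
  then have "norm (step d x a i - b) \<le> (1 - x i) * norm (a i - b) + x i * norm (a (i mod d + 1) - b)"
    using norm_triangle_ineq[of "(1 - x i) *\<^sub>R (a i - b)" "x i *\<^sub>R (a (i mod d + 1) - b)"] assms
    by simp
  also have "\<dots> \<le> (1 - x i) * K + x i * K"
    using assms by (intro add_mono mult_left_mono) auto
  finally show ?thesis by (simp add: algebra_simps)
qed

text \<open>A step replaces entries by convex combinations of entries.\<close>

lemma osc_step_le:
  assumes d: "d \<ge> 1" and x: "\<And>i. i \<in> {1..d} \<Longrightarrow> 0 \<le> x i \<and> x i \<le> 1"
  shows "osc d (step d x a) \<le> osc d a"
proof (rule osc_le[OF d])
  fix i j assume i: "i \<in> {1..d}" and j: "j \<in> {1..d}"
  have "norm (step d x a j - a k) \<le> osc d a" if "k \<in> {1..d}" for k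
    using x[OF j] osc_ge[OF j that] osc_ge[OF cyc_mem[OF j] that] by (intro step_norm_le) auto
  then have "norm (a k - step d x a j) \<le> osc d a" if "k \<in> {1..d}" for k
    using that by (simp add: norm_minus_commute)
  from this[OF i] this[OF cyc_mem[OF i]] show "norm (step d x a i - step d x a j) \<le> osc d a"
    using x[OF i] by (intro step_norm_le) auto
qed

lemma regular_unit: "regular d x \<Longrightarrow> i \<in> {1..d} \<Longrightarrow> 0 \<le> x i \<and> x i \<le> 1"
proof -
  assume "regular d x" "i \<in> {1..d}"
  then have "x i \<in> {0<..<1}" unfolding regular_def by blast
  then show ?thesis by simp
qed

lemma osc_evolve_decreasing:
  assumes "d \<ge> 1" "\<And>n. regular d (\<omega> n)"
  shows "osc d (evolve d \<omega> n a) \<le> osc d a"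
proof (induction n)
  case (Suc n)
  have "osc d (step d (\<omega> n) (evolve d \<omega> n a)) \<le> osc d (evolve d \<omega> n a)"
    by (rule osc_step_le[OF assms(1) regular_unit[OF assms(2)]])
  with Suc show ?case by simp
qed simp

lemma evolve_bounded:
  assumes "\<And>n. regular d (\<omega> n)" "\<And>i. i \<in> {1..d} \<Longrightarrow> norm (a i) \<le> K" "i \<in> {1..d}"
  shows "norm (evolve d \<omega> n a i) \<le> K"
  using assms(3)
proof (induction n arbitrary: i)
  case (Suc n)
  then show ?case
    using step_norm_le[of "\<omega> n" i "evolve d \<omega> n a" 0 K d] regular_unit[OF assms(1) Suc.prems]
      Suc.IH[OF Suc.prems] Suc.IH[OF cyc_mem[OF Suc.prems]] by simp
qed (use assms in auto)

lemma evolve_expand: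
  fixes a :: "nat \<Rightarrow> real"
  assumes "i \<in> {1..d}"
  shows "evolve d \<omega> n a i = (\<Sum>k=1..d. a k * evolve d \<omega> n (unit_vec k) i)"
proof -
  have sum_app: "(\<Sum>k\<in>I. f k) j = (\<Sum>k\<in>I. f k j)" if "finite I" for I :: "nat set" and f :: "nat \<Rightarrow> nat \<Rightarrow> real" and j
    using that by (induction I rule: finite_induct) auto
  have "evolve d \<omega> n a i = evolve d \<omega> n (\<Sum>k\<in>{1..d}. a k *\<^sub>R unit_vec k) i"
  proof (rule evolve_local[OF _ assms])
    fix j assume j: "j \<in> {1..d}"
    have "(\<Sum>k\<in>{1..d}. a k *\<^sub>R unit_vec k) j = (\<Sum>k\<in>{1..d}. if j = k then a k else 0)"
      unfolding sum_app[OF finite_atLeastAtMost] by (intro sum.cong) (auto simp: unit_vec_def)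
    then show "a j = (\<Sum>k\<in>{1..d}. a k *\<^sub>R unit_vec k) j" using j by simp
  qed
  also have "\<dots> = (\<Sum>k=1..d. a k * evolve d \<omega> n (unit_vec k) i)"
    unfolding linear_sum[OF evolve_linear] linear_scale[OF evolve_linear]
      sum_app[OF finite_atLeastAtMost] by simp
  finally show ?thesis .
qed

text \<open>A concrete substitute for the operator norm of the evolution on sequences modulo constants, with which it agrees up
  to a factor \<open>d\<close>; see \<open>osc_evolve_le_gain\<close>.\<close>

definition gain :: "nat \<Rightarrow> (nat \<Rightarrow> nat \<Rightarrow> real) \<Rightarrow> nat \<Rightarrow> real" where
  "gain d \<omega> n = Max ((\<lambda>k. osc d (evolve d \<omega> n (unit_vec k))) ` {1..d})"

lemma gain_ge: "k \<in> {1..d} \<Longrightarrow> osc d (evolve d \<omega> n (unit_vec k)) \<le> gain d \<omega> n"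
  unfolding gain_def by (rule Max_ge) auto

lemma gain_attained:
  assumes "d \<ge> 1"
  obtains k where "k \<in> {1..d}" "gain d \<omega> n = osc d (evolve d \<omega> n (unit_vec k))"
proof -
  have "gain d \<omega> n \<in> (\<lambda>k. osc d (evolve d \<omega> n (unit_vec k))) ` {1..d}"
    unfolding gain_def by (rule Max_in) (use assms in auto)
  then show ?thesis using that by auto
qed

lemma gain_nonneg: "d \<ge> 1 \<Longrightarrow> 0 \<le> gain d \<omega> n"
  using gain_attained osc_nonneg by metis

text \<open>Subtract the constant \<open>a 1\<close> and expand the rest in unit sequences.\<close>

lemma osc_evolve_le_gain:
  fixes a :: "nat \<Rightarrow> real"
  assumes d: "d \<ge> 1"
  shows "osc d (evolve d \<omega> n a) \<le> real d * osc d a * gain d \<omega> n"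
proof (rule osc_le[OF d])
  fix i j assume ij: "i \<in> {1..d}" "j \<in> {1..d}"
  have one: "(1::nat) \<in> {1..d}" using d by simp
  let ?E = "\<lambda>k. evolve d \<omega> n (unit_vec k)"
  have *: "evolve d \<omega> n a i = (\<Sum>k=1..d. (a k - a 1) * ?E k i) + a 1" if "i \<in> {1..d}" for i
  proof -
    have "(\<Sum>k=1..d. a 1 * ?E k i) = a 1"
      using evolve_expand[OF that, of \<omega> n "\<lambda>_. a 1"] by (simp add: evolve_const)
    then show ?thesis
      unfolding evolve_expand[OF that, of \<omega> n a] by (simp add: left_diff_distrib sum_subtractf)
  qed
  have diff: "evolve d \<omega> n a i - evolve d \<omega> n a j = (\<Sum>k=1..d. (a k - a 1) * (?E k i - ?E k j))"
    unfolding *[OF ij(1)] *[OF ij(2)] by (simp add: sum_subtractf right_diff_distrib)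
  have "norm (\<Sum>k=1..d. (a k - a 1) * (?E k i - ?E k j)) \<le> (\<Sum>k=1..d. osc d a * gain d \<omega> n)"
  proof (rule sum_norm_le)
    fix k assume k: "k \<in> {1..d}"
    have "norm (?E k i - ?E k j) \<le> gain d \<omega> n"
      using osc_ge[OF ij, of "?E k"] gain_ge[OF k, of \<omega> n] by linarith
    moreover have "norm (a k - a 1) \<le> osc d a" by (rule osc_ge[OF k one])
    ultimately show "norm ((a k - a 1) * (?E k i - ?E k j)) \<le> osc d a * gain d \<omega> n"
      unfolding norm_mult by (intro mult_mono) (auto simp: osc_nonneg[OF d])
  qed
  then show "norm (evolve d \<omega> n a i - evolve d \<omega> n a j) \<le> real d * osc d a * gain d \<omega> n"
    unfolding diff by simp
qed

definition unit_forms :: "nat \<Rightarrow> (nat \<Rightarrow> real) set" where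
  "unit_forms d = {c \<in> vecs d. (\<forall>i\<in>{1..d}. \<bar>c i\<bar> \<le> 1) \<and> (\<exists>i\<in>{1..d}. \<bar>c i\<bar> = 1)}"

text \<open>The form is the difference between the two entries at which the fastest growing unit sequence attains its
  oscillation, divided by the gain; its coefficients are bounded by one by the definition of the gain.\<close>

lemma gain_form:
  assumes d: "d \<ge> 1" and pos: "gain d \<omega> n > 0"
  shows "\<exists>c\<in>unit_forms d. \<forall>a. \<bar>pairing d c a\<bar> * gain d \<omega> n \<le> osc d (evolve d \<omega> n a)"
proof -
  let ?E = "\<lambda>k. evolve d \<omega> n (unit_vec k)"
  obtain k where k: "k \<in> {1..d}" "gain d \<omega> n = osc d (?E k)" by (rule gain_attained[OF d])
  obtain i j where ij: "i \<in> {1..d}" "j \<in> {1..d}" "osc d (?E k) = norm (?E k i - ?E k j)"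
    by (rule osc_attained[OF d])
  define c where "c = (\<lambda>l. if l \<in> {1..d} then (?E l i - ?E l j) / gain d \<omega> n else 0)"
  have "norm (?E l i - ?E l j) \<le> gain d \<omega> n" if "l \<in> {1..d}" for l
    using osc_ge[OF ij(1,2), of "?E l"] gain_ge[OF that, of \<omega> n] by linarith
  then have "\<bar>c l\<bar> \<le> 1" if "l \<in> {1..d}" for l
    using that pos by (simp add: c_def abs_divide divide_le_eq)
  moreover have "\<bar>c k\<bar> = 1" using k ij pos by (simp add: c_def abs_divide)
  ultimately have "c \<in> unit_forms d"
    using k(1) unfolding unit_forms_def by (auto simp: vecs_def c_def)
  moreover have "\<bar>pairing d c a\<bar> * gain d \<omega> n \<le> osc d (evolve d \<omega> n a)" for a
  proof -
    have "pairing d c a * gain d \<omega> n = (\<Sum>l=1..d. a l * (?E l i - ?E l j))"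
      unfolding pairing_def sum_distrib_right using pos by (intro sum.cong) (auto simp: c_def)
    also have "\<dots> = evolve d \<omega> n a i - evolve d \<omega> n a j"
      unfolding evolve_expand[OF ij(1), of \<omega> n a] evolve_expand[OF ij(2), of \<omega> n a]
      by (simp add: sum_subtractf right_diff_distrib)
    finally have "\<bar>pairing d c a * gain d \<omega> n\<bar> = norm (evolve d \<omega> n a i - evolve d \<omega> n a j)"
      by simp
    then have "\<bar>pairing d c a\<bar> * gain d \<omega> n = norm (evolve d \<omega> n a i - evolve d \<omega> n a j)"
      using pos by (simp add: abs_mult)
    then show ?thesis using osc_ge[OF ij(1,2), of "evolve d \<omega> n a"] by simp
  qed
  ultimately show ?thesis by blast
qed

lemma gain_add_le:
  assumes d: "d \<ge> 1" and reg: "\<And>n. regular d (\<omega> n)"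
  shows "gain d \<omega> (n + k) \<le> real d * gain d (\<lambda>m. \<omega> (n + m)) k"
proof -
  obtain l where l: "l \<in> {1..d}" "gain d \<omega> (n + k) = osc d (evolve d \<omega> (n + k) (unit_vec l))"
    by (rule gain_attained[OF d])
  have "osc d (unit_vec l) \<le> 1" by (rule osc_le[OF d]) (auto simp: unit_vec_def)
  then have "osc d (evolve d \<omega> n (unit_vec l)) \<le> 1"
    using osc_evolve_decreasing[where \<omega> = \<omega> and n = n and a = "unit_vec l", OF d reg] by linarith
  have "gain d \<omega> (n + k) \<le> real d * osc d (evolve d \<omega> n (unit_vec l)) * gain d (\<lambda>m. \<omega> (n + m)) k"
    unfolding l(2) evolve_add by (rule osc_evolve_le_gain[OF d])
  also have "\<dots> \<le> real d * 1 * gain d (\<lambda>m. \<omega> (n + m)) k"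
    by (intro mult_right_mono mult_left_mono gain_nonneg[OF d] of_nat_0_le_iff) fact
  finally show ?thesis by simp
qed

lemma gain_cong: "(\<And>m. m < n \<Longrightarrow> \<omega> m = \<omega>' m) \<Longrightarrow> gain d \<omega> n = gain d \<omega>' n"
  unfolding gain_def by (simp cong: evolve_cong)

lemma eventually_abs_less:
  fixes f :: "'a \<Rightarrow> real"
  shows "(f \<longlongrightarrow> 0) F \<Longrightarrow> e > 0 \<Longrightarrow> \<forall>\<^sub>F x in F. \<bar>f x\<bar> < e"
  by (rule order_tendstoD(2)[OF tendsto_rabs_zero])

context subdivision_law
begin

lemma d1: "d \<ge> 1" using d3 by simp

lemma osc_evolve_meas [measurable]:
  fixes a :: "nat \<Rightarrow> 'v::{real_normed_vector, second_countable_topology}"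
  shows "(\<lambda>\<omega>. osc d (evolve d \<omega> n a)) \<in> borel_measurable seqs"
proof -
  have "(\<lambda>\<omega>. norm (evolve d \<omega> n a i - evolve d \<omega> n a j)) \<in> borel_measurable seqs"
    if "i \<in> {1..d}" "j \<in> {1..d}" for i j
    using evolve_meas[OF that(1), of n a] evolve_meas[OF that(2), of n a] by measurable
  then show ?thesis
    unfolding osc_def case_prod_beta by (intro borel_measurable_Max) auto
qed

lemma gain_meas [measurable]: "(\<lambda>\<omega>. gain d \<omega> n) \<in> borel_measurable seqs"
  unfolding gain_def by (intro borel_measurable_Max) auto

lemma osc_pos_iff: "osc d a > 0 \<longleftrightarrow> nonconstant a"
proof
  assume "osc d a > 0"
  then obtain i j where "i \<in> {1..d}" "j \<in> {1..d}" "norm (a i - a j) > 0"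
    using osc_attained[OF d1, of a] by metis
  then show "nonconstant a" unfolding nonconstant_def by (metis norm_zero right_minus_eq order_less_irrefl)
next
  assume "nonconstant a"
  then obtain i where i: "i \<in> {1..d}" "a i \<noteq> a 1" unfolding nonconstant_def by blast
  then have "0 < norm (a i - a 1)" by simp
  also have "\<dots> \<le> osc d a" by (rule osc_ge) (use i d1 in auto)
  finally show "osc d a > 0" .
qed

lemma AE_gain_pos: "AE \<omega> in seqs. \<forall>n. gain d \<omega> n > 0"
proof -
  have "nonconstant (unit_vec 1)" unfolding nonconstant_def unit_vec_def using d3 by (intro bexI[of _ 2]) auto
  from AE_evolve_nonconstant[OF this] show ?thesis
  proof eventually_elim
    case (elim \<omega>)
    have "1 \<in> {1..d}" using d1 by simp
    from gain_ge[OF this, of \<omega>] elim osc_pos_iff show ?case by (metis order_less_le_trans)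
  qed
qed

section \<open>Small balls\<close>

text \<open>Choose a time at which a single form annihilates the evolved sequence with probability less than
  \<open>\<eta>\<close>. If no radius \<open>e\<close> worked for all sequences and forms, then a subsequence of
  counterexamples with radii tending to \<open>0\<close> would converge to a nonconstant sequence and a nonzero form,
  because the normalisations are preserved in the limit. The evolution is Lipschitz uniformly in the ratios, so for
  the limit pair exact annihilation would have probability at least \<open>\<eta>\<close>.\<close>

lemma small_ball:
  assumes "\<eta> > 0"
  shows "\<exists>j. \<exists>e>0. \<forall>w c. (\<forall>i\<in>{1..d}. \<bar>w i\<bar> \<le> 1) \<and> (\<exists>i\<in>{1..d}. \<bar>w i - w 1\<bar> \<ge> 1 / 2) \<and> c \<in> unit_forms d \<longrightarrow>
    seqs.prob {\<omega>\<in>space seqs. \<bar>pairing d c (evolve d \<omega> j w)\<bar> \<le> e} \<le> \<eta>"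
proof -
  obtain j where j: "max_mass 1 j < \<eta>"
    using order_tendstoD(2)[OF max_mass_tendsto_0[of 1] assms] by (auto simp: eventually_sequentially)
  define adm where "adm w c \<longleftrightarrow> (\<forall>i\<in>{1..d}. \<bar>w i\<bar> \<le> 1) \<and> (\<exists>i\<in>{1..d}. \<bar>w i - w 1\<bar> \<ge> 1 / 2) \<and>
    c \<in> unit_forms d" for w c :: "nat \<Rightarrow> real"
  let ?p = "\<lambda>w c e. seqs.prob {\<omega>\<in>space seqs. \<bar>pairing d c (evolve d \<omega> j w)\<bar> \<le> e}"
  define prb where "prb w c e = ?p w c e" for w c e
  have "\<exists>e>0. \<forall>w c. adm w c \<longrightarrow> prb w c e \<le> \<eta>"
  proof (rule ccontr)
    assume neg: "\<not> ?thesis"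
    have "\<exists>w c. adm w c \<and> \<eta> < prb w c (1 / real (Suc m))" for m
    proof -
      have "0 < 1 / real (Suc m)" by simp
      with neg show ?thesis by (meson not_le)
    qed
    then obtain w c where adm: "\<And>m. adm (w m) (c m)" and p': "\<And>m. \<eta> < prb (w m) (c m) (1 / real (Suc m))"
      by metis
    note p = p'[unfolded prb_def]
    define a where "a m i = (w m i, c m i)" for m i
    have wb: "\<bar>w m i\<bar> \<le> 1" and cb: "\<bar>c m i\<bar> \<le> 1" if "i \<in> {1..d}" for m i
      using adm[of m, unfolded adm_def] that by (auto simp: unit_forms_def)
    have "bounded (range (\<lambda>m. a m i))" if "i \<in> {1..d}" for i
    proof (rule bounded_subset)
      show "bounded (cball (0::real) 1 \<times> cball (0::real) 1)" by (intro bounded_Times bounded_cball)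
      show "range (\<lambda>m. a m i) \<subseteq> cball (0::real) 1 \<times> cball (0::real) 1"
        using wb[OF that] cb[OF that] by (auto simp: a_def)
    qed
    from finite_coords_convergent_subsequence[of "{1..d}" a, OF finite_atLeastAtMost this]
    obtain r where r: "strict_mono r" "\<And>i. i \<in> {1..d} \<Longrightarrow> convergent (\<lambda>m. a (r m) i)" by blast
    then obtain l where l: "\<And>i. i \<in> {1..d} \<Longrightarrow> (\<lambda>m. a (r m) i) \<longlonglongrightarrow> l i"
      unfolding convergent_def by metis
    define w' where "w' i = fst (l i)" for i
    define c' where "c' i = (if i \<in> {1..d} then snd (l i) else 0)" for i
    have wl: "(\<lambda>m. w (r m) i) \<longlonglongrightarrow> w' i" and cl: "(\<lambda>m. c (r m) i) \<longlonglongrightarrow> c' i" if "i \<in> {1..d}" for i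
      using tendsto_fst[OF l[OF that]] tendsto_snd[OF l[OF that]] that
      by (auto simp: a_def w'_def c'_def)
    have w'b: "\<bar>w' i\<bar> \<le> 1" if "i \<in> {1..d}" for i
      by (rule tendsto_upperbound[OF tendsto_rabs[OF wl[OF that]]]) (use wb that in auto)
    have one: "1 \<in> {1..d}" using d1 by simp
    have w'nc: "nonconstant w'"
    proof (rule ccontr)
      assume "\<not> nonconstant w'"
      then have eq: "w' i = w' 1" if "i \<in> {1..d}" for i using that unfolding nonconstant_def by blast
      have lim0: "(\<lambda>m. w (r m) i - w (r m) 1) \<longlonglongrightarrow> 0" if "i \<in> {1..d}" for i
        using tendsto_diff[OF wl[OF that] wl[OF one]] eq[OF that] by simp
      have "\<forall>\<^sub>F m in sequentially. \<bar>w (r m) i - w (r m) 1\<bar> < 1 / 2" if "i \<in> {1..d}" for i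
        by (rule eventually_abs_less[OF lim0[OF that] half_gt_zero[OF zero_less_one]])
      then have "\<forall>\<^sub>F m in sequentially. \<forall>i\<in>{1..d}. \<bar>w (r m) i - w (r m) 1\<bar> < 1 / 2"
        by (intro eventually_ball_finite) auto
      then obtain m where "\<forall>i\<in>{1..d}. \<bar>w (r m) i - w (r m) 1\<bar> < 1 / 2"
        by (auto simp: eventually_sequentially)
      with adm[of "r m", unfolded adm_def] show False by force
    qed
    have c'V: "c' \<in> vecs d" by (auto simp: c'_def vecs_def)
    have c'nz: "c' \<noteq> 0"
    proof
      assume "c' = 0"
      then have lim0: "(\<lambda>m. c (r m) i) \<longlonglongrightarrow> 0" if "i \<in> {1..d}" for i using cl[OF that] by simp
      have "\<forall>\<^sub>F m in sequentially. \<bar>c (r m) i\<bar> < 1" if "i \<in> {1..d}" for i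
        by (rule eventually_abs_less[OF lim0[OF that] zero_less_one])
      then have "\<forall>\<^sub>F m in sequentially. \<forall>i\<in>{1..d}. \<bar>c (r m) i\<bar> < 1"
        by (intro eventually_ball_finite) auto
      then obtain m where "\<forall>i\<in>{1..d}. \<bar>c (r m) i\<bar> < 1" by (auto simp: eventually_sequentially)
      with adm[of "r m", unfolded adm_def] show False by (force simp: unit_forms_def)
    qed
    \<comment> \<open>Passing from the m-th counterexample to the limit changes the pairing by at most the sum; the
      first summand is the radius of the counterexample.\<close>
    define \<delta> where "\<delta> m = 1 / real (Suc (r m)) +
      (\<Sum>i=1..d. (\<Sum>k=1..d. \<bar>w (r m) k - w' k\<bar>) + \<bar>c (r m) i - c' i\<bar>)" for m
    have "\<delta> \<longlonglongrightarrow> 0 + (\<Sum>i=1..d. (\<Sum>k=1..d. 0) + 0)"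
      unfolding \<delta>_def
    proof (intro tendsto_add tendsto_sum tendsto_rabs_zero)
      show "(\<lambda>m. 1 / real (Suc (r m))) \<longlonglongrightarrow> 0"
        using LIMSEQ_subseq_LIMSEQ[OF lim_1_over_n[THEN LIMSEQ_Suc] r(1)] by (simp add: comp_def)
    qed (use wl cl in \<open>auto intro: LIM_zero\<close>)
    then have \<delta>0: "\<delta> \<longlonglongrightarrow> 0" by simp
    have big: "?p w' c' (\<delta> m) \<ge> \<eta>" for m
    proof -
      have "AE \<omega> in seqs. \<omega> \<in> {\<omega>\<in>space seqs. \<bar>pairing d (c (r m)) (evolve d \<omega> j (w (r m)))\<bar> \<le> 1 / real (Suc (r m))} \<longrightarrow>
         \<omega> \<in> {\<omega>\<in>space seqs. \<bar>pairing d c' (evolve d \<omega> j w')\<bar> \<le> \<delta> m}"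
        using AE_seqs_regular
      proof eventually_elim
        case (elim \<omega>)
        let ?G = "evolve d \<omega> j"
        have bnd: "\<bar>c (r m) i * ?G (w (r m)) i - c' i * ?G w' i\<bar> \<le> (\<Sum>k=1..d. \<bar>w (r m) k - w' k\<bar>) + \<bar>c (r m) i - c' i\<bar>"
          if i: "i \<in> {1..d}" for i
        proof -
          have "?G (w (r m)) i - ?G w' i = ?G (w (r m) - w') i"
            by (simp add: linear_diff[OF evolve_linear])
          moreover have "norm (?G (w (r m) - w') i) \<le> (\<Sum>k=1..d. \<bar>w (r m) k - w' k\<bar>)"
            using elim i by (intro evolve_bounded) (auto intro: member_le_sum)
          ultimately have 1: "\<bar>?G (w (r m)) i - ?G w' i\<bar> \<le> (\<Sum>k=1..d. \<bar>w (r m) k - w' k\<bar>)" by simp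
          have 2: "\<bar>?G w' i\<bar> \<le> 1" using evolve_bounded[of d \<omega> w' 1 i j] elim w'b i by simp
          have "c (r m) i * ?G (w (r m)) i - c' i * ?G w' i =
              c (r m) i * (?G (w (r m)) i - ?G w' i) + (c (r m) i - c' i) * ?G w' i"
            by (simp add: algebra_simps)
          also have "\<bar>\<dots>\<bar> \<le> \<bar>c (r m) i\<bar> * \<bar>?G (w (r m)) i - ?G w' i\<bar> + \<bar>c (r m) i - c' i\<bar> * \<bar>?G w' i\<bar>"
            by (metis abs_mult abs_triangle_ineq)
          also have "\<dots> \<le> 1 * (\<Sum>k=1..d. \<bar>w (r m) k - w' k\<bar>) + \<bar>c (r m) i - c' i\<bar> * 1"
            using 1 2 cb[OF i] by (intro add_mono mult_mono) auto
          finally show ?thesis by simp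
        qed
        have "\<bar>pairing d (c (r m)) (?G (w (r m))) - pairing d c' (?G w')\<bar> \<le>
            (\<Sum>i=1..d. (\<Sum>k=1..d. \<bar>w (r m) k - w' k\<bar>) + \<bar>c (r m) i - c' i\<bar>)"
          unfolding pairing_def sum_subtractf[symmetric]
          by (rule order_trans[OF sum_abs sum_mono]) (rule bnd)
        then show ?case by (auto simp: \<delta>_def)
      qed
      then have "?p (w (r m)) (c (r m)) (1 / real (Suc (r m))) \<le> ?p w' c' (\<delta> m)"
        by (intro seqs.finite_measure_mono_AE) measurable
      with p[of "r m"] show ?thesis by linarith
    qed
    have big': "?p w' c' (1 / real (Suc k)) \<ge> \<eta>" for k
    proof -
      obtain m where "\<delta> m < 1 / real (Suc k)"
        using order_tendstoD(2)[OF \<delta>0, of "1 / real (Suc k)"] by (auto simp: eventually_sequentially)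
      then have "?p w' c' (\<delta> m) \<le> ?p w' c' (1 / real (Suc k))"
        by (intro seqs.finite_measure_mono) auto
      with big[of m] show ?thesis by linarith
    qed
    let ?A = "\<lambda>k. {\<omega>\<in>space seqs. \<bar>pairing d c' (evolve d \<omega> j w')\<bar> \<le> 1 / real (Suc k)}"
    have "(\<lambda>k. seqs.prob (?A k)) \<longlonglongrightarrow> seqs.prob (\<Inter>k. ?A k)"
    proof (rule seqs.finite_Lim_measure_decseq)
      show "range ?A \<subseteq> sets seqs" by auto
      show "decseq ?A"
        by (rule decseq_SucI) (auto elim!: order_trans simp: field_simps)
    qed
    then have "\<eta> \<le> seqs.prob (\<Inter>k. ?A k)" by (rule LIMSEQ_le_const) (use big' in blast)
    also have "(\<Inter>k. ?A k) = {\<omega>\<in>space seqs. pairing d c' (evolve d \<omega> j w') = 0}"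
    proof -
      have "x = 0" if "\<And>k. \<bar>x\<bar> \<le> 1 / real (Suc k)" for x :: real
        using LIMSEQ_le_const[OF lim_1_over_n[THEN LIMSEQ_Suc], of "\<bar>x\<bar>"] that by auto
      then show ?thesis by auto
    qed
    also have "seqs.prob \<dots> = mass j w' (span {c'})"
      by (simp add: mass_def pairing_zero_on_span)
    also have "\<dots> \<le> max_mass 1 j"
      by (rule mass_le_max_mass[OF w'nc])
        (use c'V c'nz in \<open>auto simp: subspaces_of_dim_def intro!: exI[of _ "{c'}"]\<close>)
    finally show False using j by simp
  qed
  then show ?thesis unfolding adm_def prb_def by blast
qed

end

lemma evolve_shift:
  fixes a :: "nat \<Rightarrow> 'v::real_vector"
  shows "evolve d \<omega> n (\<lambda>i. a i - c) i = evolve d \<omega> n a i - c"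
proof -
  have "(\<lambda>i. a i - c) = a - (\<lambda>_. c)" by (simp add: fun_eq_iff)
  then have "evolve d \<omega> n (\<lambda>i. a i - c) = evolve d \<omega> n a - evolve d \<omega> n (\<lambda>_. c)"
    by (simp only: linear_diff[OF evolve_linear])
  then show ?thesis by (simp add: evolve_const)
qed

context subdivision_law
begin

section \<open>Comparing a single sequence with the gain\<close>

text \<open>Fubini in the other order: it suffices to bound the probability over the path up to time \<open>n\<close> for every
  fixed regular continuation.\<close>

lemma split_future:
  assumes meas: "{\<omega>\<in>space seqs. Q \<omega>} \<in> sets seqs"
    and le: "\<And>\<omega>'. \<omega>' \<in> space seqs \<Longrightarrow> (\<forall>n. regular d (\<omega>' n)) \<Longrightarrow>
      seqs.prob {\<omega>\<in>space seqs. Q (comb_seq n \<omega> \<omega>')} \<le> \<eta>"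
  shows "seqs.prob {\<omega>\<in>space seqs. Q \<omega>} \<le> \<eta>"
proof -
  let ?P = "seqs \<Otimes>\<^sub>M seqs"
  interpret pair: pair_prob_space seqs seqs ..
  let ?A = "{z\<in>space ?P. Q (comb_seq n (fst z) (snd z))}"
  have A: "?A = (\<lambda>(\<omega>, \<omega>'). comb_seq n \<omega> \<omega>') -` {\<omega>\<in>space seqs. Q \<omega>} \<inter> space ?P"
    using measurable_space[OF measurable_comb_seq[of n ratios]] by (auto simp: case_prod_beta)
  have Am [measurable]: "?A \<in> sets ?P"
    unfolding A by (rule measurable_sets[OF measurable_comb_seq meas])
  have sec: "(\<lambda>\<omega>. (\<omega>, \<omega>')) -` ?A = {\<omega>\<in>space seqs. Q (comb_seq n \<omega> \<omega>')}" if "\<omega>' \<in> space seqs" for \<omega>'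
    using that by (auto simp: space_pair_measure)
  obtain \<omega>\<^sub>0 where "\<omega>\<^sub>0 \<in> space seqs" "\<forall>n. regular d (\<omega>\<^sub>0 n)"
  proof -
    have "\<exists>\<omega>. \<omega> \<in> space seqs \<and> (\<forall>n. regular d (\<omega> n))"
    proof (rule ccontr)
      assume none: "\<not> ?thesis"
      have "AE \<omega> in seqs. False"
        using AE_seqs_regular AE_space by eventually_elim (use none in blast)
      then show False by simp
    qed
    then show ?thesis using that by blast
  qed
  from le[OF this] have \<eta>: "\<eta> \<ge> 0" by (rule order_trans[OF measure_nonneg])
  have "emeasure seqs {\<omega>\<in>space seqs. Q \<omega>} =
      emeasure (distr ?P seqs (\<lambda>(\<omega>, \<omega>'). comb_seq n \<omega> \<omega>')) {\<omega>\<in>space seqs. Q \<omega>}"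
    by (simp only: seqs.PiM_comb_seq)
  also have "\<dots> = emeasure ?P ?A"
    unfolding A by (rule emeasure_distr[OF measurable_comb_seq meas])
  also have "\<dots> = (\<integral>\<^sup>+\<omega>'. emeasure seqs ((\<lambda>\<omega>. (\<omega>, \<omega>')) -` ?A) \<partial>seqs)"
    by (rule pair.emeasure_pair_measure_alt2[OF Am])
  also have "\<dots> \<le> (\<integral>\<^sup>+\<omega>'. ennreal \<eta> \<partial>seqs)"
  proof (rule nn_integral_mono_AE)
    show "AE \<omega>' in seqs. emeasure seqs ((\<lambda>\<omega>. (\<omega>, \<omega>')) -` ?A) \<le> ennreal \<eta>"
      using AE_seqs_regular AE_space
    proof eventually_elim
      case (elim \<omega>')
      then show ?case
        unfolding sec[OF elim(2)] seqs.emeasure_eq_measure using le by (intro ennreal_leI) blast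
    qed
  qed
  also have "\<dots> = ennreal \<eta>" by (simp add: seqs.emeasure_space_1)
  finally show ?thesis by (simp add: seqs.emeasure_eq_measure \<eta>)
qed

lemma regular_comb_seq:
  "(\<forall>n. regular d (\<omega> n)) \<Longrightarrow> (\<forall>n. regular d (\<omega>' n)) \<Longrightarrow> regular d (comb_seq k \<omega> \<omega>' m)"
  by (simp add: comb_seq_def)

text \<open>Fix the steps after time \<open>j\<close>. They provide a form \<open>c\<close> such that the final oscillation is
  at least their gain times the pairing of \<open>c\<close> with the sequence at time \<open>j\<close>, and by the
  small-ball estimate this pairing is unlikely to be below \<open>e\<close>. The total gain exceeds the gain of the
  later steps by a factor of at most \<open>d\<close>, because the first \<open>j\<close> steps do not increase
  oscillations.\<close>

lemma nondegenerate_fixed_time: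
  assumes \<eta>: "\<eta> > 0"
  shows "\<exists>e>0. \<exists>j. \<forall>(w :: nat \<Rightarrow> real) k. osc d w = 1 \<and> j \<le> k \<longrightarrow>
    seqs.prob {\<omega>\<in>space seqs. osc d (evolve d \<omega> k w) < e * gain d \<omega> k} \<le> \<eta>"
proof -
  obtain j e where e: "e > 0" and ball: "\<forall>w c. (\<forall>i\<in>{1..d}. \<bar>w i\<bar> \<le> 1) \<and> (\<exists>i\<in>{1..d}. \<bar>w i - w 1\<bar> \<ge> 1 / 2) \<and> c \<in> unit_forms d \<longrightarrow>
    seqs.prob {\<omega>\<in>space seqs. \<bar>pairing d c (evolve d \<omega> j w)\<bar> \<le> e} \<le> \<eta>"
    using small_ball[OF \<eta>] by (elim exE conjE) (rule that; assumption)
  have "seqs.prob {\<omega>\<in>space seqs. osc d (evolve d \<omega> k w) < e / real d * gain d \<omega> k} \<le> \<eta>"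
    if w: "osc d w = 1" and k: "j \<le> k" for w :: "nat \<Rightarrow> real" and k
  proof (rule split_future[where n = j])
    show "{\<omega>\<in>space seqs. osc d (evolve d \<omega> k w) < e / real d * gain d \<omega> k} \<in> sets seqs" by measurable
    fix \<omega>' assume \<omega>': "\<omega>' \<in> space seqs" "\<forall>n. regular d (\<omega>' n)"
    \<comment> \<open>Shifted so that the entries are bounded by one, as the small-ball estimate requires.\<close>
    define w0 where "w0 i = w i - w 1" for i
    define g where "g = gain d \<omega>' (k - j)"
    have one: "1 \<in> {1..d}" using d1 by simp
    have w0b: "\<forall>i\<in>{1..d}. \<bar>w0 i\<bar> \<le> 1"
      using osc_ge[OF _ one, of _ w] w by (auto simp: w0_def)
    have w0n: "\<exists>i\<in>{1..d}. \<bar>w0 i - w0 1\<bar> \<ge> 1 / 2"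
    proof -
      obtain i l where il: "i \<in> {1..d}" "l \<in> {1..d}" "osc d w = norm (w i - w l)"
        by (rule osc_attained[OF d1])
      then have "\<bar>w0 i - w0 1\<bar> + \<bar>w0 l - w0 1\<bar> \<ge> 1" using w by (simp add: w0_def)
      then have "\<bar>w0 i - w0 1\<bar> \<ge> 1 / 2 \<or> \<bar>w0 l - w0 1\<bar> \<ge> 1 / 2" by linarith
      with il show ?thesis by blast
    qed
    have le_gain: "gain d (comb_seq j \<omega> \<omega>') k \<le> real d * g" if "\<forall>n. regular d (\<omega> n)" for \<omega>
      using gain_add_le[of d "comb_seq j \<omega> \<omega>'" j "k - j", OF d1 regular_comb_seq[OF that \<omega>'(2)]] k
      by (simp add: g_def comb_seq_def)
    have split: "evolve d (comb_seq j \<omega> \<omega>') k w = evolve d \<omega>' (k - j) (evolve d \<omega> j w)" for \<omega>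
      using evolve_comb_seq[of d j \<omega> \<omega>' "k - j" w] k by simp
    obtain c where c: "c \<in> unit_forms d" "g > 0 \<Longrightarrow> \<bar>pairing d c a\<bar> * g \<le> osc d (evolve d \<omega>' (k - j) a)" for a
    proof (cases "g > 0")
      case True
      then show ?thesis using gain_form[OF d1, of \<omega>' "k - j"] that unfolding g_def by blast
    next
      case False
      have "unit_vec 1 \<in> unit_forms d"
        using one by (auto simp: unit_forms_def vecs_def unit_vec_def)
      with False show ?thesis using that by blast
    qed
    have "AE \<omega> in seqs. \<omega> \<in> {\<omega>\<in>space seqs. osc d (evolve d (comb_seq j \<omega> \<omega>') k w) < e / real d * gain d (comb_seq j \<omega> \<omega>') k}
      \<longrightarrow> \<omega> \<in> {\<omega>\<in>space seqs. \<bar>pairing d c (evolve d \<omega> j w0)\<bar> \<le> e}"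
      using AE_seqs_regular
    proof eventually_elim
      case (elim \<omega>)
      show ?case
      proof
        assume *: "\<omega> \<in> {\<omega>\<in>space seqs. osc d (evolve d (comb_seq j \<omega> \<omega>') k w) < e / real d * gain d (comb_seq j \<omega> \<omega>') k}"
        then have "osc d (evolve d \<omega>' (k - j) (evolve d \<omega> j w)) < e / real d * gain d (comb_seq j \<omega> \<omega>') k"
          by (simp add: split)
        also have "\<dots> \<le> e / real d * (real d * g)"
          using le_gain[OF elim] e by (intro mult_left_mono) auto
        also have "\<dots> = e * g" using d3 by simp
        finally have lt: "osc d (evolve d \<omega>' (k - j) (evolve d \<omega> j w)) < e * g" .
        then have "e * g > 0" by (rule order_le_less_trans[OF osc_nonneg[OF d1]])
        then have g: "g > 0" using e by (simp add: zero_less_mult_iff)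
        have "evolve d \<omega> j w0 = (\<lambda>i. evolve d \<omega> j w i - w 1)"
          unfolding w0_def by (rule ext) (rule evolve_shift)
        then have "evolve d \<omega>' (k - j) (evolve d \<omega> j w0) = (\<lambda>i. evolve d \<omega>' (k - j) (evolve d \<omega> j w) i - w 1)"
          by (simp only:) (rule ext, rule evolve_shift)
        then have "osc d (evolve d \<omega>' (k - j) (evolve d \<omega> j w0)) = osc d (evolve d \<omega>' (k - j) (evolve d \<omega> j w))"
          by (simp add: osc_shift)
        with lt c(2)[OF g, of "evolve d \<omega> j w0"] have "\<bar>pairing d c (evolve d \<omega> j w0)\<bar> * g < e * g" by linarith
        with g have "\<bar>pairing d c (evolve d \<omega> j w0)\<bar> < e" by simp
        with * show "\<omega> \<in> {\<omega>\<in>space seqs. \<bar>pairing d c (evolve d \<omega> j w0)\<bar> \<le> e}" by simp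
      qed
    qed
    then have "seqs.prob {\<omega>\<in>space seqs. osc d (evolve d (comb_seq j \<omega> \<omega>') k w) < e / real d * gain d (comb_seq j \<omega> \<omega>') k}
      \<le> seqs.prob {\<omega>\<in>space seqs. \<bar>pairing d c (evolve d \<omega> j w0)\<bar> \<le> e}"
      by (rule seqs.finite_measure_mono_AE) measurable
    also have "\<dots> \<le> \<eta>" using ball w0b w0n c(1) by blast
    finally show "seqs.prob {\<omega>\<in>space seqs. osc d (evolve d (comb_seq j \<omega> \<omega>') k w) < e / real d * gain d (comb_seq j \<omega> \<omega>') k} \<le> \<eta>" .
  qed
  moreover have "e / real d > 0" using e d3 by simp
  ultimately show ?thesis by blast
qed

text \<open>Decompose according to the first time at which \<open>E\<close> occurs and condition on the path up to that time,
  as in the proof of Ottaviani's maximal inequality.\<close>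

lemma first_passage:
  fixes E :: "nat \<Rightarrow> (nat \<Rightarrow> nat \<Rightarrow> real) \<Rightarrow> bool"
  assumes Em: "\<And>k. {\<omega>\<in>space seqs. E k \<omega>} \<in> sets seqs" and Bm: "{\<omega>\<in>space seqs. B \<omega>} \<in> sets seqs"
    and past: "\<And>k \<omega> \<omega>'. (\<And>m. m < k \<Longrightarrow> \<omega> m = \<omega>' m) \<Longrightarrow> E k \<omega> = E k \<omega>'"
    and future: "\<And>k \<omega>. k \<le> n \<Longrightarrow> \<omega> \<in> space seqs \<Longrightarrow> (\<forall>m. regular d (\<omega> m)) \<Longrightarrow> E k \<omega> \<Longrightarrow>
      \<theta> \<le> seqs.prob {\<omega>'\<in>space seqs. B (comb_seq k \<omega> \<omega>')}"
  shows "\<theta> * seqs.prob {\<omega>\<in>space seqs. \<exists>k\<le>n. E k \<omega>} \<le> seqs.prob {\<omega>\<in>space seqs. B \<omega>}"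
proof -
  define D where "D k \<omega> \<longleftrightarrow> E k \<omega> \<and> (\<forall>l<k. \<not> E l \<omega>)" for k \<omega>
  have Dm: "{\<omega>\<in>space seqs. D k \<omega>} \<in> sets seqs" for k
    unfolding D_def using Em by measurable
  have DBm: "{\<omega>\<in>space seqs. D k \<omega> \<and> B \<omega>} \<in> sets seqs" for k
    using Dm Bm by measurable
  have Dcomb: "D k (comb_seq k \<omega> \<omega>') = D k \<omega>" for k \<omega> \<omega>'
  proof -
    have "E l (comb_seq k \<omega> \<omega>') = E l \<omega>" if "l \<le> k" for l
      by (rule past) (use that in \<open>simp add: comb_seq_less\<close>)
    then show ?thesis by (simp add: D_def)
  qed
  have disj: "\<not> (D k \<omega> \<and> D l \<omega>)" if "k \<noteq> l" for k l \<omega>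
    using that by (cases k l rule: linorder_cases) (auto simp: D_def)
  have ex: "(\<exists>k\<le>n. E k \<omega>) \<longleftrightarrow> (\<exists>k\<le>n. D k \<omega>)" for \<omega>
  proof
    assume "\<exists>k\<le>n. E k \<omega>"
    then obtain k where k: "k \<le> n" "E k \<omega>" by blast
    define l where "l = (LEAST l. E l \<omega>)"
    have "E l \<omega>" "l \<le> k" unfolding l_def using k(2) by (auto intro: LeastI Least_le)
    moreover have "\<not> E m \<omega>" if "m < l" for m using that unfolding l_def by (rule not_less_Least)
    ultimately show "\<exists>k\<le>n. D k \<omega>" unfolding D_def using k(1) by (intro exI[of _ l]) auto
  qed (auto simp: D_def)
  have each: "\<theta> * seqs.prob {\<omega>\<in>space seqs. D k \<omega>} \<le> seqs.prob {\<omega>\<in>space seqs. D k \<omega> \<and> B \<omega>}" if k: "k \<le> n" for k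
  proof -
    let ?h = "\<lambda>\<omega>. seqs.prob {\<omega>'\<in>space seqs. D k (comb_seq k \<omega> \<omega>') \<and> B (comb_seq k \<omega> \<omega>')}"
    have "\<theta> * seqs.prob {\<omega>\<in>space seqs. D k \<omega>} = (\<integral>\<omega>. \<theta> * indicator {\<omega>\<in>space seqs. D k \<omega>} \<omega> \<partial>seqs)"
      using Dm by simp
    also have "\<dots> \<le> (\<integral>\<omega>. ?h \<omega> \<partial>seqs)"
    proof (rule integral_mono_AE)
      show "integrable seqs (\<lambda>\<omega>. \<theta> * indicator {\<omega>\<in>space seqs. D k \<omega>} \<omega>)"
        using Dm by (intro integrable_mult_right) (simp add: integrable_indicator_iff seqs.emeasure_eq_measure)
      show "integrable seqs ?h"
        by (rule seqs.integrable_const_bound[where B = 1])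
          (use split_past(1)[OF DBm, of k] in \<open>auto intro!: AE_I2\<close>)
      show "AE \<omega> in seqs. \<theta> * indicator {\<omega>\<in>space seqs. D k \<omega>} \<omega> \<le> ?h \<omega>"
        using AE_seqs_regular AE_space
      proof eventually_elim
        case (elim \<omega>)
        show ?case
        proof (cases "D k \<omega>")
          case True
          then have "E k \<omega>" by (simp add: D_def)
          from future[OF k elim(2,1) this] True show ?thesis by (simp add: Dcomb elim(2))
        qed (simp add: Dcomb)
      qed
    qed
    also have "\<dots> = seqs.prob {\<omega>\<in>space seqs. D k \<omega> \<and> B \<omega>}" by (rule split_past(2)[OF DBm, symmetric])
    finally show ?thesis .
  qed
  have U: "{\<omega>\<in>space seqs. \<exists>k\<le>n. E k \<omega>} = (\<Union>k\<in>{..n}. {\<omega>\<in>space seqs. D k \<omega>})"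
    unfolding ex by auto
  have "seqs.prob {\<omega>\<in>space seqs. \<exists>k\<le>n. E k \<omega>} = (\<Sum>k\<le>n. seqs.prob {\<omega>\<in>space seqs. D k \<omega>})"
    unfolding U using Dm disj
    by (intro seqs.finite_measure_finite_Union) (auto simp: disjoint_family_on_def)
  then have "\<theta> * seqs.prob {\<omega>\<in>space seqs. \<exists>k\<le>n. E k \<omega>} = (\<Sum>k\<le>n. \<theta> * seqs.prob {\<omega>\<in>space seqs. D k \<omega>})"
    by (simp add: sum_distrib_left)
  also have "\<dots> \<le> (\<Sum>k\<le>n. seqs.prob {\<omega>\<in>space seqs. D k \<omega> \<and> B \<omega>})" by (intro sum_mono each) simp
  also have "\<dots> = seqs.prob (\<Union>k\<in>{..n}. {\<omega>\<in>space seqs. D k \<omega> \<and> B \<omega>})"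
    using DBm disj
    by (intro seqs.finite_measure_finite_Union[symmetric]) (auto simp: disjoint_family_on_def)
  also have "\<dots> \<le> seqs.prob {\<omega>\<in>space seqs. B \<omega>}"
    by (rule seqs.finite_measure_mono[OF _ Bm]) auto
  finally show ?thesis .
qed

lemma prob_ex_limit:
  assumes "\<And>k. {\<omega>\<in>space seqs. E k \<omega>} \<in> sets seqs"
  shows "(\<lambda>n. seqs.prob {\<omega>\<in>space seqs. \<exists>k\<le>n. E k \<omega>}) \<longlonglongrightarrow> seqs.prob {\<omega>\<in>space seqs. \<exists>k::nat. E k \<omega>}"
proof -
  let ?A = "\<lambda>n. {\<omega>\<in>space seqs. \<exists>k\<le>n. E k \<omega>}"
  have "(\<lambda>n. seqs.prob (?A n)) \<longlonglongrightarrow> seqs.prob (\<Union>n. ?A n)"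
  proof (rule seqs.finite_Lim_measure_incseq)
    show "range ?A \<subseteq> sets seqs" using assms by (auto intro!: sets.sets_Collect_finite_Ex simp: atMost_def[symmetric] Bex_def[symmetric])
    show "incseq ?A" by (rule incseq_SucI) (auto intro: le_SucI)
  qed
  also have "(\<Union>n. ?A n) = {\<omega>\<in>space seqs. \<exists>k. E k \<omega>}" by auto
  finally show ?thesis .
qed

lemma first_passage_infinite:
  fixes E :: "nat \<Rightarrow> (nat \<Rightarrow> nat \<Rightarrow> real) \<Rightarrow> bool"
  assumes Em: "\<And>k. {\<omega>\<in>space seqs. E k \<omega>} \<in> sets seqs" and Bm: "{\<omega>\<in>space seqs. B \<omega>} \<in> sets seqs"
    and past: "\<And>k \<omega> \<omega>'. (\<And>m. m < k \<Longrightarrow> \<omega> m = \<omega>' m) \<Longrightarrow> E k \<omega> = E k \<omega>'"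
    and future: "\<And>k \<omega>. \<omega> \<in> space seqs \<Longrightarrow> (\<forall>m. regular d (\<omega> m)) \<Longrightarrow> E k \<omega> \<Longrightarrow>
      \<theta> \<le> seqs.prob {\<omega>'\<in>space seqs. B (comb_seq k \<omega> \<omega>')}"
  shows "\<theta> * seqs.prob {\<omega>\<in>space seqs. \<exists>k. E k \<omega>} \<le> seqs.prob {\<omega>\<in>space seqs. B \<omega>}"
proof (rule LIMSEQ_le_const2[OF tendsto_mult[OF tendsto_const prob_ex_limit[OF Em]]])
  have "\<theta> * seqs.prob {\<omega>\<in>space seqs. \<exists>k\<le>n. E k \<omega>} \<le> seqs.prob {\<omega>\<in>space seqs. B \<omega>}" for n
    by (rule first_passage[OF Em Bm past future])
  then show "\<exists>N. \<forall>n\<ge>N. \<theta> * seqs.prob {\<omega>\<in>space seqs. \<exists>k\<le>n. E k \<omega>} \<le> seqs.prob {\<omega>\<in>space seqs. B \<omega>}"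
    by blast
qed

text \<open>Should the oscillation of \<open>w\<close> fall below \<open>e\<close> times the gain at some time
  \<open>k \<le> n\<close>, then it is also small at time \<open>m = n + j\<close> with conditional probability
  at least \<open>1 - \<zeta>\<close>: the fastest unit sequence, restarted at time \<open>k\<close>, keeps growing
  at the rate of the gain by \<open>nondegenerate_fixed_time\<close>, whereas \<open>w\<close> gains at most a factor
  \<open>d\<close> on it. By the maximal inequality the probability of the former is at most twice the fixed-time
  probability \<open>\<zeta>\<close> of the latter, uniformly in \<open>n\<close>.\<close>

lemma nondegenerate:
  assumes \<eta>: "\<eta> > 0"
  shows "\<exists>e>0. \<forall>w :: nat \<Rightarrow> real. osc d w = 1 \<longrightarrow>
    seqs.prob {\<omega>\<in>space seqs. \<exists>k. osc d (evolve d \<omega> k w) < e * gain d \<omega> k} \<le> \<eta>"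
proof -
  define \<zeta> where "\<zeta> = min (\<eta> / 2) (1 / 2)"
  have \<zeta>: "\<zeta> > 0" "\<zeta> \<le> 1 / 2" "2 * \<zeta> \<le> \<eta>" using \<eta> by (auto simp: \<zeta>_def)
  obtain e\<^sub>1 j where e1: "e\<^sub>1 > 0" and fixed: "\<forall>(w :: nat \<Rightarrow> real) k. osc d w = 1 \<and> j \<le> k \<longrightarrow>
    seqs.prob {\<omega>\<in>space seqs. osc d (evolve d \<omega> k w) < e\<^sub>1 * gain d \<omega> k} \<le> \<zeta>"
    using nondegenerate_fixed_time[OF \<zeta>(1)] by (elim exE conjE) (rule that; assumption)
  \<comment> \<open>The square: one factor e1 is lost in comparing with the restarted unit sequence, the other is
    the threshold at time m. The 2 makes the final inequality strict.\<close>
  define e where "e = e\<^sub>1\<^sup>2 / (2 * real d)"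
  have e: "e > 0" using e1 d3 by (simp add: e_def)
  have de: "real d * e = e\<^sub>1 * e\<^sub>1 / 2" using d3 by (simp add: e_def power2_eq_square)
  have "seqs.prob {\<omega>\<in>space seqs. \<exists>k. osc d (evolve d \<omega> k w) < e * gain d \<omega> k} \<le> \<eta>"
    if w: "osc d w = 1" for w :: "nat \<Rightarrow> real"
  proof -
    have wn: "nonconstant w" using w osc_pos_iff[of w] by simp
    define E where "E k \<omega> \<longleftrightarrow> osc d (evolve d \<omega> k w) < e * gain d \<omega> k" for k \<omega>
    have Em: "{\<omega>\<in>space seqs. E k \<omega>} \<in> sets seqs" for k unfolding E_def by measurable
    have finite: "seqs.prob {\<omega>\<in>space seqs. \<exists>k\<le>n. E k \<omega>} \<le> \<eta>" for n
    proof -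
      define m where "m = n + j"
      define B where "B \<omega> \<longleftrightarrow> osc d (evolve d \<omega> m w) < e\<^sub>1 * gain d \<omega> m" for \<omega>
      have Bm: "{\<omega>\<in>space seqs. B \<omega>} \<in> sets seqs" unfolding B_def by measurable
      have "(1 - \<zeta>) * seqs.prob {\<omega>\<in>space seqs. \<exists>k\<le>n. E k \<omega>} \<le> seqs.prob {\<omega>\<in>space seqs. B \<omega>}"
      proof (rule first_passage[OF Em Bm])
        show "E k \<omega> = E k \<omega>'" if "\<And>m. m < k \<Longrightarrow> \<omega> m = \<omega>' m" for k \<omega> \<omega>'
          unfolding E_def using evolve_cong[of k \<omega> \<omega>' d w] gain_cong[of k \<omega> \<omega>' d] that by simp
        fix k \<omega> assume k: "k \<le> n" and \<omega>: "\<omega> \<in> space seqs" "\<forall>m. regular d (\<omega> m)" and Ek: "E k \<omega>"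
        obtain i where i: "i \<in> {1..d}" "gain d \<omega> k = osc d (evolve d \<omega> k (unit_vec i))"
          by (rule gain_attained[OF d1])
        define v where "v = evolve d \<omega> k (unit_vec i)"
        define g where "g = gain d \<omega> k"
        have "0 < e * g" using Ek osc_nonneg[OF d1, of "evolve d \<omega> k w"] unfolding E_def g_def by linarith
        then have g: "g > 0" using e by (simp add: zero_less_mult_iff)
        have gv: "osc d v = g" by (simp add: g_def v_def i)
        let ?v = "\<lambda>l. (1 / g) *\<^sub>R v l"
        have ov: "osc d ?v = 1" using osc_scale[OF d1, of "1 / g" v] g gv by simp
        have mk: "j \<le> m - k" "k + (m - k) = m" using k by (auto simp: m_def)
        let ?bad = "{\<omega>'\<in>space seqs. osc d (evolve d \<omega>' (m - k) ?v) < e\<^sub>1 * gain d \<omega>' (m - k)}"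
        have badm: "?bad \<in> sets seqs" by measurable
        have "seqs.prob ?bad \<le> \<zeta>" by (rule fixed[THEN spec, THEN spec, THEN mp, OF conjI[OF ov mk(1)]])
        then have "1 - \<zeta> \<le> seqs.prob (space seqs - ?bad)"
          using seqs.prob_compl[OF badm] by linarith
        also have "\<dots> \<le> seqs.prob {\<omega>'\<in>space seqs. B (comb_seq k \<omega> \<omega>')}"
        proof (rule seqs.finite_measure_mono_AE)
          show "{\<omega>'\<in>space seqs. B (comb_seq k \<omega> \<omega>')} \<in> sets seqs"
            by (rule comb_seq_section[OF \<omega>(1) Bm])
          show "AE \<omega>' in seqs. \<omega>' \<in> space seqs - ?bad \<longrightarrow> \<omega>' \<in> {\<omega>'\<in>space seqs. B (comb_seq k \<omega> \<omega>')}"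
            using AE_gain_pos
          proof eventually_elim
            case (elim \<omega>')
            show ?case
            proof
              assume good: "\<omega>' \<in> space seqs - ?bad"
              define g' where "g' = gain d \<omega>' (m - k)"
              have g': "g' > 0" using elim by (simp add: g'_def)
              have split: "evolve d (comb_seq k \<omega> \<omega>') m a = evolve d \<omega>' (m - k) (evolve d \<omega> k a)" for a :: "nat \<Rightarrow> real"
                using evolve_comb_seq[of d k \<omega> \<omega>' "m - k" a] mk(2) by simp
              have "osc d (evolve d \<omega>' (m - k) ?v) = osc d (evolve d \<omega>' (m - k) v) / g"
                using osc_evolve_scale[OF d1, of \<omega>' "m - k" "1 / g" v] g by simp
              then have "e\<^sub>1 * g' \<le> osc d (evolve d \<omega>' (m - k) v) / g"
                using good by (auto simp: g'_def not_less)
              then have "e\<^sub>1 * g' * g \<le> osc d (evolve d \<omega>' (m - k) v)"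
                using g by (simp add: field_simps)
              also have "\<dots> \<le> gain d (comb_seq k \<omega> \<omega>') m"
                using gain_ge[OF i(1), of "comb_seq k \<omega> \<omega>'" m] by (simp add: split v_def)
              finally have low: "e\<^sub>1 * g' * g \<le> gain d (comb_seq k \<omega> \<omega>') m" .
              have "osc d (evolve d (comb_seq k \<omega> \<omega>') m w) \<le> real d * osc d (evolve d \<omega> k w) * g'"
                unfolding split g'_def by (rule osc_evolve_le_gain[OF d1])
              also have "\<dots> \<le> real d * (e * g) * g'"
                using Ek g' unfolding E_def g_def[symmetric]
                by (intro mult_right_mono mult_left_mono) auto
              also have "\<dots> = e\<^sub>1 / 2 * (e\<^sub>1 * g' * g)"
                using de by (simp add: algebra_simps)
              also have "\<dots> < e\<^sub>1 * (e\<^sub>1 * g' * g)" using e1 g g' by simp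
              also have "\<dots> \<le> e\<^sub>1 * gain d (comb_seq k \<omega> \<omega>') m"
                using low e1 by simp
              finally show "\<omega>' \<in> {\<omega>'\<in>space seqs. B (comb_seq k \<omega> \<omega>')}"
                using good by (simp add: B_def)
            qed
          qed
        qed
        finally show "1 - \<zeta> \<le> seqs.prob {\<omega>'\<in>space seqs. B (comb_seq k \<omega> \<omega>')}" .
      qed
      also have "\<dots> \<le> \<zeta>" unfolding B_def using fixed w by (auto simp: m_def)
      finally have *: "(1 - \<zeta>) * seqs.prob {\<omega>\<in>space seqs. \<exists>k\<le>n. E k \<omega>} \<le> \<zeta>" .
      have "1 / 2 * seqs.prob {\<omega>\<in>space seqs. \<exists>k\<le>n. E k \<omega>} \<le> (1 - \<zeta>) * seqs.prob {\<omega>\<in>space seqs. \<exists>k\<le>n. E k \<omega>}"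
        using \<zeta>(2) by (intro mult_right_mono) auto
      with * \<zeta>(3) show ?thesis by linarith
    qed
    have "seqs.prob {\<omega>\<in>space seqs. \<exists>k. E k \<omega>} \<le> \<eta>"
      by (rule LIMSEQ_le_const2[OF prob_ex_limit[OF Em]]) (use finite in blast)
    then show ?thesis by (simp add: E_def)
  qed
  with e show ?thesis by blast
qed

end

section \<open>Discrete Fourier analysis of the constant-ratio step\<close>

definition unity_root :: "nat \<Rightarrow> complex" where
  "unity_root d = cis (2 * pi / real d)"

lemma root_power: "unity_root d ^ m = cis (2 * pi * real m / real d)"
proof -
  have "unity_root d ^ m = cis (real m * (2 * pi / real d))"
    unfolding unity_root_def by (rule Complex.DeMoivre)
  also have "real m * (2 * pi / real d) = 2 * pi * real m / real d" by simp
  finally show ?thesis .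
qed

lemma root_power_d: "d \<ge> 1 \<Longrightarrow> unity_root d ^ d = 1"
  by (simp add: root_power)

lemma root_power_eq_1:
  assumes "d \<ge> 1" shows "unity_root d ^ m = 1 \<longleftrightarrow> d dvd m"
  using complex_root_unity_eq_1[of d m] assms
  by (simp add: root_power cis_conv_exp mult_ac)

lemma norm_root [simp]: "norm (unity_root d) = 1"
  by (simp add: unity_root_def)

lemma cnj_root_mult: "cnj (unity_root d ^ m) * unity_root d ^ m = 1"
  using complex_norm_square[of "unity_root d ^ m"] by (simp add: norm_power mult.commute)

lemma cnj_root_power:
  assumes "d \<ge> 1" "k \<le> d" shows "cnj (unity_root d ^ k) = unity_root d ^ (d - k)"
proof -
  have "unity_root d ^ (d - k) * unity_root d ^ k = 1"
    using assms by (simp flip: power_add add: root_power_d)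
  then have "cnj (unity_root d ^ k) = cnj (unity_root d ^ k) * (unity_root d ^ k * unity_root d ^ (d - k))"
    by (simp add: mult.commute)
  also have "\<dots> = unity_root d ^ (d - k)"
    unfolding mult.assoc[symmetric] cnj_root_mult by simp
  finally show ?thesis .
qed

lemma root_power_cyc:
  assumes "d \<ge> 1" "i \<in> {1..d}" shows "unity_root d ^ (k * (i mod d + 1)) = unity_root d ^ (k * i) * unity_root d ^ k"
proof (cases "i = d")
  case True
  then show ?thesis using root_power_d[OF assms(1)] by (simp add: power_mult mult.commute[of k d])
next
  case False
  then show ?thesis using assms by (simp add: algebra_simps power_add)
qed

lemma geometric_root_sum:
  fixes r :: complex
  assumes "r ^ d = 1" "r \<noteq> 1"
  shows "(\<Sum>k<d. r ^ k) = 0" "(\<Sum>k=1..d. r ^ k) = 0"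
proof -
  show 1: "(\<Sum>k<d. r ^ k) = 0"
    using power_diff_1_eq[of r d] assms by simp
  have "(\<Sum>k=1..d. r ^ k) = (\<Sum>k<d. r ^ Suc k)"
    by (rule sum.reindex_bij_witness[of _ Suc "\<lambda>k. k - 1"]) auto
  also have "\<dots> = r * (\<Sum>k<d. r ^ k)" by (simp add: sum_distrib_left)
  finally show "(\<Sum>k=1..d. r ^ k) = 0" using 1 by simp
qed

text \<open>The unnormalised discrete Fourier coefficient of frequency \<open>k\<close>.\<close>

definition dft :: "nat \<Rightarrow> nat \<Rightarrow> (nat \<Rightarrow> complex) \<Rightarrow> complex" where
  "dft d k z = (\<Sum>i=1..d. z i * cnj (unity_root d ^ (k * i)))"

lemma dft_inverse:
  assumes d: "d \<ge> 1" and i: "i \<in> {1..d}"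
  shows "of_nat d * z i = (\<Sum>k<d. dft d k z * unity_root d ^ (k * i))"
proof -
  have orth: "(\<Sum>k<d. cnj (unity_root d ^ (k * j)) * unity_root d ^ (k * i)) = (if i = j then of_nat d else 0)"
    if j: "j \<in> {1..d}" for j
  proof -
    define r where "r = cnj (unity_root d ^ j) * unity_root d ^ i"
    have eq: "(\<Sum>k<d. cnj (unity_root d ^ (k * j)) * unity_root d ^ (k * i)) = (\<Sum>k<d. r ^ k)"
      unfolding r_def power_mult_distrib complex_cnj_power[symmetric] power_mult[symmetric]
      by (simp add: mult.commute)
    show ?thesis
    proof (cases "i = j")
      case True
      then have "r = 1" unfolding r_def by (simp only: cnj_root_mult)
      then show ?thesis unfolding eq using True by simp
    next
      case False
      have "r = unity_root d ^ (d - j + i)"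
        unfolding r_def power_add using cnj_root_power[OF d, of j] j by simp
      moreover have "\<not> d dvd (d - j + i)"
      proof
        assume "d dvd (d - j + i)"
        then obtain t where t: "d - j + i = d * t" by blast
        have "d - j + i < d * 2" "0 < d - j + i" using i j False by auto
        then have "t = 1" using t by (metis less_2_cases mult_0_right mult_less_cancel1 less_irrefl One_nat_def)
        then show False using t i j False by auto
      qed
      ultimately have "r \<noteq> 1" using root_power_eq_1[OF d] by simp
      moreover have "r ^ d = 1"
      proof -
        have "r ^ d = unity_root d ^ ((d - j + i) * d)" by (simp add: \<open>r = unity_root d ^ (d - j + i)\<close> power_mult)
        then show ?thesis using root_power_eq_1[OF d] by simp
      qed
      ultimately show ?thesis unfolding eq using False geometric_root_sum(1) by simp
    qed
  qed
  have "(\<Sum>k<d. dft d k z * unity_root d ^ (k * i)) = (\<Sum>j=1..d. z j * (\<Sum>k<d. cnj (unity_root d ^ (k * j)) * unity_root d ^ (k * i)))"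
    unfolding dft_def sum_distrib_right sum_distrib_left by (subst sum.swap) (simp add: mult_ac)
  also have "\<dots> = (\<Sum>j=1..d. if i = j then of_nat d * z j else 0)"
    by (intro sum.cong refl, subst orth) auto
  also have "\<dots> = of_nat d * z i" using i by simp
  finally show ?thesis by simp
qed

lemma dft_const_zero:
  assumes d: "d \<ge> 1" and k: "1 \<le> k" "k < d" and z: "\<And>i. i \<in> {1..d} \<Longrightarrow> z i = c"
  shows "dft d k z = 0"
proof -
  have "dft d k z = c * cnj (\<Sum>i=1..d. (unity_root d ^ k) ^ i)"
    unfolding dft_def by (simp add: z sum_distrib_left power_mult)
  also have "(\<Sum>i=1..d. (unity_root d ^ k) ^ i) = 0"
    using root_power_eq_1[OF d, of k] root_power_eq_1[OF d, of "k * d"] k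
    by (intro geometric_root_sum(2)) (auto simp: power_mult dest: dvd_imp_le)
  finally show ?thesis by simp
qed

lemma dft_step:
  assumes d: "d \<ge> 1"
  shows "dft d k (step d (\<lambda>_. p) z) = (of_real (1 - p) + of_real p * unity_root d ^ k) * dft d k z"
proof -
  have "(\<Sum>i=1..d. z (i mod d + 1) * cnj (unity_root d ^ (k * i))) =
      (\<Sum>i=1..d. unity_root d ^ k * (z (i mod d + 1) * cnj (unity_root d ^ (k * (i mod d + 1)))))"
  proof (intro sum.cong refl)
    fix i assume i: "i \<in> {1..d}"
    have "unity_root d ^ k * cnj (unity_root d ^ (k * (i mod d + 1))) = cnj (unity_root d ^ (k * i)) * (cnj (unity_root d ^ k) * unity_root d ^ k)"
      unfolding root_power_cyc[OF d i] complex_cnj_mult by (simp add: mult_ac)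
    then show "z (i mod d + 1) * cnj (unity_root d ^ (k * i)) =
        unity_root d ^ k * (z (i mod d + 1) * cnj (unity_root d ^ (k * (i mod d + 1))))"
      unfolding cnj_root_mult by (metis mult.commute mult.left_commute mult_1)
  qed
  also have "\<dots> = unity_root d ^ k * (\<Sum>i=1..d. z (i mod d + 1) * cnj (unity_root d ^ (k * (i mod d + 1))))"
    by (simp add: sum_distrib_left)
  also have "(\<Sum>i=1..d. z (i mod d + 1) * cnj (unity_root d ^ (k * (i mod d + 1)))) = dft d k z"
    unfolding dft_def by (rule sum_cyc[where f = "\<lambda>i. z i * cnj (unity_root d ^ (k * i))"])
  finally have shift: "(\<Sum>i=1..d. z (i mod d + 1) * cnj (unity_root d ^ (k * i))) = unity_root d ^ k * dft d k z" .
  have "dft d k (step d (\<lambda>_. p) z) =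
      (\<Sum>i=1..d. of_real (1 - p) * (z i * cnj (unity_root d ^ (k * i))) +
        of_real p * (z (i mod d + 1) * cnj (unity_root d ^ (k * i))))"
    unfolding dft_def step_def by (intro sum.cong refl) (simp add: scaleR_conv_of_real algebra_simps)
  also have "\<dots> = of_real (1 - p) * dft d k z + of_real p * (unity_root d ^ k * dft d k z)"
    by (simp only: sum.distrib sum_distrib_left[symmetric] shift) (simp only: dft_def)
  finally show ?thesis by (simp add: algebra_simps)
qed

lemma dft_step_update:
  assumes d: "d \<ge> 1" and s: "s \<in> {1..d}"
  shows "dft d k (step d ((\<lambda>_. p)(s := q)) z) = dft d k (step d (\<lambda>_. p) z) +
    of_real (q - p) * (z (s mod d + 1) - z s) * cnj (unity_root d ^ (k * s))"
proof -
  have "dft d k (step d ((\<lambda>_. p)(s := q)) z) = (\<Sum>i=1..d. step d (\<lambda>_. p) z i * cnj (unity_root d ^ (k * i)) +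
     (if i = s then of_real (q - p) * (z (s mod d + 1) - z s) * cnj (unity_root d ^ (k * s)) else 0))"
    unfolding dft_def by (intro sum.cong refl) (auto simp: step_def scaleR_conv_of_real algebra_simps)
  also have "\<dots> = dft d k (step d (\<lambda>_. p) z) +
    of_real (q - p) * (z (s mod d + 1) - z s) * cnj (unity_root d ^ (k * s))"
    unfolding sum.distrib using s by (simp add: dft_def)
  finally show ?thesis .
qed

text \<open>The factor by which a step with all ratios equal to \<open>p\<close> multiplies mode \<open>k\<close>; see
  \<open>dft_step\<close>.\<close>

definition eigenvalue :: "nat \<Rightarrow> real \<Rightarrow> nat \<Rightarrow> complex" where
  "eigenvalue d p k = of_real (1 - p) + of_real p * unity_root d ^ k"

lemma norm_eigenvalue:
  "(norm (eigenvalue d p k))\<^sup>2 = 1 - 2 * p * (1 - p) * (1 - cos (2 * pi * real k / real d))"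
proof -
  let ?c = "cos (2 * pi * real k / real d)" and ?s = "sin (2 * pi * real k / real d)"
  have "(norm (eigenvalue d p k))\<^sup>2 = ((1 - p) + p * ?c)\<^sup>2 + (p * ?s)\<^sup>2"
    by (simp add: eigenvalue_def root_power cmod_power2)
  also have "\<dots> = (1 - p)\<^sup>2 + 2 * p * (1 - p) * ?c + p\<^sup>2 * (?s\<^sup>2 + ?c\<^sup>2)"
  proof -
    have "((1 - p) + p * c)\<^sup>2 + (p * s)\<^sup>2 = (1 - p)\<^sup>2 + 2 * p * (1 - p) * c + p\<^sup>2 * (s\<^sup>2 + c\<^sup>2)" for c s :: real
      by (simp add: power2_eq_square algebra_simps)
    then show ?thesis .
  qed
  also have "\<dots> = 1 - 2 * p * (1 - p) * (1 - ?c)"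
    unfolding sin_cos_squared_add by (simp add: power2_eq_square algebra_simps)
  finally show ?thesis .
qed

lemma eigenvalue_reflect:
  assumes "d \<ge> 1" "k \<le> d" shows "eigenvalue d p (d - k) = cnj (eigenvalue d p k)"
  using cnj_root_power[OF assms] by (simp add: eigenvalue_def)

lemma cos_decreasing_modes:
  assumes d: "d \<ge> 3" and k: "2 \<le> k" "k \<le> d - 2"
  shows "cos (2 * pi * real k / real d) < cos (2 * pi / real d)"
proof -
  have main: "cos (2 * pi * real l / real d) < cos (2 * pi / real d)" if l: "2 \<le> l" "2 * l \<le> d" for l
  proof (rule cos_monotone_0_pi)
    have "2 * pi * real l \<le> pi * real d" using l pi_gt_zero
      by (metis mult.assoc mult.commute mult_le_cancel_left_pos of_nat_le_iff of_nat_mult of_nat_numeral)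
    then show "2 * pi * real l / real d \<le> pi" using d by (simp add: divide_le_eq)
    show "2 * pi / real d < 2 * pi * real l / real d" using l d by (intro divide_strict_right_mono) auto
  qed (use d in auto)
  show ?thesis
  proof (cases "2 * k \<le> d")
    case True
    then show ?thesis using main k by simp
  next
    case False
    have "2 * pi * real (d - k) / real d = 2 * pi - 2 * pi * real k / real d"
      using k d by (simp add: of_nat_diff field_simps)
    then have "cos (2 * pi * real k / real d) = cos (2 * pi * real (d - k) / real d)"
      by (simp add: cos_diff)
    also have "\<dots> < cos (2 * pi / real d)" using False k d by (intro main) auto
    finally show ?thesis .
  qed
qed

text \<open>Among the nonconstant modes, \<open>1\<close> and its conjugate \<open>d - 1\<close> decay most slowly, since
  their root of unity has the largest real part.\<close>

lemma eigenvalue_dominant: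
  assumes d: "d \<ge> 3" and p: "p \<in> {0<..<1}" and k: "2 \<le> k" "k \<le> d - 2"
  shows "norm (eigenvalue d p k) < norm (eigenvalue d p 1)"
proof -
  have "2 * p * (1 - p) * cos (2 * pi * real k / real d) < 2 * p * (1 - p) * cos (2 * pi / real d)"
    using cos_decreasing_modes[OF d k] p by (intro mult_strict_left_mono) auto
  then have "(norm (eigenvalue d p k))\<^sup>2 < (norm (eigenvalue d p 1))\<^sup>2"
    unfolding norm_eigenvalue by (simp add: right_diff_distrib)
  then show ?thesis by (rule power2_less_imp_less) simp
qed

lemma sin_root_pos: "d \<ge> 3 \<Longrightarrow> sin (2 * pi / real d) > 0"
  by (rule sin_gt_zero) (auto simp: divide_less_eq)

lemma eigenvalue_1_nonzero:
  assumes "d \<ge> 3" "p \<in> {0<..<1}" shows "eigenvalue d p 1 \<noteq> 0"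
proof
  assume "eigenvalue d p 1 = 0"
  then have "Im (eigenvalue d p 1) = 0" by simp
  then have "p * sin (2 * pi / real d) = 0" by (simp add: eigenvalue_def unity_root_def)
  with assms sin_root_pos[OF assms(1)] show False by simp
qed

section \<open>Affine images of the regular polygon\<close>

text \<open>The affine images, centred at the origin, of the regular \<open>d\<close>-gon: exactly the configurations with
  modes \<open>1\<close> and \<open>d - 1\<close> only.\<close>

definition ellipse :: "nat \<Rightarrow> complex \<Rightarrow> complex \<Rightarrow> nat \<Rightarrow> complex" where
  "ellipse d a b i = a * unity_root d ^ i + b * cnj (unity_root d ^ i)"

lemma dft_ellipse:
  assumes d: "d \<ge> 3"
  shows "dft d 1 (ellipse d a b) = of_nat d * a" "dft d (d - 1) (ellipse d a b) = of_nat d * b"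
proof -
  have d1: "d \<ge> 1" using d by simp
  have "\<not> d dvd 2" using d by (auto dest: dvd_imp_le)
  then have r2: "unity_root d ^ 2 \<noteq> 1" using root_power_eq_1[OF d1, of 2] by simp
  have rd: "(unity_root d ^ 2) ^ d = 1" using root_power_eq_1[OF d1, of "2 * d"] by (simp add: power_mult)
  have z: "(\<Sum>i=1..d. (unity_root d ^ 2) ^ i) = 0" by (rule geometric_root_sum(2)[OF rd r2])
  have z': "(\<Sum>i=1..d. cnj ((unity_root d ^ 2) ^ i)) = 0"
    using arg_cong[OF z, of cnj] by simp
  have c1: "cnj (unity_root d ^ i) * unity_root d ^ i = 1" for i by (rule cnj_root_mult)
  have "dft d 1 (ellipse d a b) = (\<Sum>i=1..d. a + b * cnj ((unity_root d ^ 2) ^ i))"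
    unfolding dft_def ellipse_def
  proof (intro sum.cong refl)
    fix i
    have "(a * unity_root d ^ i + b * cnj (unity_root d ^ i)) * cnj (unity_root d ^ (1 * i)) =
       a * (cnj (unity_root d ^ i) * unity_root d ^ i) + b * (cnj (unity_root d ^ i) * cnj (unity_root d ^ i))"
      by (simp add: algebra_simps)
    then show "(a * unity_root d ^ i + b * cnj (unity_root d ^ i)) * cnj (unity_root d ^ (1 * i)) = a + b * cnj ((unity_root d ^ 2) ^ i)"
      unfolding c1 by (simp flip: power_mult power_add add: mult_2)
  qed
  also have "\<dots> = of_nat d * a" using z' by (simp add: sum.distrib flip: sum_distrib_left)
  finally show "dft d 1 (ellipse d a b) = of_nat d * a" .
  have cr: "cnj (unity_root d ^ ((d - 1) * i)) = unity_root d ^ i" for i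
    using cnj_root_power[OF d1, of "d - 1"] d1 by (simp add: power_mult)
  have "dft d (d - 1) (ellipse d a b) = (\<Sum>i=1..d. a * (unity_root d ^ 2) ^ i + b)"
    unfolding dft_def ellipse_def cr
  proof (intro sum.cong refl)
    fix i
    have "(a * unity_root d ^ i + b * cnj (unity_root d ^ i)) * unity_root d ^ i =
       a * (unity_root d ^ i * unity_root d ^ i) + b * (cnj (unity_root d ^ i) * unity_root d ^ i)"
      by (simp add: algebra_simps)
    then show "(a * unity_root d ^ i + b * cnj (unity_root d ^ i)) * unity_root d ^ i = a * (unity_root d ^ 2) ^ i + b"
      unfolding c1 by (simp flip: power_mult power_add add: mult_2)
  qed
  also have "\<dots> = of_nat d * b" using z by (simp add: sum.distrib flip: sum_distrib_left)
  finally show "dft d (d - 1) (ellipse d a b) = of_nat d * b" .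
qed

text \<open>When both amplitudes agree, the rotation by minus half the sum of their arguments turns every point into the sum of
  a number and its conjugate.\<close>

lemma ellipse_flat:
  assumes "norm a = norm b"
  shows "\<exists>u. norm u = 1 \<and> (\<forall>i. Im (u * ellipse d a b i) = 0)"
proof -
  define \<alpha> \<beta> where "\<alpha> = Arg a" and "\<beta> = Arg b"
  have a: "a = of_real (norm a) * cis \<alpha>" using rcis_cmod_Arg[of a] by (simp add: rcis_def \<alpha>_def)
  have b: "b = of_real (norm a) * cis \<beta>" using rcis_cmod_Arg[of b] assms by (simp add: rcis_def \<beta>_def)
  define u where "u = cis (- (\<alpha> + \<beta>) / 2)"
  have "Im (u * ellipse d a b i) = 0" for i
  proof -
    define t where "t = 2 * pi * real i / real d"
    define s where "s = (\<alpha> - \<beta>) / 2 + t"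
    have "u * (a * cis t) = of_real (norm a) * (u * cis \<alpha> * cis t)"
      by (subst a) (simp add: mult_ac)
    also have "u * cis \<alpha> * cis t = cis s"
      unfolding u_def cis_mult s_def by (simp add: field_simps)
    finally have 1: "u * (a * cis t) = of_real (norm a) * cis s" .
    have "u * (b * cis (- t)) = of_real (norm a) * (u * cis \<beta> * cis (- t))"
      by (subst b) (simp add: mult_ac)
    also have "u * cis \<beta> * cis (- t) = cis (- s)"
      unfolding u_def cis_mult s_def by (rule arg_cong[of _ _ cis]) (simp add: field_simps)
    finally have 2: "u * (b * cis (- t)) = of_real (norm a) * cis (- s)" .
    have "u * ellipse d a b i = of_real (norm a) * cis s + of_real (norm a) * cis (- s)"
      unfolding ellipse_def root_power t_def[symmetric] cis_cnj distrib_left 1 2 ..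
    then show ?thesis by simp
  qed
  then show ?thesis by (intro exI[of _ u]) (simp add: u_def)
qed

lemma norm_add_square:
  "(norm (x + y))\<^sup>2 = (norm x)\<^sup>2 + (norm y)\<^sup>2 + 2 * Re (x * cnj y)" for x y :: complex
  unfolding cmod_power2 by (simp add: power2_eq_square algebra_simps)

text \<open>The family \<open>C\<close> stands for the nonconstant configurations from which flatness is out of reach. It
  contains no collinear configuration, but with each member its nonconstant images under the step with equal ratios
  \<open>p\<close> and under the steps with one ratio changed to \<open>q\<close>, as well as nonconstant limits and
  rescaled translates.

  Power iteration with equal ratios takes a member whose modes \<open>1\<close> and \<open>d - 1\<close> do not
  both vanish to a member \<open>ellipse d a b\<close>, without changing the moduli of the two amplitudes up to a
  common factor. No member has both of these modes zero, for then a changed ratio would create them with equal moduli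
  and lead to a collinear ellipse. Hence normalised ellipses with minimal
  \<open>D = \<bar>\<bar>a\<bar>\<^sup>2 - \<bar>b\<bar>\<^sup>2\<bar>\<close> exist in a nonempty
  \<open>C\<close>, and \<open>D > 0\<close> as they are not collinear. A step with the ratio changed at vertex
  \<open>s\<close> maps the amplitudes to \<open>a' = \<mu> a + cnj \<nu> cnj W\<^sup>2 b\<close> and
  \<open>b' = cnj \<mu> b + \<nu> W\<^sup>2 a\<close> with \<open>W = \<zeta>\<^sup>s\<close>. The
  difference of the squares gets multiplied by
  \<open>\<bar>\<mu>\<bar>\<^sup>2 - \<bar>\<nu>\<bar>\<^sup>2\<close>, but their sum becomes
  \<open>\<bar>\<mu>\<bar>\<^sup>2 + \<bar>\<nu>\<bar>\<^sup>2\<close> plus four times the real part of a number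
  that rotates with \<open>s\<close> and is nonnegative for a suitable vertex. The normalised difference thus becomes
  strictly smaller.\<close>

lemma flat_free_family_empty:
  fixes C :: "(nat \<Rightarrow> complex) set"
  assumes d: "d \<ge> 3" and p: "p \<in> {0<..<1}" and q: "q \<in> {0<..<1}" and pq: "p \<noteq> q"
    and nonconst: "\<And>z. z \<in> C \<Longrightarrow> \<exists>i\<in>{1..d}. z i \<noteq> z 1"
    and step0: "\<And>z. z \<in> C \<Longrightarrow> \<exists>i\<in>{1..d}. step d (\<lambda>_. p) z i \<noteq> step d (\<lambda>_. p) z 1 \<Longrightarrow> step d (\<lambda>_. p) z \<in> C"
    and step1: "\<And>z s. z \<in> C \<Longrightarrow> s \<in> {1..d} \<Longrightarrow>
      \<exists>i\<in>{1..d}. step d ((\<lambda>_. p)(s := q)) z i \<noteq> step d ((\<lambda>_. p)(s := q)) z 1 \<Longrightarrow>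
      step d ((\<lambda>_. p)(s := q)) z \<in> C"
    and limit: "\<And>v z. (\<And>n::nat. v n \<in> C) \<Longrightarrow> (\<And>i. i \<in> {1..d} \<Longrightarrow> (\<lambda>n. v n i) \<longlonglongrightarrow> z i) \<Longrightarrow>
      \<exists>i\<in>{1..d}. z i \<noteq> z 1 \<Longrightarrow> z \<in> C"
    and affine: "\<And>z r c. z \<in> C \<Longrightarrow> r > 0 \<Longrightarrow> (\<lambda>i. of_real r * z i + c) \<in> C"
    and flat: "\<And>z u. z \<in> C \<Longrightarrow> norm u = 1 \<Longrightarrow> \<exists>i\<in>{1..d}. Im (u * z i) \<noteq> Im (u * z 1)"
  shows "C = {}"
proof (rule ccontr)
  assume "C \<noteq> {}"
  then obtain z\<^sub>0 where z0: "z\<^sub>0 \<in> C" by blast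
  have d1: "d \<ge> 1" using d by simp
  have nc: "\<exists>i\<in>{1..d}. z i \<noteq> z 1" if "1 \<le> k" "k < d" "dft d k z \<noteq> 0" for k z
    using dft_const_zero[OF d1 that(1,2), of z "z 1"] that(3) by blast
  have dft_d1: "1 \<le> d - 1" "d - 1 < d" "1 < d" using d by auto
  define \<Lambda> where "\<Lambda> = eigenvalue d p"
  have \<Lambda>step: "dft d k (step d (\<lambda>_. p) z) = \<Lambda> k * dft d k z" for k z
    unfolding \<Lambda>_def eigenvalue_def by (rule dft_step[OF d1])
  have \<Lambda>1: "\<Lambda> 1 \<noteq> 0" unfolding \<Lambda>_def by (rule eigenvalue_1_nonzero[OF d p])
  have \<Lambda>cnj: "\<Lambda> (d - 1) = cnj (\<Lambda> 1)" unfolding \<Lambda>_def by (rule eigenvalue_reflect[OF d1 d1])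
  have ellipse_nc: "\<exists>i\<in>{1..d}. ellipse d a b i \<noteq> ellipse d a b 1" if "a \<noteq> 0 \<or> b \<noteq> 0" for a b
    using that nc[of 1 "ellipse d a b"] nc[of "d - 1" "ellipse d a b"] dft_d1 d
    by (auto simp: dft_ellipse[OF d])
  have no_circle: "norm a \<noteq> norm b" if "ellipse d a b \<in> C" for a b
    using ellipse_flat[of a b d] flat[OF that] by metis
  \<comment> \<open>Power iteration: after recentring and dividing by the dominant modulus only the modes 1 and d - 1
    survive, and their phases converge along a subsequence.\<close>
  have to_ellipse: "\<exists>a b. norm a = norm (dft d 1 z) \<and> norm b = norm (dft d (d - 1) z) \<and> ellipse d a b \<in> C"
    if z: "z \<in> C" and ne: "dft d 1 z \<noteq> 0 \<or> dft d (d - 1) z \<noteq> 0" for z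
  proof -
    define w where "w n = (step d (\<lambda>_. p) ^^ n) z" for n
    have wdft: "dft d k (w n) = \<Lambda> k ^ n * dft d k z" for k n
      by (induction n) (simp_all add: w_def \<Lambda>step)
    have w_nc: "\<exists>i\<in>{1..d}. w n i \<noteq> w n 1" for n
      using ne nc[of 1 "w n"] nc[of "d - 1" "w n"] dft_d1 \<Lambda>1 d by (auto simp: wdft \<Lambda>cnj)
    have wC: "w n \<in> C" for n
    proof (induction n)
      case 0
      then show ?case using z by (simp add: w_def)
    next
      case (Suc n)
      have "w (Suc n) = step d (\<lambda>_. p) (w n)" by (simp add: w_def)
      then show ?case using step0[OF Suc] w_nc[of "Suc n"] by simp
    qed
    define R where "R = norm (\<Lambda> 1)"
    have R: "R > 0" using \<Lambda>1 by (simp add: R_def)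
    \<comment> \<open>Subtracting mode 0 recentres the polygon; its eigenvalue is 1.\<close>
    define v where "v n i = of_real (real d / R ^ n) * w n i + - (dft d 0 z / of_real (R ^ n))" for n i
    have vC: "v n \<in> C" for n
      unfolding v_def using R d by (intro affine wC) auto
    define u where "u = \<Lambda> 1 / of_real R"
    have nu: "norm u = 1" using R by (simp add: u_def norm_divide R_def)
    define E where "E k n = (\<Lambda> k / of_real R) ^ n * dft d k z" for k n
    have \<Lambda>0: "\<Lambda> 0 = 1" by (simp add: \<Lambda>_def eigenvalue_def)
    have v_sum: "v n i = E 1 n * unity_root d ^ i + E (d - 1) n * cnj (unity_root d ^ i) +
        (\<Sum>k\<in>{2..d-2}. E k n * unity_root d ^ (k * i))" if i: "i \<in> {1..d}" for n i
    proof -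
      have "of_real (real d / R ^ n) * w n i = (of_nat d * w n i) / of_real (R ^ n)" by simp
      also have "\<dots> = (\<Sum>k<d. \<Lambda> k ^ n * dft d k z * unity_root d ^ (k * i)) / of_real (R ^ n)"
        unfolding dft_inverse[OF d1 i] wdft ..
      also have "\<dots> = (\<Sum>k<d. E k n * unity_root d ^ (k * i))"
        unfolding sum_divide_distrib E_def by (intro sum.cong refl) (simp add: power_divide)
      also have "{..<d} = insert 0 (insert 1 (insert (d - 1) {2..d-2}))" using d by auto
      also have "(\<Sum>k\<in>\<dots>. E k n * unity_root d ^ (k * i)) =
          E 0 n + (E 1 n * unity_root d ^ i + (E (d - 1) n * unity_root d ^ ((d - 1) * i) +
            (\<Sum>k\<in>{2..d-2}. E k n * unity_root d ^ (k * i))))"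
        using d by (subst sum.insert; (subst sum.insert)?; (subst sum.insert)?; force?)
      also have "E 0 n = dft d 0 z / of_real (R ^ n)"
        by (simp add: E_def \<Lambda>0 power_divide)
      also have "unity_root d ^ ((d - 1) * i) = cnj (unity_root d ^ i)"
        using cnj_root_power[OF d1 d1] by (simp only: power_mult power_one_right complex_cnj_power)
      finally show ?thesis by (simp add: v_def add.assoc)
    qed
    have "bounded (range (\<lambda>n. u ^ n))"
      by (rule boundedI[of _ 1]) (auto simp: norm_power nu)
    then obtain u' r where r: "strict_mono r" "((\<lambda>n. u ^ n) \<circ> r) \<longlonglongrightarrow> u'"
      using bounded_imp_convergent_subsequence by blast
    then have ul: "(\<lambda>n. u ^ r n) \<longlonglongrightarrow> u'" by (simp add: comp_def)
    have nu': "norm u' = 1"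
      using tendsto_norm[OF ul] by (simp add: norm_power nu LIMSEQ_const_iff)
    have E1: "(\<lambda>n. E 1 (r n)) \<longlonglongrightarrow> u' * dft d 1 z"
      using tendsto_mult[OF ul tendsto_const[of "dft d 1 z"]] by (simp add: E_def u_def)
    have E2: "(\<lambda>n. E (d - 1) (r n)) \<longlonglongrightarrow> cnj u' * dft d (d - 1) z"
      using tendsto_mult[OF tendsto_cnj[OF ul] tendsto_const[of "dft d (d - 1) z"]]
      by (simp add: E_def u_def \<Lambda>cnj)
    have E3: "(\<lambda>n. E k (r n)) \<longlonglongrightarrow> 0" if k: "k \<in> {2..d-2}" for k
    proof -
      have "norm (\<Lambda> k / of_real R) < 1"
        using eigenvalue_dominant[OF d p, of k] k R by (simp add: norm_divide R_def \<Lambda>_def)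
      then have "(\<lambda>n. (\<Lambda> k / of_real R) ^ n) \<longlonglongrightarrow> 0" by (rule LIMSEQ_power_zero)
      then have "(\<lambda>n. (\<Lambda> k / of_real R) ^ r n) \<longlonglongrightarrow> 0"
        using LIMSEQ_subseq_LIMSEQ[OF _ r(1)] by (force simp: comp_def)
      then show ?thesis using tendsto_mult[OF _ tendsto_const[of "dft d k z"]] by (force simp: E_def)
    qed
    define a b where "a = u' * dft d 1 z" and "b = cnj u' * dft d (d - 1) z"
    have "ellipse d a b \<in> C"
    proof (rule limit)
      show "v (r n) \<in> C" for n by (rule vC)
      fix i assume i: "i \<in> {1..d}"
      have "(\<lambda>n. E 1 (r n) * unity_root d ^ i + E (d - 1) (r n) * cnj (unity_root d ^ i) +
          (\<Sum>k\<in>{2..d-2}. E k (r n) * unity_root d ^ (k * i)))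
        \<longlonglongrightarrow> a * unity_root d ^ i + b * cnj (unity_root d ^ i) + (\<Sum>k\<in>{2..d-2}. 0 * unity_root d ^ (k * i))"
        unfolding a_def b_def
        by (intro tendsto_add tendsto_mult tendsto_sum tendsto_const E1 E2 E3)
      then show "(\<lambda>n. v (r n) i) \<longlonglongrightarrow> ellipse d a b i"
        by (simp add: v_sum[OF i] ellipse_def)
    next
      show "\<exists>i\<in>{1..d}. ellipse d a b i \<noteq> ellipse d a b 1"
        using ne nu' by (intro ellipse_nc) (auto simp: a_def b_def)
    qed
    moreover have "norm a = norm (dft d 1 z)" "norm b = norm (dft d (d - 1) z)"
      by (simp_all add: a_def b_def norm_mult nu')
    ultimately show ?thesis by blast
  qed
  have perturb: "dft d k (step d ((\<lambda>_. p)(s := q)) z) = \<Lambda> k * dft d k z +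
      of_real (q - p) * (z (s mod d + 1) - z s) * cnj (unity_root d ^ (k * s))" if "s \<in> {1..d}" for k s z
    unfolding dft_step_update[OF d1 that] \<Lambda>step ..
  have cr: "cnj (unity_root d ^ ((d - 1) * s)) = unity_root d ^ s" for s
    using cnj_root_power[OF d1, of "d - 1"] d1 by (simp add: power_mult)
  \<comment> \<open>If both dominant modes vanish, then a changed ratio at a nondegenerate side produces dominant modes of equal
    modulus, and power iteration leads to a collinear ellipse.\<close>
  have first_mode: "dft d 1 z \<noteq> 0 \<or> dft d (d - 1) z \<noteq> 0" if z: "z \<in> C" for z
  proof (rule ccontr)
    assume "\<not> ?thesis"
    then have 0: "dft d 1 z = 0" "dft d (d - 1) z = 0" by auto
    obtain s where s: "s \<in> {1..d}" "z (s mod d + 1) \<noteq> z s"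
      using nonconst[OF z] cyclic_constant[of d z] by blast
    let ?z = "step d ((\<lambda>_. p)(s := q)) z"
    have "unity_root d \<noteq> 0" using norm_root[of d] by force
    have eq: "norm (dft d 1 ?z) = norm (dft d (d - 1) ?z)" "dft d 1 ?z \<noteq> 0"
      unfolding perturb[OF s(1)] 0 cr using s(2) pq \<open>unity_root d \<noteq> 0\<close>
      by (simp_all add: norm_mult norm_power)
    have "?z \<in> C" using eq(2) dft_d1 by (intro step1[OF z s(1)] nc[of 1]) auto
    then obtain a b where "norm a = norm b" "ellipse d a b \<in> C"
      using to_ellipse[of ?z] eq by metis
    then show False using no_circle by blast
  qed
  have normalise: "ellipse d (of_real r * a) (of_real r * b) \<in> C" if "ellipse d a b \<in> C" "r > 0" for a b r
  proof -
    have "ellipse d (of_real r * a) (of_real r * b) = (\<lambda>i. of_real r * ellipse d a b i + 0)"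
      by (simp add: ellipse_def fun_eq_iff algebra_simps)
    then show ?thesis using affine[OF that, of 0] by simp
  qed
  \<comment> \<open>Normalised ellipses in C; their two amplitudes form a compact set.\<close>
  define S where "S = {(a, b). (norm a)\<^sup>2 + (norm b)\<^sup>2 = 1 \<and> ellipse d a b \<in> C}"
  have to_S: "(of_real r * a, of_real r * b) \<in> S"
    if "ellipse d a b \<in> C" "a \<noteq> 0 \<or> b \<noteq> 0" "r = 1 / sqrt ((norm a)\<^sup>2 + (norm b)\<^sup>2)" for a b r
  proof -
    have pos: "(norm a)\<^sup>2 + (norm b)\<^sup>2 > 0" using that(2) by (auto simp: add_pos_nonneg add_nonneg_pos)
    then have r: "r > 0" "r\<^sup>2 * ((norm a)\<^sup>2 + (norm b)\<^sup>2) = 1" by (auto simp: that(3) power_divide)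
    then show ?thesis
      unfolding S_def using normalise[OF that(1) r(1)] by (simp add: norm_mult power_mult_distrib distrib_left)
  qed
  have "S \<noteq> {}"
  proof -
    obtain a b where "norm a = norm (dft d 1 z\<^sub>0)" "norm b = norm (dft d (d - 1) z\<^sub>0)" "ellipse d a b \<in> C"
      using to_ellipse[OF z0 first_mode[OF z0]] by blast
    then show ?thesis using to_S[of a b] first_mode[OF z0] by fastforce
  qed
  moreover have "compact S"
    unfolding compact_eq_bounded_closed
  proof
    have "norm a \<le> 1 \<and> norm b \<le> 1" if "(norm a)\<^sup>2 + (norm b)\<^sup>2 = 1" for a b :: complex
      using that power2_le_imp_le[of "norm a" 1] power2_le_imp_le[of "norm b" 1]
        zero_le_power2[of "norm a"] zero_le_power2[of "norm b"] by (auto simp del: zero_le_power2)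
    then have "S \<subseteq> cball 0 1 \<times> cball 0 1" by (auto simp: S_def)
    then show "bounded S" by (rule bounded_subset[rotated]) (intro bounded_Times bounded_cball)
    show "closed S"
      unfolding closed_sequential_limits
    proof (intro allI impI)
      fix x l assume x: "(\<forall>n. x n \<in> S) \<and> x \<longlonglongrightarrow> l"
      obtain a b where l: "l = (a, b)" by (cases l)
      have lim: "(\<lambda>n. fst (x n)) \<longlonglongrightarrow> a" "(\<lambda>n. snd (x n)) \<longlonglongrightarrow> b"
        using tendsto_fst[of x l sequentially] tendsto_snd[of x l sequentially] x l by auto
      have xs: "(norm (fst (x n)))\<^sup>2 + (norm (snd (x n)))\<^sup>2 = 1" "ellipse d (fst (x n)) (snd (x n)) \<in> C" for n
        using x by (auto simp: S_def case_prod_beta)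
      have "(\<lambda>n. (norm (fst (x n)))\<^sup>2 + (norm (snd (x n)))\<^sup>2) \<longlonglongrightarrow> (norm a)\<^sup>2 + (norm b)\<^sup>2"
        by (intro tendsto_intros lim)
      then have n1: "(norm a)\<^sup>2 + (norm b)\<^sup>2 = 1" by (simp add: xs LIMSEQ_const_iff)
      have "ellipse d a b \<in> C"
      proof (rule limit[OF xs(2)])
        show "(\<lambda>n. ellipse d (fst (x n)) (snd (x n)) i) \<longlonglongrightarrow> ellipse d a b i" for i
          unfolding ellipse_def by (intro tendsto_intros lim)
        show "\<exists>i\<in>{1..d}. ellipse d a b i \<noteq> ellipse d a b 1"
          by (rule ellipse_nc) (use n1 in auto)
      qed
      then show "l \<in> S" using n1 by (simp add: S_def l)
    qed
  qed
  ultimately obtain ab where ab: "ab \<in> S" and min: "\<And>y. y \<in> S \<Longrightarrow>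
      \<bar>(norm (fst ab))\<^sup>2 - (norm (snd ab))\<^sup>2\<bar> \<le> \<bar>(norm (fst y))\<^sup>2 - (norm (snd y))\<^sup>2\<bar>"
    using continuous_attains_inf[of S "\<lambda>y. \<bar>(norm (fst y))\<^sup>2 - (norm (snd y))\<^sup>2\<bar>"]
    by (force intro: continuous_intros)
  define a b where "a = fst ab" and "b = snd ab"
  have S1: "(norm a)\<^sup>2 + (norm b)\<^sup>2 = 1" and SC: "ellipse d a b \<in> C"
    using ab by (auto simp: S_def a_def b_def case_prod_beta)
  define D where "D = \<bar>(norm a)\<^sup>2 - (norm b)\<^sup>2\<bar>"
  have D: "D > 0" using no_circle[OF SC] by (simp add: D_def)
  \<comment> \<open>The factor 1 / d normalises the Fourier coefficients of the one-point perturbation.\<close>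
  define c where "c = (q - p) / real d"
  define \<mu> where "\<mu> = \<Lambda> 1 + of_real c * (unity_root d - 1)"
  define \<nu> where "\<nu> = of_real c * (unity_root d - 1)"
  have w1: "unity_root d \<noteq> 1" using root_power_eq_1[OF d1, of 1] d by auto
  have \<nu>0: "\<nu> \<noteq> 0" using w1 pq d by (simp add: \<nu>_def c_def)
  have \<mu>0: "\<mu> \<noteq> 0"
  proof
    assume "\<mu> = 0"
    then have "Im \<mu> = 0" by simp
    moreover have "Im \<mu> = (p + c) * sin (2 * pi / real d)"
      by (simp add: \<mu>_def \<Lambda>_def eigenvalue_def unity_root_def algebra_simps)
    ultimately have "p + c = 0" using sin_root_pos[OF d] by auto
    moreover have "p + c = ((real d - 1) * p + q) / real d" using d by (simp add: c_def field_simps)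
    moreover have "(real d - 1) * p + q > 0" using d p q by (intro add_pos_pos mult_pos_pos) auto
    ultimately show False using d by simp
  qed
  \<comment> \<open>The numbers sum to zero over all s, because the square of the root of unity is not 1.\<close>
  have "\<exists>s\<in>{1..d}. Re (\<mu> * \<nu> * a * cnj b * unity_root d ^ (2 * s)) \<ge> 0"
  proof (rule ccontr)
    assume "\<not> ?thesis"
    then have neg: "Re (\<mu> * \<nu> * a * cnj b * unity_root d ^ (2 * s)) < 0" if "s \<in> {1..d}" for s
      using that by force
    have "(\<Sum>s=1..d. Re (\<mu> * \<nu> * a * cnj b * unity_root d ^ (2 * s))) < 0"
      using sum_strict_mono[of "{1..d}" _ "\<lambda>_. 0", OF _ _ neg] d by simp
    moreover have "(\<Sum>s=1..d. \<mu> * \<nu> * a * cnj b * unity_root d ^ (2 * s)) = 0"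
    proof -
      have "\<not> d dvd 2" using d by (auto dest: dvd_imp_le)
      then have r2: "unity_root d ^ 2 \<noteq> 1" using root_power_eq_1[OF d1, of 2] by simp
      have rd: "(unity_root d ^ 2) ^ d = 1" using root_power_eq_1[OF d1, of "2 * d"] by (simp add: power_mult)
      show ?thesis
        using geometric_root_sum(2)[OF rd r2] by (simp add: power_mult flip: sum_distrib_left)
    qed
    ultimately show False by (metis Re_sum less_irrefl zero_complex.simps(1))
  qed
  then obtain s where s: "s \<in> {1..d}" "Re (\<mu> * \<nu> * a * cnj b * unity_root d ^ (2 * s)) \<ge> 0" by blast
  define z where "z = step d ((\<lambda>_. p)(s := q)) (ellipse d a b)"
  define W where "W = unity_root d ^ s"
  have WW: "cnj W * W = 1" unfolding W_def by (rule cnj_root_mult)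
  have Ws: "unity_root d ^ (s mod d + 1) = W * unity_root d"
    using root_power_cyc[OF d1 s(1), of 1] by (simp add: W_def)
  define a' b' where "a' = \<mu> * a + cnj \<nu> * cnj W * cnj W * b" and "b' = cnj \<mu> * b + \<nu> * W * W * a"
  have diff: "ellipse d a b (s mod d + 1) - ellipse d a b s =
      a * W * (unity_root d - 1) + b * cnj W * (cnj (unity_root d) - 1)"
    unfolding ellipse_def Ws W_def[symmetric] by (simp add: algebra_simps)
  have qp: "(of_real (q - p) :: complex) = of_nat d * of_real c" using d by (simp add: c_def)
  have dz1: "dft d 1 z = of_nat d * a'"
  proof -
    have "dft d 1 z = \<Lambda> 1 * (of_nat d * a) + of_nat d * of_real c *
        (a * W * (unity_root d - 1) + b * cnj W * (cnj (unity_root d) - 1)) * cnj W"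
      unfolding z_def perturb[OF s(1)] dft_ellipse[OF d] diff qp by (simp add: W_def)
    also have "\<dots> = of_nat d * (\<Lambda> 1 * a + of_real c * (unity_root d - 1) * (cnj W * W) * a
        + of_real c * (cnj (unity_root d) - 1) * cnj W * cnj W * b)"
      by (simp add: algebra_simps)
    also have "\<dots> = of_nat d * a'"
      unfolding WW by (simp add: a'_def \<mu>_def \<nu>_def algebra_simps)
    finally show ?thesis .
  qed
  have dz2: "dft d (d - 1) z = of_nat d * b'"
  proof -
    have "dft d (d - 1) z = cnj (\<Lambda> 1) * (of_nat d * b) + of_nat d * of_real c *
        (a * W * (unity_root d - 1) + b * cnj W * (cnj (unity_root d) - 1)) * W"
      unfolding z_def perturb[OF s(1)] dft_ellipse[OF d] diff qp cr \<Lambda>cnj by (simp add: W_def)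
    also have "\<dots> = of_nat d * (cnj (\<Lambda> 1) * b + of_real c * (cnj (unity_root d) - 1) * (cnj W * W) * b
        + of_real c * (unity_root d - 1) * W * W * a)"
      by (simp add: algebra_simps)
    also have "\<dots> = of_nat d * b'"
      unfolding WW by (simp add: b'_def \<mu>_def \<nu>_def algebra_simps)
    finally show ?thesis .
  qed
  define X where "X = \<mu> * \<nu> * a * cnj b * W * W"
  have X: "Re X \<ge> 0"
  proof -
    have "X = \<mu> * \<nu> * a * cnj b * unity_root d ^ (2 * s)"
      by (simp add: X_def W_def mult_2 power_add mult.assoc)
    then show ?thesis using s(2) by simp
  qed
  have nW: "norm W = 1" by (simp add: W_def norm_power)
  have na: "(norm a')\<^sup>2 = (norm \<mu>)\<^sup>2 * (norm a)\<^sup>2 + (norm \<nu>)\<^sup>2 * (norm b)\<^sup>2 + 2 * Re X"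
  proof -
    have "(norm a')\<^sup>2 = (norm (\<mu> * a))\<^sup>2 + (norm (cnj \<nu> * cnj W * cnj W * b))\<^sup>2
        + 2 * Re (\<mu> * a * cnj (cnj \<nu> * cnj W * cnj W * b))"
      unfolding a'_def by (rule norm_add_square)
    also have "\<mu> * a * cnj (cnj \<nu> * cnj W * cnj W * b) = X" by (simp add: X_def mult_ac)
    finally show ?thesis by (simp add: norm_mult nW power_mult_distrib)
  qed
  have nb: "(norm b')\<^sup>2 = (norm \<mu>)\<^sup>2 * (norm b)\<^sup>2 + (norm \<nu>)\<^sup>2 * (norm a)\<^sup>2 + 2 * Re X"
  proof -
    have "(norm b')\<^sup>2 = (norm (cnj \<mu> * b))\<^sup>2 + (norm (\<nu> * W * W * a))\<^sup>2
        + 2 * Re (cnj \<mu> * b * cnj (\<nu> * W * W * a))"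
      unfolding b'_def by (rule norm_add_square)
    also have "cnj \<mu> * b * cnj (\<nu> * W * W * a) = cnj X" by (simp add: X_def mult_ac)
    finally show ?thesis by (simp add: norm_mult nW power_mult_distrib)
  qed
  define m l where "m = (norm \<mu>)\<^sup>2" and "l = (norm \<nu>)\<^sup>2"
  have ml: "m > 0" "l > 0" using \<mu>0 \<nu>0 by (auto simp: m_def l_def)
  have sum': "(norm a')\<^sup>2 + (norm b')\<^sup>2 = m + l + 4 * Re X"
    using S1 unfolding na nb m_def[symmetric] l_def[symmetric]
    by (simp add: algebra_simps flip: distrib_left)
  have diff': "\<bar>(norm a')\<^sup>2 - (norm b')\<^sup>2\<bar> = \<bar>m - l\<bar> * D"
  proof -
    have "(norm a')\<^sup>2 - (norm b')\<^sup>2 = (m - l) * ((norm a)\<^sup>2 - (norm b)\<^sup>2)"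
      unfolding na nb m_def[symmetric] l_def[symmetric] by (simp add: algebra_simps)
    then show ?thesis by (simp add: D_def abs_mult)
  qed
  have pos: "(norm a')\<^sup>2 + (norm b')\<^sup>2 > 0" using sum' ml X by linarith
  then have ab'0: "a' \<noteq> 0 \<or> b' \<noteq> 0" by auto
  have dz: "dft d 1 z \<noteq> 0 \<or> dft d (d - 1) z \<noteq> 0"
    unfolding dz1 dz2 using ab'0 d by auto
  then have "\<exists>i\<in>{1..d}. z i \<noteq> z 1" using nc[of 1 z] nc[of "d - 1" z] dft_d1 by auto
  then have "z \<in> C" unfolding z_def by (rule step1[OF SC s(1)])
  from to_ellipse[OF this dz] obtain A B where AB: "norm A = real d * norm a'" "norm B = real d * norm b'"
    "ellipse d A B \<in> C"
    unfolding dz1 dz2 by (auto simp: norm_mult)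
  have AB0: "A \<noteq> 0 \<or> B \<noteq> 0" using ab'0 AB(1,2) d by (metis mult_eq_0_iff norm_eq_zero of_nat_eq_0_iff not_numeral_le_zero)
  define r where "r = 1 / sqrt ((norm A)\<^sup>2 + (norm B)\<^sup>2)"
  have rS: "(of_real r * A, of_real r * B) \<in> S" by (rule to_S[OF AB(3) AB0 r_def])
  have NN: "(norm A)\<^sup>2 + (norm B)\<^sup>2 = (real d)\<^sup>2 * ((norm a')\<^sup>2 + (norm b')\<^sup>2)"
    unfolding AB by (simp add: power_mult_distrib distrib_left)
  have r2: "r\<^sup>2 * ((real d)\<^sup>2 * ((norm a')\<^sup>2 + (norm b')\<^sup>2)) = 1"
  proof -
    have "(real d)\<^sup>2 * ((norm a')\<^sup>2 + (norm b')\<^sup>2) > 0" using pos d by simp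
    moreover have "(1 / sqrt N)\<^sup>2 * N = 1" if "N > 0" for N :: real
      using that by (simp add: power_divide)
    ultimately show ?thesis unfolding r_def NN by blast
  qed
  have "D \<le> \<bar>(norm (of_real r * A))\<^sup>2 - (norm (of_real r * B))\<^sup>2\<bar>"
    using min[OF rS] by (simp add: D_def a_def b_def)
  also have "(norm (of_real r * A))\<^sup>2 - (norm (of_real r * B))\<^sup>2 = r\<^sup>2 * (real d)\<^sup>2 * ((norm a')\<^sup>2 - (norm b')\<^sup>2)"
    by (simp add: norm_mult power_mult_distrib AB right_diff_distrib)
  also have "\<bar>\<dots>\<bar> = r\<^sup>2 * (real d)\<^sup>2 * (\<bar>m - l\<bar> * D)"
    unfolding abs_mult diff' by simp
  finally have "D * (m + l + 4 * Re X) \<le> r\<^sup>2 * (real d)\<^sup>2 * (\<bar>m - l\<bar> * D) * (m + l + 4 * Re X)"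
    using sum' pos by (intro mult_right_mono) auto
  also have "\<dots> = \<bar>m - l\<bar> * D"
    using r2 unfolding sum' by (simp add: algebra_simps)
  finally have "D * (m + l + 4 * Re X) \<le> D * \<bar>m - l\<bar>" by (simp add: mult.commute)
  then have "m + l + 4 * Re X \<le> \<bar>m - l\<bar>" using D by simp
  then show False using ml X by linarith
qed

section \<open>Flat configurations\<close>

lemma osc_perturb:
  assumes "d \<ge> 1" "\<And>i. i \<in> {1..d} \<Longrightarrow> norm (a i - b i) \<le> K"
  shows "osc d a \<le> osc d b + 2 * K"
proof (rule osc_le[OF assms(1)])
  fix i j assume ij: "i \<in> {1..d}" "j \<in> {1..d}"
  have "a i - a j = (a i - b i) + (b i - b j) + (b j - a j)" by simp
  then have "norm (a i - a j) \<le> norm (a i - b i) + norm (b i - b j) + norm (b j - a j)"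
    by (metis norm_triangle_mono norm_triangle_ineq order_refl)
  then show "norm (a i - a j) \<le> osc d b + 2 * K"
    using assms(2)[OF ij(1)] assms(2)[OF ij(2)] osc_ge[OF ij, of b] by (simp add: norm_minus_commute)
qed

lemma evolve_commute:
  assumes "linear f"
  shows "f (evolve d \<omega> n a i) = evolve d \<omega> n (\<lambda>i. f (a i)) i"
  by (induction n arbitrary: i) (simp_all add: step_def linear_add[OF assms] linear_scale[OF assms])

text \<open>The inequality is strict, so that it defines an open condition and fails for constant sequences.\<close>

definition narrow :: "nat \<Rightarrow> real \<Rightarrow> (nat \<Rightarrow> complex) \<Rightarrow> bool" where
  "narrow d \<delta> w \<longleftrightarrow> osc d (\<lambda>i. Im (w i)) < \<delta> * osc d (\<lambda>i. Re (w i))"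

lemma narrow_open:
  assumes d: "d \<ge> 1" and \<delta>: "\<delta> > 0" and "narrow d \<delta> a"
  shows "\<exists>e>0. \<forall>w. (\<forall>i\<in>{1..d}. norm (w i - a i) \<le> e) \<longrightarrow> narrow d \<delta> w"
proof -
  define g where "g = \<delta> * osc d (\<lambda>i. Re (a i)) - osc d (\<lambda>i. Im (a i))"
  have g: "g > 0" using assms(3) by (simp add: g_def narrow_def)
  define e where "e = g / (4 * (1 + \<delta>))"
  have "g / (4 * D) * D = g / 4" if "D > 0" for D using that by simp
  from this[of "1 + \<delta>"] have "e * (1 + \<delta>) = g / 4" using \<delta> unfolding e_def by linarith
  then have e: "e > 0" "2 * e * (1 + \<delta>) < g"
    using g \<delta> unfolding mult.assoc by (simp add: e_def, linarith)
  have "narrow d \<delta> w" if w: "\<forall>i\<in>{1..d}. norm (w i - a i) \<le> e" for w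
  proof -
    have re: "norm (Re (a i) - Re (w i)) \<le> e" and im: "norm (Im (w i) - Im (a i)) \<le> e" if "i \<in> {1..d}" for i
      using w that abs_Re_le_cmod[of "w i - a i"] abs_Im_le_cmod[of "w i - a i"] by force+
    have 1: "osc d (\<lambda>i. Re (a i)) \<le> osc d (\<lambda>i. Re (w i)) + 2 * e" by (rule osc_perturb[OF d re])
    have 2: "osc d (\<lambda>i. Im (w i)) \<le> osc d (\<lambda>i. Im (a i)) + 2 * e" by (rule osc_perturb[OF d im])
    have "\<delta> * osc d (\<lambda>i. Re (a i)) \<le> \<delta> * (osc d (\<lambda>i. Re (w i)) + 2 * e)"
      using 1 \<delta> by (intro mult_left_mono) auto
    with 2 e(2) show ?thesis unfolding narrow_def g_def by (simp add: algebra_simps)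
  qed
  with e show ?thesis by blast
qed

text \<open>Rotations by rational angles are sufficient because \<open>narrow\<close> is an open condition
  (\<open>flat_if_narrow\<close>); a countable union makes flatness of the evolved configuration measurable.\<close>

definition flat :: "nat \<Rightarrow> real \<Rightarrow> (nat \<Rightarrow> complex) \<Rightarrow> bool" where
  "flat d \<delta> z \<longleftrightarrow> (\<exists>r::rat. narrow d \<delta> (\<lambda>i. cis (of_rat r) * z i))"

lemma rational_direction_dense:
  assumes "norm u = 1" "e > 0"
  shows "\<exists>r::rat. norm (cis (of_rat r) - u) < e"
proof -
  have u: "u = cis (Arg u)" using rcis_cmod_Arg[of u] assms(1) by (simp add: rcis_def)
  have "isCont (\<lambda>t. cis t) (Arg u)" unfolding cis_conv_exp by (intro continuous_intros)
  then obtain s where s: "s > 0" "\<And>t. \<bar>t - Arg u\<bar> < s \<Longrightarrow> norm (cis t - cis (Arg u)) < e"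
    using assms(2) unfolding continuous_at_eps_delta dist_norm real_norm_def by blast
  obtain r where "Arg u < of_rat r" "of_rat r < Arg u + s"
    using of_rat_dense[of "Arg u" "Arg u + s"] s(1) by auto
  then have "norm (cis (of_rat r) - cis (Arg u)) < e" by (intro s(2)) auto
  then show ?thesis using u by auto
qed

lemma flat_if_narrow:
  assumes d: "d \<ge> 1" and \<delta>: "\<delta> > 0" and u: "norm u = 1" and nar: "narrow d \<delta> (\<lambda>i. u * z i)"
  shows "flat d \<delta> z"
proof -
  obtain e where e: "e > 0" "\<And>w. (\<forall>i\<in>{1..d}. norm (w i - u * z i) \<le> e) \<Longrightarrow> narrow d \<delta> w"
    using narrow_open[OF d \<delta> nar] by blast
  define K where "K = 1 + (\<Sum>i=1..d. norm (z i))"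
  have K: "K > 0" unfolding K_def by (simp add: add_pos_nonneg sum_nonneg)
  have zK: "norm (z i) \<le> K" if "i \<in> {1..d}" for i
    using member_le_sum[of i "{1..d}" "\<lambda>i. norm (z i)"] that by (simp add: K_def)
  obtain r :: rat where r: "norm (cis (of_rat r) - u) < e / K"
    using rational_direction_dense[OF u, of "e / K"] e K by auto
  have "norm (cis (of_rat r) * z i - u * z i) \<le> e" if "i \<in> {1..d}" for i
  proof -
    have "norm (cis (of_rat r) * z i - u * z i) = norm (cis (of_rat r) - u) * norm (z i)"
      by (simp flip: norm_mult add: left_diff_distrib)
    also have "\<dots> \<le> (e / K) * K" using r zK[OF that] K e by (intro mult_mono) auto
    finally show ?thesis using K by simp
  qed
  then have "narrow d \<delta> (\<lambda>i. cis (of_rat r) * z i)" by (intro e(2)) blast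
  then show ?thesis unfolding flat_def by blast
qed

lemma flat_open:
  assumes d: "d \<ge> 1" and \<delta>: "\<delta> > 0" and "flat d \<delta> z"
  shows "\<exists>e>0. \<forall>w. (\<forall>i\<in>{1..d}. norm (w i - z i) \<le> e) \<longrightarrow> flat d \<delta> w"
proof -
  obtain r :: rat where r: "narrow d \<delta> (\<lambda>i. cis (of_rat r) * z i)" using assms(3) by (auto simp: flat_def)
  obtain e where e: "e > 0" "\<And>w. (\<forall>i\<in>{1..d}. norm (w i - cis (of_rat r) * z i) \<le> e) \<Longrightarrow> narrow d \<delta> w"
    using narrow_open[OF d \<delta> r] by blast
  have "flat d \<delta> w" if w: "\<forall>i\<in>{1..d}. norm (w i - z i) \<le> e" for w
    unfolding flat_def
  proof (intro exI[of _ r] e(2) ballI)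
    fix i assume "i \<in> {1..d}"
    then show "norm (cis (of_rat r) * w i - cis (of_rat r) * z i) \<le> e"
      using w by (simp add: norm_mult flip: right_diff_distrib)
  qed
  with e show ?thesis by blast
qed

lemma flat_affine:
  assumes d: "d \<ge> 1" and r: "r > 0"
  shows "flat d \<delta> (\<lambda>i. of_real r * z i + c) \<longleftrightarrow> flat d \<delta> z"
proof -
  have "narrow d \<delta> (\<lambda>i. u * (of_real r * z i + c)) = narrow d \<delta> (\<lambda>i. u * z i)" for u
  proof -
    have "(\<lambda>i. Im (u * (of_real r * z i + c))) = (\<lambda>i. r *\<^sub>R Im (u * z i) - (- Im (u * c)))"
      "(\<lambda>i. Re (u * (of_real r * z i + c))) = (\<lambda>i. r *\<^sub>R Re (u * z i) - (- Re (u * c)))"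
      by (simp_all add: fun_eq_iff algebra_simps)
    then have "osc d (\<lambda>i. Im (u * (of_real r * z i + c))) = r * osc d (\<lambda>i. Im (u * z i))"
      "osc d (\<lambda>i. Re (u * (of_real r * z i + c))) = r * osc d (\<lambda>i. Re (u * z i))"
      using r by (simp_all only: osc_shift osc_scale[OF d] abs_of_pos)
    then show ?thesis unfolding narrow_def using r by (simp add: mult.left_commute)
  qed
  then show ?thesis by (simp add: flat_def)
qed

lemma evolve_affine:
  "evolve d \<omega> n (\<lambda>i. of_real r * z i + c) = (\<lambda>i. of_real r * evolve d \<omega> n z i + (c :: complex))"
  by (induction n) (simp_all add: step_def fun_eq_iff scaleR_conv_of_real algebra_simps)

lemma exactly_flat_flat:
  assumes d: "d \<ge> 1" and \<delta>: "\<delta> > 0" and u: "norm u = 1"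
    and ex: "\<And>i. i \<in> {1..d} \<Longrightarrow> Im (u * z i) = Im (u * z 1)"
    and nc: "i\<^sub>0 \<in> {1..d}" "z i\<^sub>0 \<noteq> z 1"
  shows "flat d \<delta> z"
proof (rule flat_if_narrow[OF d \<delta> u])
  have "osc d (\<lambda>i. Im (u * z i)) \<le> 0"
  proof (rule osc_le[OF d])
    fix i j assume "i \<in> {1..d}" "j \<in> {1..d}"
    then have "Im (u * z i) = Im (u * z j)" using ex[of i] ex[of j] by metis
    then show "norm (Im (u * z i) - Im (u * z j)) \<le> 0" by simp
  qed
  moreover have "osc d (\<lambda>i. Re (u * z i)) > 0"
  proof -
    have "u * z i\<^sub>0 \<noteq> u * z 1" using u nc(2) by auto
    then have "Re (u * z i\<^sub>0) \<noteq> Re (u * z 1)" using ex[OF nc(1)] by (metis complex_eqI)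
    then have "0 < norm (Re (u * z i\<^sub>0) - Re (u * z 1))" by simp
    also have "\<dots> \<le> osc d (\<lambda>i. Re (u * z i))" by (rule osc_ge[where a = "\<lambda>i. Re (u * z i)"]) (use nc d in auto)
    finally show ?thesis .
  qed
  ultimately show "narrow d \<delta> (\<lambda>i. u * z i)"
    unfolding narrow_def using \<delta> by (meson mult_pos_pos order_le_less_trans)
qed

context subdivision_law
begin

lemma flat_meas [measurable]:
  "{\<omega>\<in>space seqs. flat d \<delta> (evolve d \<omega> n z)} \<in> sets seqs"
proof -
  have "(\<lambda>\<omega>. osc d (\<lambda>i. f (u * evolve d \<omega> n z i))) \<in> borel_measurable seqs"
    if "linear f" for f :: "complex \<Rightarrow> real" and u
  proof -
    have "linear (\<lambda>w. f (u * w))"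
      using linear_compose[OF linear_times that] by (simp add: comp_def)
    from evolve_commute[OF this] show ?thesis by simp
  qed
  from this[of Re] this[of Im] have [measurable]:
    "(\<lambda>\<omega>. osc d (\<lambda>i. Re (u * evolve d \<omega> n z i))) \<in> borel_measurable seqs"
    "(\<lambda>\<omega>. osc d (\<lambda>i. Im (u * evolve d \<omega> n z i))) \<in> borel_measurable seqs" for u
    by (auto simp: bounded_linear.linear bounded_linear_Re bounded_linear_Im)
  show ?thesis unfolding flat_def narrow_def by measurable
qed

lemma AE_complex_nonconstant:
  assumes "nonconstant (z :: nat \<Rightarrow> complex)"
  shows "AE \<omega> in seqs. \<forall>n. nonconstant (evolve d \<omega> n z)"
proof -
  have *: "AE \<omega> in seqs. \<forall>n. nonconstant (evolve d \<omega> n z)"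
    if f: "linear f" and nc: "nonconstant (\<lambda>i. f (z i))" for f :: "complex \<Rightarrow> real"
    using AE_evolve_nonconstant[OF nc]
  proof eventually_elim
    case (elim \<omega>)
    show ?case
    proof
      fix n
      obtain i where "i \<in> {1..d}" "evolve d \<omega> n (\<lambda>i. f (z i)) i \<noteq> evolve d \<omega> n (\<lambda>i. f (z i)) 1"
        using elim unfolding nonconstant_def by blast
      then show "nonconstant (evolve d \<omega> n z)"
        unfolding nonconstant_def evolve_commute[OF f, symmetric] by metis
    qed
  qed
  have "nonconstant (\<lambda>i. Re (z i)) \<or> nonconstant (\<lambda>i. Im (z i))"
    using assms unfolding nonconstant_def by (metis complex_eqI)
  then show ?thesis
    using *[of Re] *[of Im] by (auto simp: bounded_linear.linear bounded_linear_Re bounded_linear_Im)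
qed

section \<open>Reaching flatness\<close>

text \<open>The bound is required for all nearby configurations, so that it survives limits of configurations.\<close>

definition reaches_flat :: "real \<Rightarrow> (nat \<Rightarrow> complex) \<Rightarrow> bool" where
  "reaches_flat \<delta> z \<longleftrightarrow> (\<exists>k e c. e > 0 \<and> c > 0 \<and> (\<forall>w. (\<forall>i\<in>{1..d}. norm (w i - z i) < e) \<longrightarrow>
     c \<le> seqs.prob {\<omega>\<in>space seqs. flat d \<delta> (evolve d \<omega> k w)}))"

lemma measurable_first [measurable]: "(\<lambda>\<omega>. \<omega> (0::nat)) \<in> measurable seqs ratios"
  by (rule measurable_component_singleton) simp

text \<open>Both \<open>p\<close> and \<open>q\<close> belong to the support, so every pattern of them is approximated with
  positive probability.\<close>

lemma prob_first_near:
  assumes x: "\<And>i. i \<in> {1..d} \<Longrightarrow> x i \<in> {p, q}" and e: "e > 0"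
  shows "{\<omega>\<in>space seqs. \<forall>i\<in>{1..d}. \<bar>\<omega> 0 i - x i\<bar> < e} \<in> sets seqs"
    and "seqs.prob {\<omega>\<in>space seqs. \<forall>i\<in>{1..d}. \<bar>\<omega> 0 i - x i\<bar> < e} > 0"
proof -
  interpret pp: product_prob_space "\<lambda>_. \<mu>" "{1..d}" ..
  let ?B = "PiE {1..d} (\<lambda>i. {x i - e<..<x i + e})"
  have Bm: "?B \<in> sets ratios" by (rule sets_PiM_I_finite) auto
  have eq: "{\<omega>\<in>space seqs. \<forall>i\<in>{1..d}. \<bar>\<omega> 0 i - x i\<bar> < e} = (\<lambda>\<omega>. \<omega> 0) -` ?B \<inter> space seqs"
  proof -
    have "(\<omega> 0 \<in> ?B) = (\<forall>i\<in>{1..d}. \<bar>\<omega> 0 i - x i\<bar> < e)" if "\<omega> \<in> space seqs" for \<omega>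
    proof -
      have "\<omega> 0 \<in> space ratios" using measurable_space[OF measurable_first that] .
      then have "\<omega> 0 \<in> extensional {1..d}" by (auto simp: space_PiM PiE_def)
      then show ?thesis by (auto simp: PiE_iff abs_less_iff algebra_simps)
    qed
    then show ?thesis by auto
  qed
  show "{\<omega>\<in>space seqs. \<forall>i\<in>{1..d}. \<bar>\<omega> 0 i - x i\<bar> < e} \<in> sets seqs"
    unfolding eq by (rule measurable_sets[OF measurable_first Bm])
  have "emeasure seqs ((\<lambda>\<omega>. \<omega> 0) -` ?B \<inter> space seqs) = emeasure ratios ?B"
    using emeasure_distr[OF measurable_first Bm] unfolding distr_first by simp
  also have "\<dots> = (\<Prod>i\<in>{1..d}. emeasure \<mu> {x i - e<..<x i + e})"
    by (rule pp.emeasure_PiM) auto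
  also have "\<dots> \<noteq> 0"
  proof -
    have "measure \<mu> {x i - e<..<x i + e} > 0" if "i \<in> {1..d}" for i
      using x[OF that] p_charged[of "{x i - e<..<x i + e}"] q_charged[of "{x i - e<..<x i + e}"] e by auto
    then have "emeasure \<mu> {x i - e<..<x i + e} \<noteq> 0" if "i \<in> {1..d}" for i
      using that by (fastforce simp: measure_def)
    then show ?thesis by simp
  qed
  finally show "seqs.prob {\<omega>\<in>space seqs. \<forall>i\<in>{1..d}. \<bar>\<omega> 0 i - x i\<bar> < e} > 0"
    unfolding eq by (simp add: seqs.emeasure_eq_measure zero_less_measure_iff)
qed

lemma step_continuous:
  assumes x: "\<And>i. i \<in> {1..d} \<Longrightarrow> 0 \<le> x i \<and> x i \<le> 1" and e: "e > 0"
  shows "\<exists>s>0. \<forall>w y. (\<forall>i\<in>{1..d}. norm (w i - z i) < s) \<and> (\<forall>i\<in>{1..d}. \<bar>y i - x i\<bar> < s) \<longrightarrow>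
     (\<forall>i\<in>{1..d}. norm (step d y w i - step d x (z :: nat \<Rightarrow> complex) i) < e)"
proof -
  define K where "K = 2 + (\<Sum>i=1..d. 2 * norm (z i))"
  have K: "K \<ge> 2" unfolding K_def by (simp add: sum_nonneg)
  have zK: "2 * norm (z i) \<le> K - 2" if "i \<in> {1..d}" for i
    using member_le_sum[of i "{1..d}" "\<lambda>i. 2 * norm (z i)"] that by (simp add: K_def)
  define s where "s = min 1 (e / (2 * (1 + K)))"
  have s: "s > 0" "s \<le> 1" "s * (1 + K) < e"
  proof -
    show "s > 0" "s \<le> 1" using e K by (auto simp: s_def)
    have "s * (1 + K) \<le> e / (2 * (1 + K)) * (1 + K)" using K by (intro mult_right_mono) (auto simp: s_def)
    also have "\<dots> = e / 2" using K by (simp add: field_simps)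
    finally show "s * (1 + K) < e" using e by linarith
  qed
  have "norm (step d y w i - step d x z i) < e"
    if w: "\<forall>i\<in>{1..d}. norm (w i - z i) < s" and y: "\<forall>i\<in>{1..d}. \<bar>y i - x i\<bar> < s" and i: "i \<in> {1..d}" for w y i
  proof -
    let ?j = "i mod d + 1"
    have j: "?j \<in> {1..d}" by (rule cyc_mem[OF i])
    have eq: "step d y w i - step d x z i = (y i - x i) *\<^sub>R (w ?j - w i) +
        ((1 - x i) *\<^sub>R (w i - z i) + x i *\<^sub>R (w ?j - z ?j))"
      by (simp add: step_def algebra_simps)
    have wb: "norm (w k) \<le> norm (z k) + 1" if "k \<in> {1..d}" for k
      using w that s norm_triangle_ineq2[of "w k" "z k"] by force
    have "norm (w ?j - w i) \<le> K"
      using norm_triangle_ineq4[of "w ?j" "w i"] zK[OF i] zK[OF j] wb[OF i] wb[OF j] by linarith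
    then have 1: "norm ((y i - x i) *\<^sub>R (w ?j - w i)) \<le> s * K"
    proof -
      have "\<bar>y i - x i\<bar> \<le> s" using y i by (intro less_imp_le) blast
      then show ?thesis using \<open>norm (w ?j - w i) \<le> K\<close> s(1) unfolding norm_scaleR by (intro mult_mono) auto
    qed
    have "norm ((1 - x i) *\<^sub>R (w i - z i) + x i *\<^sub>R (w ?j - z ?j)) \<le> (1 - x i) * s + x i * s"
    proof -
      have "norm (w i - z i) \<le> s" "norm (w ?j - z ?j) \<le> s"
        using w[rule_format, OF i] w[rule_format, OF j] by (simp_all add: less_imp_le)
      then show ?thesis
        using x[OF i] by (intro order_trans[OF norm_triangle_ineq] add_mono) (simp_all add: mult_left_mono)
    qed
    then have 2: "norm ((1 - x i) *\<^sub>R (w i - z i) + x i *\<^sub>R (w ?j - z ?j)) \<le> s" by (simp add: algebra_simps)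
    have "norm (step d y w i - step d x z i) \<le> s * K + s"
      unfolding eq by (rule order_trans[OF norm_triangle_ineq add_mono[OF 1 2]])
    then show ?thesis using s(3) by (simp add: algebra_simps)
  qed
  with s(1) show ?thesis by blast
qed

text \<open>Flatness that can be reached after a step with ratios \<open>p\<close> and \<open>q\<close> can be reached before
  it: the first ratios are close to the prescribed ones with positive probability, and the step is continuous in the
  ratios and in the configuration.\<close>

lemma reaches_flat_step:
  assumes x: "\<And>i. i \<in> {1..d} \<Longrightarrow> x i \<in> {p, q}" and r: "reaches_flat \<delta> (step d x z)"
  shows "reaches_flat \<delta> z"
proof -
  obtain k e c where e: "e > 0" and c: "c > 0" and near: "\<And>w. (\<forall>i\<in>{1..d}. norm (w i - step d x z i) < e) \<Longrightarrow>
     c \<le> seqs.prob {\<omega>\<in>space seqs. flat d \<delta> (evolve d \<omega> k w)}"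
    using r unfolding reaches_flat_def by blast
  have unit: "0 \<le> x i \<and> x i \<le> 1" if "i \<in> {1..d}" for i using x[OF that] pq by auto
  have "\<exists>s>0. \<forall>w y. (\<forall>i\<in>{1..d}. norm (w i - z i) < s) \<and> (\<forall>i\<in>{1..d}. \<bar>y i - x i\<bar> < s) \<longrightarrow>
     (\<forall>i\<in>{1..d}. norm (step d y w i - step d x z i) < e)"
    by (rule step_continuous[OF _ e]) (rule unit)
  then obtain s where s: "s > 0" and cont: "\<forall>w y. (\<forall>i\<in>{1..d}. norm (w i - z i) < s) \<and>
     (\<forall>i\<in>{1..d}. \<bar>y i - x i\<bar> < s) \<longrightarrow> (\<forall>i\<in>{1..d}. norm (step d y w i - step d x z i) < e)"
    by (elim exE conjE) (rule that; assumption)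
  let ?A = "{\<omega>\<in>space seqs. \<forall>i\<in>{1..d}. \<bar>\<omega> 0 i - x i\<bar> < s}"
  have A: "?A \<in> sets seqs" "seqs.prob ?A > 0" using prob_first_near[of x s] x s by auto
  have "c * seqs.prob ?A \<le> seqs.prob {\<omega>\<in>space seqs. flat d \<delta> (evolve d \<omega> (Suc k) w)}"
    if w: "\<forall>i\<in>{1..d}. norm (w i - z i) < s" for w
  proof -
    \<comment> \<open>The maximal inequality, used for the single time 1.\<close>
    define E where "E l \<omega> \<longleftrightarrow> l = 1 \<and> (\<forall>i\<in>{1..d}. \<bar>\<omega> 0 i - x i\<bar> < s)" for l :: nat and \<omega> :: "nat \<Rightarrow> nat \<Rightarrow> real"
    have "c * seqs.prob {\<omega>\<in>space seqs. \<exists>l\<le>1. E l \<omega>} \<le> seqs.prob {\<omega>\<in>space seqs. flat d \<delta> (evolve d \<omega> (Suc k) w)}"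
    proof (rule first_passage)
      show "{\<omega>\<in>space seqs. E l \<omega>} \<in> sets seqs" for l
        using A(1) by (cases "l = 1") (auto simp: E_def)
      show "{\<omega>\<in>space seqs. flat d \<delta> (evolve d \<omega> (Suc k) w)} \<in> sets seqs" by (rule flat_meas)
      show "E l \<omega> = E l \<omega>'" if "\<And>m. m < l \<Longrightarrow> \<omega> m = \<omega>' m" for l \<omega> \<omega>'
        using that by (auto simp: E_def)
      fix l \<omega> assume "E l \<omega>"
      then have l: "l = 1" and o: "\<forall>i\<in>{1..d}. \<bar>\<omega> 0 i - x i\<bar> < s" by (auto simp: E_def)
      have "evolve d (comb_seq 1 \<omega> \<omega>') (Suc k) w = evolve d \<omega>' k (step d (\<omega> 0) w)" for \<omega>'
        using evolve_comb_seq[of d 1 \<omega> \<omega>' k w] by (simp add: One_nat_def)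
      then show "c \<le> seqs.prob {\<omega>'\<in>space seqs. flat d \<delta> (evolve d (comb_seq l \<omega> \<omega>') (Suc k) w)}"
        unfolding l using near[OF cont[THEN spec, THEN spec, THEN mp, OF conjI[OF w o]]] by simp
    qed
    then show ?thesis by (simp add: E_def)
  qed
  then show ?thesis unfolding reaches_flat_def using s A(2) c by (intro exI[of _ "Suc k"] exI[of _ s] exI[of _ "c * seqs.prob ?A"]) auto
qed

text \<open>The exceptional configurations form a family as in \<open>flat_free_family_empty\<close>.\<close>

lemma reaches_flat_always:
  assumes \<delta>: "\<delta> > 0" and nc: "nonconstant z"
  shows "reaches_flat \<delta> z"
proof -
  define C where "C = {z :: nat \<Rightarrow> complex. nonconstant z \<and> \<not> reaches_flat \<delta> z}"
  have "C = {}"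
  proof (rule flat_free_family_empty[OF d3 pq(1,2,3)])
    show "\<exists>i\<in>{1..d}. z i \<noteq> z 1" if "z \<in> C" for z
      using that by (auto simp: C_def nonconstant_def)
    show "step d (\<lambda>_. p) z \<in> C" if "z \<in> C" "\<exists>i\<in>{1..d}. step d (\<lambda>_. p) z i \<noteq> step d (\<lambda>_. p) z 1" for z
      using that reaches_flat_step[of "\<lambda>_. p" \<delta> z] by (auto simp: C_def nonconstant_def)
    show "step d ((\<lambda>_. p)(s := q)) z \<in> C"
      if "z \<in> C" "s \<in> {1..d}" "\<exists>i\<in>{1..d}. step d ((\<lambda>_. p)(s := q)) z i \<noteq> step d ((\<lambda>_. p)(s := q)) z 1" for z s
    proof -
      have pattern: "((\<lambda>_. p)(s := q)) i \<in> {p, q}" for i by simp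
      have "\<not> reaches_flat \<delta> (step d ((\<lambda>_. p)(s := q)) z)"
        using that(1) reaches_flat_step[of "(\<lambda>_. p)(s := q)" \<delta> z, OF pattern] by (auto simp: C_def)
      then show ?thesis using that(3) by (simp add: C_def nonconstant_def)
    qed
    show "z \<in> C" if v: "\<And>n::nat. v n \<in> C" and l: "\<And>i. i \<in> {1..d} \<Longrightarrow> (\<lambda>n. v n i) \<longlonglongrightarrow> z i"
      and nc: "\<exists>i\<in>{1..d}. z i \<noteq> z 1" for v z
    proof (rule ccontr)
      assume "z \<notin> C"
      then have "reaches_flat \<delta> z" using nc by (auto simp: C_def nonconstant_def)
      then obtain k e c where e: "e > 0" and c: "c > 0" and near: "\<And>w. (\<forall>i\<in>{1..d}. norm (w i - z i) < e) \<Longrightarrow>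
         c \<le> seqs.prob {\<omega>\<in>space seqs. flat d \<delta> (evolve d \<omega> k w)}"
        unfolding reaches_flat_def by blast
      have "\<forall>\<^sub>F n in sequentially. \<forall>i\<in>{1..d}. norm (v n i - z i) < e / 2"
      proof (intro eventually_ball_finite ballI finite_atLeastAtMost)
        fix i assume "i \<in> {1..d}"
        from tendstoD[OF l[OF this], of "e / 2"] e
        show "\<forall>\<^sub>F n in sequentially. norm (v n i - z i) < e / 2" by (simp add: dist_norm)
      qed
      then obtain n where n: "\<forall>i\<in>{1..d}. norm (v n i - z i) < e / 2"
        by (auto simp: eventually_sequentially)
      have "norm (w i - z i) < e" if "norm (w i - v n i) < e / 2" "i \<in> {1..d}" for w i
        using norm_triangle_ineq[of "w i - v n i" "v n i - z i"] that n by force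
      then have "reaches_flat \<delta> (v n)"
        unfolding reaches_flat_def using near e c
        by (intro exI[of _ k] exI[of _ "e / 2"] exI[of _ c]) auto
      then show False using v[of n] by (simp add: C_def)
    qed
    show "(\<lambda>i. of_real r * z i + c) \<in> C" if z: "z \<in> C" and r: "r > 0" for z r c
    proof -
      have "nonconstant (\<lambda>i. of_real r * z i + c)"
        using z r by (auto simp: C_def nonconstant_def)
      moreover have "reaches_flat \<delta> z" if g: "reaches_flat \<delta> (\<lambda>i. of_real r * z i + c)"
      proof -
        obtain k e b where e: "e > 0" and b: "b > 0" and near: "\<And>w. (\<forall>i\<in>{1..d}. norm (w i - (of_real r * z i + c)) < e) \<Longrightarrow>
           b \<le> seqs.prob {\<omega>\<in>space seqs. flat d \<delta> (evolve d \<omega> k w)}"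
          using g unfolding reaches_flat_def by blast
        have "b \<le> seqs.prob {\<omega>\<in>space seqs. flat d \<delta> (evolve d \<omega> k w)}"
          if w: "\<forall>i\<in>{1..d}. norm (w i - z i) < e / r" for w
        proof -
          have "norm ((of_real r * w i + c) - (of_real r * z i + c)) < e" if "i \<in> {1..d}" for i
          proof -
            have "(of_real r * w i + c) - (of_real r * z i + c) = of_real r * (w i - z i)" by (simp add: algebra_simps)
            then show ?thesis using w that r by (simp add: norm_mult pos_less_divide_eq mult.commute)
          qed
          then have "b \<le> seqs.prob {\<omega>\<in>space seqs. flat d \<delta> (evolve d \<omega> k (\<lambda>i. of_real r * w i + c))}"
            by (intro near) auto
          then show ?thesis unfolding evolve_affine flat_affine[OF d1 r] .
        qed
        then show ?thesis
          unfolding reaches_flat_def using e b r by (intro exI[of _ k] exI[of _ "e / r"] exI[of _ b]) auto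
      qed
      ultimately show ?thesis using z by (auto simp: C_def)
    qed
    show "\<exists>i\<in>{1..d}. Im (u * z i) \<noteq> Im (u * z 1)" if z: "z \<in> C" and u: "norm u = 1" for z u
    proof (rule ccontr)
      assume none: "\<not> ?thesis"
      then have all: "Im (u * z k) = Im (u * z 1)" if "k \<in> {1..d}" for k using that by blast
      obtain i where i: "i \<in> {1..d}" "z i \<noteq> z 1" using z by (auto simp: C_def nonconstant_def)
      have "flat d \<delta> z" by (rule exactly_flat_flat[OF d1 \<delta> u all i])
      then obtain e where e: "e > 0" "\<And>w. (\<forall>i\<in>{1..d}. norm (w i - z i) \<le> e) \<Longrightarrow> flat d \<delta> w"
        using flat_open[OF d1 \<delta>] by blast
      have "1 \<le> seqs.prob {\<omega>\<in>space seqs. flat d \<delta> (evolve d \<omega> 0 w)}" if "\<forall>i\<in>{1..d}. norm (w i - z i) < e" for w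
      proof -
        have "flat d \<delta> w" by (rule e(2)) (use that in \<open>auto intro: less_imp_le\<close>)
        then have "{\<omega>\<in>space seqs. flat d \<delta> (evolve d \<omega> 0 w)} = space seqs" by simp
        then show ?thesis by (simp only: measure_def seqs.emeasure_space_1) simp
      qed
      then have "reaches_flat \<delta> z"
        unfolding reaches_flat_def using e(1) by (intro exI[of _ 0] exI[of _ e] exI[of _ 1]) auto
      then show False using z by (simp add: C_def)
    qed
  qed
  then show ?thesis using nc by (auto simp: C_def)
qed

text \<open>Flatness is invariant under rescaling and translation, so only the compact set of normalised configurations
  matters. Along a sequence on which time and probability fail to be bounded, a limit configuration would contradict
  \<open>reaches_flat_always\<close>.\<close>

lemma reaches_flat_uniformly:
  assumes \<delta>: "\<delta> > 0"
  shows "\<exists>K. \<exists>c>0. \<forall>z. nonconstant z \<longrightarrow> c \<le> seqs.prob {\<omega>\<in>space seqs. \<exists>k\<le>K. flat d \<delta> (evolve d \<omega> k z)}"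
proof -
  have one: "1 \<in> {1..d}" using d1 by simp
  define P where "P K z = seqs.prob {\<omega>\<in>space seqs. \<exists>k\<le>K. flat d \<delta> (evolve d \<omega> k z)}" for K z
  have "\<exists>K. \<exists>c>0. \<forall>z. osc d z = 1 \<and> z 1 = 0 \<longrightarrow> c \<le> P K z"
  proof (rule ccontr)
    assume neg: "\<not> ?thesis"
    have "\<exists>z. osc d z = 1 \<and> z 1 = 0 \<and> P m z < 1 / real (Suc m)" for m
    proof -
      have "0 < 1 / real (Suc m)" by simp
      with neg show ?thesis by (meson not_le)
    qed
    then obtain v where v: "\<And>m. osc d (v m) = 1" "\<And>m. v m 1 = 0" "\<And>m. P m (v m) < 1 / real (Suc m)"
      by metis
    have "bounded (range (\<lambda>m. v m i))" if "i \<in> {1..d}" for i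
      using osc_ge[OF that one, of "v _"] v(1,2) by (intro boundedI[of _ 1]) auto
    from finite_coords_convergent_subsequence[of "{1..d}" v, OF finite_atLeastAtMost this]
    obtain r where r: "strict_mono r" "\<And>i. i \<in> {1..d} \<Longrightarrow> convergent (\<lambda>m. v (r m) i)" by blast
    then obtain z where z: "\<And>i. i \<in> {1..d} \<Longrightarrow> (\<lambda>m. v (r m) i) \<longlonglongrightarrow> z i"
      unfolding convergent_def by metis
    have near: "\<forall>\<^sub>F m in sequentially. \<forall>i\<in>{1..d}. norm (v (r m) i - z i) < e" if "e > 0" for e
      by (intro eventually_ball_finite ballI finite_atLeastAtMost) (use z that in \<open>simp add: tendsto_iff dist_norm\<close>)
    have "nonconstant z"
    proof (rule ccontr)
      assume "\<not> nonconstant z"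
      then have "osc d z \<le> 0" using osc_pos_iff[of z] by linarith
      obtain m where m: "\<forall>i\<in>{1..d}. norm (v (r m) i - z i) < 1 / 4"
        using near[of "1 / 4"] by (auto simp: eventually_sequentially)
      have "osc d (v (r m)) \<le> osc d z + 2 * (1 / 4)"
        by (rule osc_perturb[OF d1]) (use m in force)
      then show False using v(1)[of "r m"] \<open>osc d z \<le> 0\<close> by linarith
    qed
    from reaches_flat_always[OF \<delta> this] obtain k e c where e: "e > 0" and c: "c > 0"
      and good: "\<And>w. (\<forall>i\<in>{1..d}. norm (w i - z i) < e) \<Longrightarrow>
         c \<le> seqs.prob {\<omega>\<in>space seqs. flat d \<delta> (evolve d \<omega> k w)}"
      unfolding reaches_flat_def by blast
    obtain N where N: "1 / real (Suc N) < c" using c reals_Archimedean[of c] by (auto simp: inverse_eq_divide)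
    obtain m0 where m0: "\<And>m. m \<ge> m0 \<Longrightarrow> \<forall>i\<in>{1..d}. norm (v (r m) i - z i) < e"
      using near[OF e] by (auto simp: eventually_sequentially)
    define m where "m = max m0 (max k N)"
    have rm: "m \<le> r m" by (rule seq_suble[OF r(1)])
    have "c \<le> seqs.prob {\<omega>\<in>space seqs. flat d \<delta> (evolve d \<omega> k (v (r m)))}"
      by (rule good[OF m0]) (simp add: m_def)
    also have "\<dots> \<le> P (r m) (v (r m))"
      unfolding P_def
    proof (rule seqs.finite_measure_mono)
      show "{\<omega>\<in>space seqs. flat d \<delta> (evolve d \<omega> k (v (r m)))} \<subseteq> {\<omega>\<in>space seqs. \<exists>k\<le>r m. flat d \<delta> (evolve d \<omega> k (v (r m)))}"
        using rm by (auto simp: m_def)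
    qed measurable
    also have "\<dots> < 1 / real (Suc (r m))" by (rule v(3))
    also have "\<dots> \<le> 1 / real (Suc N)"
      using rm by (intro divide_left_mono) (auto simp: m_def)
    finally show False using N by linarith
  qed
  then obtain K c where c: "c > 0" and norm1: "\<And>z. osc d z = 1 \<Longrightarrow> z 1 = 0 \<Longrightarrow> c \<le> P K z" by blast
  have "c \<le> P K z" if nc: "nonconstant z" for z
  proof -
    define r where "r = 1 / osc d z"
    have pos: "osc d z > 0" using nc osc_pos_iff by blast
    then have r: "r > 0" by (simp add: r_def)
    define z' where "z' = (\<lambda>i. of_real r * z i + - (of_real r * z 1))"
    have "osc d z' = osc d (\<lambda>i. r *\<^sub>R z i - of_real r * z 1)"
      by (simp add: z'_def scaleR_conv_of_real)
    also have "\<dots> = 1" unfolding osc_shift osc_scale[OF d1] using pos by (simp add: r_def)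
    finally have "c \<le> P K z'" by (rule norm1) (simp add: z'_def)
    also have "P K z' = P K z"
      unfolding P_def z'_def evolve_affine flat_affine[OF d1 r] ..
    finally show ?thesis .
  qed
  with c show ?thesis unfolding P_def by blast
qed

text \<open>Let \<open>s\<close> be the supremum of the probabilities of never becoming flat. By the Markov property at time
  \<open>K\<close> each of them is at most \<open>(1 - c) s\<close>, so \<open>s = 0\<close>.\<close>

lemma hits_flat:
  assumes \<delta>: "\<delta> > 0" and nc: "nonconstant z"
  shows "seqs.prob {\<omega>\<in>space seqs. \<exists>k. flat d \<delta> (evolve d \<omega> k z)} = 1"
proof -
  obtain K c where c: "c > 0" and unif: "\<And>z. nonconstant z \<Longrightarrow>
      c \<le> seqs.prob {\<omega>\<in>space seqs. \<exists>k\<le>K. flat d \<delta> (evolve d \<omega> k z)}"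
    using reaches_flat_uniformly[OF \<delta>] by blast
  define h where "h z = seqs.prob {\<omega>\<in>space seqs. \<forall>k. \<not> flat d \<delta> (evolve d \<omega> k z)}" for z
  define s where "s = Sup (h ` Collect nonconstant)"
  have bdd: "bdd_above (h ` Collect nonconstant)" by (rule bdd_aboveI[of _ 1]) (auto simp: h_def)
  have h_le: "h z \<le> s" if "nonconstant z" for z
    unfolding s_def using that by (intro cSup_upper bdd) auto
  have h_nonneg: "0 \<le> h z" for z by (simp add: h_def)
  have s0: "0 \<le> s" using h_nonneg[of z] h_le[OF nc] by linarith
  have rec: "h z \<le> (1 - c) * s" if nc: "nonconstant z" for z
  proof -
    have Nm: "{\<omega>\<in>space seqs. \<forall>k. \<not> flat d \<delta> (evolve d \<omega> k z)} \<in> sets seqs" by measurable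
    let ?A = "{\<omega>\<in>space seqs. \<not> (\<exists>k\<le>K. flat d \<delta> (evolve d \<omega> k z))}"
    have Am: "?A \<in> sets seqs" by measurable
    have "h z = (\<integral>\<omega>. seqs.prob {\<omega>'\<in>space seqs. \<forall>k. \<not> flat d \<delta> (evolve d (comb_seq K \<omega> \<omega>') k z)} \<partial>seqs)"
      unfolding h_def by (rule split_past(2)[OF Nm])
    also have "\<dots> \<le> (\<integral>\<omega>. indicator ?A \<omega> * s \<partial>seqs)"
    proof (rule integral_mono_AE)
      show "integrable seqs (\<lambda>\<omega>. seqs.prob {\<omega>'\<in>space seqs. \<forall>k. \<not> flat d \<delta> (evolve d (comb_seq K \<omega> \<omega>') k z)})"
        by (rule seqs.integrable_const_bound[where B = 1])
          (use split_past(1)[OF Nm, of K] in \<open>auto intro!: AE_I2\<close>)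
      show "integrable seqs (\<lambda>\<omega>. indicator ?A \<omega> * s)"
        using Am by (intro integrable_mult_left) (simp add: integrable_indicator_iff seqs.emeasure_eq_measure)
      show "AE \<omega> in seqs. seqs.prob {\<omega>'\<in>space seqs. \<forall>k. \<not> flat d \<delta> (evolve d (comb_seq K \<omega> \<omega>') k z)} \<le> indicator ?A \<omega> * s"
        using AE_complex_nonconstant[OF nc] AE_space
      proof eventually_elim
        case (elim \<omega>)
        have past: "evolve d (comb_seq K \<omega> \<omega>') k z = evolve d \<omega> k z" if "k \<le> K" for k \<omega>'
          by (rule evolve_comb_seq_past[OF that])
        show ?case
        proof (cases "\<omega> \<in> ?A")
          case True
          have "seqs.prob {\<omega>'\<in>space seqs. \<forall>k. \<not> flat d \<delta> (evolve d (comb_seq K \<omega> \<omega>') k z)} \<le> h (evolve d \<omega> K z)"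
            unfolding h_def
          proof (rule seqs.finite_measure_mono)
            show "{\<omega>'\<in>space seqs. \<forall>k. \<not> flat d \<delta> (evolve d (comb_seq K \<omega> \<omega>') k z)} \<subseteq>
                {\<omega>'\<in>space seqs. \<forall>k. \<not> flat d \<delta> (evolve d \<omega>' k (evolve d \<omega> K z))}"
              by (auto simp flip: evolve_comb_seq)
          qed measurable
          also have "\<dots> \<le> s" using elim(1) by (intro h_le) blast
          finally show ?thesis using True by simp
        next
          case False
          then obtain k where "k \<le> K" "flat d \<delta> (evolve d \<omega> k z)" using elim(2) by auto
          then have "flat d \<delta> (evolve d (comb_seq K \<omega> \<omega>') k z)" for \<omega>' by (simp add: past)
          then have "{\<omega>'\<in>space seqs. \<forall>k. \<not> flat d \<delta> (evolve d (comb_seq K \<omega> \<omega>') k z)} = {}"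
            by blast
          then show ?thesis by (simp only: measure_empty) (simp add: s0)
        qed
      qed
    qed
    also have "\<dots> = seqs.prob ?A * s" using Am by simp
    also have "\<dots> \<le> (1 - c) * s"
    proof (rule mult_right_mono[OF _ s0])
      have "seqs.prob ?A = 1 - seqs.prob {\<omega>\<in>space seqs. \<exists>k\<le>K. flat d \<delta> (evolve d \<omega> k z)}"
        by (rule seqs.prob_neg) measurable
      then show "seqs.prob ?A \<le> 1 - c" using unif[OF nc] by linarith
    qed
    finally show ?thesis .
  qed
  have "s \<le> (1 - c) * s"
    unfolding s_def by (rule cSup_least) (use nc rec in \<open>auto simp: s_def\<close>)
  then have "c * s \<le> 0" by (simp add: algebra_simps)
  then have "s = 0" using c s0 by (simp add: mult_le_0_iff)
  then have "h z = 0" using h_le[OF nc] h_nonneg[of z] by linarith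
  moreover have "h z = 1 - seqs.prob {\<omega>\<in>space seqs. \<exists>k. flat d \<delta> (evolve d \<omega> k z)}"
  proof -
    have "h z = seqs.prob {\<omega>\<in>space seqs. \<not> (\<exists>k. flat d \<delta> (evolve d \<omega> k z))}" by (simp add: h_def)
    also have "\<dots> = 1 - seqs.prob {\<omega>\<in>space seqs. \<exists>k. flat d \<delta> (evolve d \<omega> k z)}"
      by (rule seqs.prob_neg) measurable
    finally show ?thesis .
  qed
  ultimately show ?thesis by simp
qed

section \<open>Keeping flatness\<close>

text \<open>The thin coordinate grows at most by the factor \<open>d\<close> times the gain, the long one, by
  \<open>nondegenerate\<close> and with probability at least \<open>1 - \<eta>\<close>, at least by
  \<open>\<epsilon>\<close> times the gain, so that the initial ratio deteriorates at most by a constant factor for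
  all times.\<close>

lemma stays_flat:
  assumes \<delta>: "\<delta> > 0" and \<eta>: "\<eta> > 0"
  shows "\<exists>e>0. \<forall>z. flat d e z \<longrightarrow> 1 - \<eta> \<le> seqs.prob {\<omega>\<in>space seqs. \<forall>m. flat d \<delta> (evolve d \<omega> m z)}"
proof -
  obtain \<epsilon> where \<epsilon>: "\<epsilon> > 0" and nondeg: "\<And>w :: nat \<Rightarrow> real. osc d w = 1 \<Longrightarrow>
    seqs.prob {\<omega>\<in>space seqs. \<exists>k. osc d (evolve d \<omega> k w) < \<epsilon> * gain d \<omega> k} \<le> \<eta>"
    using nondegenerate[OF \<eta>] by blast
  \<comment> \<open>The ratio worsens at most by the factor d / \<epsilon>; the 2 leaves room for a strict inequality.\<close>
  define e where "e = \<delta> * \<epsilon> / (2 * real d)"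
  have e: "e > 0" using \<delta> \<epsilon> d3 by (simp add: e_def)
  have de: "real d * e = \<delta> * \<epsilon> / 2" using d3 by (simp add: e_def)
  have "1 - \<eta> \<le> seqs.prob {\<omega>\<in>space seqs. \<forall>m. flat d \<delta> (evolve d \<omega> m z)}" if fl: "flat d e z" for z
  proof -
    obtain r :: rat where r: "narrow d e (\<lambda>i. cis (of_rat r) * z i)" using fl by (auto simp: flat_def)
    define a where "a = (\<lambda>i. Re (cis (of_rat r) * z i))"
    define b where "b = (\<lambda>i. Im (cis (of_rat r) * z i))"
    have ab: "osc d b < e * osc d a" using r unfolding narrow_def a_def b_def .
    have "0 < e * osc d a" using ab osc_nonneg[OF d1, of b] by linarith
    then have a: "osc d a > 0" using e by (simp add: zero_less_mult_iff)
    have lin: "linear (\<lambda>w. Re (cis (of_rat r) * w))" "linear (\<lambda>w. Im (cis (of_rat r) * w))"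
      using linear_compose[OF linear_times bounded_linear.linear[OF bounded_linear_Re], of "cis (of_rat r)"]
        linear_compose[OF linear_times bounded_linear.linear[OF bounded_linear_Im], of "cis (of_rat r)"]
      by (simp_all add: comp_def)
    have ea: "Re (cis (of_rat r) * evolve d \<omega> m z i) = evolve d \<omega> m a i"
      and eb: "Im (cis (of_rat r) * evolve d \<omega> m z i) = evolve d \<omega> m b i" for \<omega> m i
      unfolding a_def b_def by (rule evolve_commute[OF lin(1)], rule evolve_commute[OF lin(2)])
    let ?a = "\<lambda>i. (1 / osc d a) *\<^sub>R a i"
    have oa: "osc d ?a = 1" using osc_scale[OF d1, of "1 / osc d a" a] a by simp
    let ?bad = "{\<omega>\<in>space seqs. \<exists>k. osc d (evolve d \<omega> k ?a) < \<epsilon> * gain d \<omega> k}"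
    have badm: "?bad \<in> sets seqs" by measurable
    have "1 - \<eta> \<le> seqs.prob (space seqs - ?bad)"
      using seqs.prob_compl[OF badm] nondeg[OF oa] by linarith
    also have "\<dots> \<le> seqs.prob {\<omega>\<in>space seqs. \<forall>m. flat d \<delta> (evolve d \<omega> m z)}"
    proof (rule seqs.finite_measure_mono_AE)
      show "{\<omega>\<in>space seqs. \<forall>m. flat d \<delta> (evolve d \<omega> m z)} \<in> sets seqs" by measurable
      show "AE \<omega> in seqs. \<omega> \<in> space seqs - ?bad \<longrightarrow> \<omega> \<in> {\<omega>\<in>space seqs. \<forall>m. flat d \<delta> (evolve d \<omega> m z)}"
        using AE_gain_pos
      proof eventually_elim
        case (elim \<omega>)
        show ?case
        proof
          assume good: "\<omega> \<in> space seqs - ?bad"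
          have "flat d \<delta> (evolve d \<omega> m z)" for m
          proof -
            define g where "g = gain d \<omega> m"
            have g: "g > 0" using elim by (simp add: g_def)
            have "osc d (evolve d \<omega> m ?a) = osc d (evolve d \<omega> m a) / osc d a"
              using osc_evolve_scale[OF d1, of \<omega> m "1 / osc d a" a] a by simp
            moreover have "\<epsilon> * g \<le> osc d (evolve d \<omega> m ?a)"
              using good by (auto simp: g_def not_less)
            ultimately have "\<epsilon> * g \<le> osc d (evolve d \<omega> m a) / osc d a" by (simp only:)
            then have low: "\<epsilon> * g * osc d a \<le> osc d (evolve d \<omega> m a)"
              using a by (simp add: field_simps)
            have "osc d (evolve d \<omega> m b) \<le> real d * osc d b * g"
              unfolding g_def by (rule osc_evolve_le_gain[OF d1])
            also have "\<dots> \<le> real d * (e * osc d a) * g"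
              using ab g by (intro mult_right_mono mult_left_mono) auto
            also have "\<dots> = \<delta> / 2 * (\<epsilon> * g * osc d a)" using de by (simp add: algebra_simps)
            also have "\<dots> < \<delta> * (\<epsilon> * g * osc d a)" using \<delta> \<epsilon> g a by simp
            also have "\<dots> \<le> \<delta> * osc d (evolve d \<omega> m a)" using low \<delta> by simp
            finally have "narrow d \<delta> (\<lambda>i. cis (of_rat r) * evolve d \<omega> m z i)"
              unfolding narrow_def ea eb .
            then show ?thesis unfolding flat_def by blast
          qed
          then show "\<omega> \<in> {\<omega>\<in>space seqs. \<forall>m. flat d \<delta> (evolve d \<omega> m z)}" using good by auto
        qed
      qed
    qed
    finally show ?thesis .
  qed
  with e show ?thesis by blast
qed

text \<open>Almost surely some time is reached at which the configuration is so flat that it stays \<open>\<delta>\<close>-flat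
  from then on with conditional probability at least \<open>1 - \<eta>\<close>.\<close>

lemma eventually_flat:
  assumes \<delta>: "\<delta> > 0" and nc: "nonconstant z"
  shows "AE \<omega> in seqs. \<forall>\<^sub>F n in sequentially. flat d \<delta> (evolve d \<omega> n z)"
proof -
  define B where "B \<omega> \<longleftrightarrow> (\<exists>n\<^sub>0. \<forall>n\<ge>n\<^sub>0. flat d \<delta> (evolve d \<omega> n z))" for \<omega>
  have Bm: "{\<omega>\<in>space seqs. B \<omega>} \<in> sets seqs" unfolding B_def by measurable
  have "1 - \<eta> \<le> seqs.prob {\<omega>\<in>space seqs. B \<omega>}" if \<eta>: "\<eta> > 0" for \<eta>
  proof -
    obtain e where e: "e > 0" and stay: "\<And>z. flat d e z \<Longrightarrow> 1 - \<eta> \<le> seqs.prob {\<omega>\<in>space seqs. \<forall>m. flat d \<delta> (evolve d \<omega> m z)}"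
      using stays_flat[OF \<delta> \<eta>] by blast
    have "(1 - \<eta>) * seqs.prob {\<omega>\<in>space seqs. \<exists>k. flat d e (evolve d \<omega> k z)} \<le> seqs.prob {\<omega>\<in>space seqs. B \<omega>}"
    proof (rule first_passage_infinite)
      show "{\<omega>\<in>space seqs. flat d e (evolve d \<omega> k z)} \<in> sets seqs" for k by (rule flat_meas)
      show "{\<omega>\<in>space seqs. B \<omega>} \<in> sets seqs" by (rule Bm)
      show "flat d e (evolve d \<omega> k z) = flat d e (evolve d \<omega>' k z)" if "\<And>m. m < k \<Longrightarrow> \<omega> m = \<omega>' m" for k \<omega> \<omega>'
        using evolve_cong[of k \<omega> \<omega>' d z] that by simp
      fix k \<omega> assume \<omega>: "\<omega> \<in> space seqs" and f: "flat d e (evolve d \<omega> k z)"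
      have "1 - \<eta> \<le> seqs.prob {\<omega>'\<in>space seqs. \<forall>m. flat d \<delta> (evolve d \<omega>' m (evolve d \<omega> k z))}"
        by (rule stay[OF f])
      also have "\<dots> \<le> seqs.prob {\<omega>'\<in>space seqs. B (comb_seq k \<omega> \<omega>')}"
      proof (rule seqs.finite_measure_mono)
        have "B (comb_seq k \<omega> \<omega>')" if m: "\<forall>m. flat d \<delta> (evolve d \<omega>' m (evolve d \<omega> k z))" for \<omega>'
          unfolding B_def
        proof (intro exI[of _ k] allI impI)
          fix n assume "k \<le> n"
          then show "flat d \<delta> (evolve d (comb_seq k \<omega> \<omega>') n z)"
            using m evolve_comb_seq[of d k \<omega> \<omega>' "n - k" z] by simp
        qed
        then show "{\<omega>'\<in>space seqs. \<forall>m. flat d \<delta> (evolve d \<omega>' m (evolve d \<omega> k z))} \<subseteq> {\<omega>'\<in>space seqs. B (comb_seq k \<omega> \<omega>')}"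
          by blast
        show "{\<omega>'\<in>space seqs. B (comb_seq k \<omega> \<omega>')} \<in> sets seqs" by (rule comb_seq_section[OF \<omega> Bm])
      qed
      finally show "1 - \<eta> \<le> seqs.prob {\<omega>'\<in>space seqs. B (comb_seq k \<omega> \<omega>')}" .
    qed
    then show ?thesis by (simp add: hits_flat[OF e nc])
  qed
  then have "1 \<le> seqs.prob {\<omega>\<in>space seqs. B \<omega>} + \<eta>" if "\<eta> > 0" for \<eta> using that by force
  then have "1 \<le> seqs.prob {\<omega>\<in>space seqs. B \<omega>}" by (rule field_le_epsilon)
  then have "seqs.prob {\<omega>\<in>space seqs. B \<omega>} = 1" using seqs.prob_le_1 by (rule antisym[rotated])
  then have "AE \<omega> in seqs. \<omega> \<in> {\<omega>\<in>space seqs. B \<omega>}" using Bm by (simp add: seqs.prob_eq_1)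
  then show ?thesis by eventually_elim (auto simp: B_def eventually_sequentially)
qed

end

section \<open>The area of a flat polygon\<close>

lemma norm_diff_le_sides:
  fixes A :: "nat \<Rightarrow> real^2"
  assumes i: "i \<in> {1..d}" and j: "j \<in> {1..d}"
  shows "norm (A i - A j) \<le> real d * (MAX j\<in>{1..d}. norm (side d A j))"
proof -
  define M where "M = (MAX j\<in>{1..d}. norm (side d A j))"
  have side_le: "norm (side d A k) \<le> M" if "k \<in> {1..d}" for k
    unfolding M_def using that by (intro Max_ge) auto
  have M: "M \<ge> 0" using side_le[OF i] norm_ge_zero order_trans by blast
  have walk: "norm (A (k + n) - A k) \<le> real n * M" if "1 \<le> k" "k + n \<le> d" for k n
    using that(2)
  proof (induction n)
    case (Suc n)
    have "A (k + Suc n) - A k = side d A (k + n) + (A (k + n) - A k)"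
      using Suc.prems by (simp add: side_def One_nat_def)
    then have "norm (A (k + Suc n) - A k) \<le> norm (side d A (k + n)) + norm (A (k + n) - A k)"
      by (metis norm_triangle_ineq)
    also have "\<dots> \<le> M + real n * M" using Suc that(1) by (intro add_mono side_le) auto
    finally show ?case by (simp add: algebra_simps)
  qed simp
  have main: "norm (A l - A k) \<le> real d * M" if "k \<in> {1..d}" "l \<in> {1..d}" "k \<le> l" for k l
  proof -
    have "norm (A l - A k) \<le> real (l - k) * M" using walk[of k "l - k"] that by simp
    also have "\<dots> \<le> real d * M" using M that by (intro mult_right_mono) auto
    finally show ?thesis .
  qed
  show ?thesis
    unfolding M_def[symmetric]
    using main[OF i j] main[OF j i] by (cases "i \<le> j") (auto simp: norm_minus_commute)
qed

definition cplx :: "real^2 \<Rightarrow> complex" where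
  "cplx v = Complex (v $ 1) (v $ 2)"

lemma linear_cplx: "linear cplx"
  by (rule linearI) (auto simp: cplx_def complex_eq_iff)

lemma norm_cplx: "norm (cplx v) = norm v"
  by (simp add: cplx_def cmod_def norm_eq_sqrt_inner inner_vec_def sum_2 power2_eq_square)

text \<open>After a rotation the vertices, and with them their convex hull, lie in a box whose side lengths are the
  oscillations of the two coordinates.\<close>

lemma area_le_of_flat:
  assumes d: "d \<ge> 1" and fl: "flat d \<delta> (\<lambda>i. cplx (A i))" and \<delta>: "\<delta> > 0"
  shows "measure lebesgue (polygon_region d A) \<le> \<delta> * (real d * (MAX j\<in>{1..d}. norm (side d A j)))\<^sup>2"
proof -
  define M where "M = (MAX j\<in>{1..d}. norm (side d A j))"
  obtain r :: rat where nar: "narrow d \<delta> (\<lambda>i. cis (of_rat r) * cplx (A i))"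
    using fl by (auto simp: flat_def)
  define u where "u = cis (of_rat r)"
  define a where "a = (\<lambda>i. Re (u * cplx (A i)))"
  define b where "b = (\<lambda>i. Im (u * cplx (A i)))"
  have ab: "osc d b < \<delta> * osc d a" using nar unfolding narrow_def a_def b_def u_def .
  have oa: "osc d a \<le> real d * M"
  proof (rule osc_le[OF d])
    fix i j assume ij: "i \<in> {1..d}" "j \<in> {1..d}"
    have "a i - a j = Re (u * cplx (A i - A j))"
      by (simp add: a_def linear_diff[OF linear_cplx] right_diff_distrib)
    then have "norm (a i - a j) \<le> norm (u * cplx (A i - A j))"
      by (metis abs_Re_le_cmod real_norm_def)
    also have "\<dots> = norm (A i - A j)" by (simp add: norm_mult norm_cplx u_def)
    also have "\<dots> \<le> real d * M" unfolding M_def by (rule norm_diff_le_sides[OF ij])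
    finally show "norm (a i - a j) \<le> real d * M" .
  qed
  define f :: "real^2 \<Rightarrow> real^2" where "f v = vector [Re (u * cplx v), Im (u * cplx v)]" for v
  have f: "orthogonal_transformation f"
    unfolding orthogonal_transformation
  proof
    show "linear f"
      by (rule linearI) (simp_all add: f_def vec_eq_iff forall_2 linear_add[OF linear_cplx]
          linear_scale[OF linear_cplx] algebra_simps)
    show "\<forall>v. norm (f v) = norm v"
    proof
      fix v
      have "norm (f v) = norm (cplx (f v))" by (simp add: norm_cplx)
      also have "cplx (f v) = u * cplx v" by (simp add: f_def cplx_def complex_eq_iff)
      also have "norm \<dots> = norm v" by (simp add: norm_mult norm_cplx u_def)
      finally show "norm (f v) = norm v" .
    qed
  qed
  have fin: "finite (g ` {1..d})" "g ` {1..d} \<noteq> {}" for g :: "nat \<Rightarrow> real" using d by auto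
  have range: "Max (g ` {1..d}) - Min (g ` {1..d}) \<le> osc d g" "Min (g ` {1..d}) \<le> Max (g ` {1..d})" for g :: "nat \<Rightarrow> real"
  proof -
    obtain i where i: "i \<in> {1..d}" "Max (g ` {1..d}) = g i" using Max_in[OF fin, of g] by auto
    obtain j where j: "j \<in> {1..d}" "Min (g ` {1..d}) = g j" using Min_in[OF fin, of g] by auto
    show "Max (g ` {1..d}) - Min (g ` {1..d}) \<le> osc d g"
      using osc_ge[OF i(1) j(1), of g] unfolding i j by simp
    show "Min (g ` {1..d}) \<le> Max (g ` {1..d})" unfolding j(2) by (rule Max_ge) (use j in auto)
  qed
  define lo hi :: "real^2" where "lo = vector [Min (a ` {1..d}), Min (b ` {1..d})]"
    and "hi = vector [Max (a ` {1..d}), Max (b ` {1..d})]"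
  have "f ` polygon_region d A = convex hull (f ` A ` {1..d})"
    unfolding polygon_region_def
    by (rule convex_hull_linear_image) (use f in \<open>simp add: orthogonal_transformation\<close>)
  also have "\<dots> \<subseteq> cbox lo hi"
  proof (rule hull_minimal)
    have "f (A i) \<in> cbox lo hi" if i: "i \<in> {1..d}" for i
    proof -
      have "f (A i) = vector [a i, b i]" by (simp add: f_def a_def b_def)
      moreover have "Min (g ` {1..d}) \<le> g i" "g i \<le> Max (g ` {1..d})" for g :: "nat \<Rightarrow> real"
        using i by auto
      ultimately show ?thesis by (simp only: mem_box_cart forall_2 lo_def hi_def vector_2)
    qed
    then show "f ` A ` {1..d} \<subseteq> cbox lo hi" by auto
  qed (rule convex_box)
  finally have sub: "f ` polygon_region d A \<subseteq> cbox lo hi" .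
  have comp: "compact (polygon_region d A)"
    unfolding polygon_region_def by (intro finite_imp_compact_convex_hull) simp
  then have compf: "compact (f ` polygon_region d A)"
    using f by (intro compact_continuous_image)
      (auto simp: orthogonal_transformation intro: linear_continuous_on linear_conv_bounded_linear[THEN iffD1])
  have "measure lebesgue (polygon_region d A) = measure lebesgue (f ` polygon_region d A)"
    using measure_orthogonal_image[OF f] comp by (simp add: lmeasurable_compact)
  also have "\<dots> \<le> measure lebesgue (cbox lo hi)"
    by (rule measure_mono_fmeasurable[OF sub]) (use compf in \<open>auto dest: lmeasurable_compact fmeasurableD\<close>)
  also have "\<dots> = (Max (a ` {1..d}) - Min (a ` {1..d})) * (Max (b ` {1..d}) - Min (b ` {1..d}))"
  proof -
    have "cbox lo hi \<noteq> {}"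
      using range(2)[of a] range(2)[of b] by (simp add: interval_ne_empty_cart forall_2 lo_def hi_def)
    from content_cbox_cart[OF this] show ?thesis
      by (simp add: UNIV_2 lo_def hi_def)
  qed
  also have "\<dots> \<le> osc d a * osc d b"
    using range[of a] range[of b] osc_nonneg[OF d, of a] by (intro mult_mono) auto
  also have "\<dots> \<le> osc d a * (\<delta> * osc d a)"
    using ab osc_nonneg[OF d, of a] by (intro mult_left_mono) auto
  also have "\<dots> = \<delta> * (osc d a)\<^sup>2" by (simp add: power2_eq_square)
  also have "\<dots> \<le> \<delta> * (real d * M)\<^sup>2"
    using \<delta> oa osc_nonneg[OF d, of a] by (intro mult_left_mono power_mono) auto
  finally show ?thesis by (simp add: M_def)
qed

section \<open>Convergence of the subdivided polygons\<close>

lemma subdivision_eq_evolve: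
  assumes "i \<in> {1..d}"
  shows "subdivision d x A n i = evolve d (\<lambda>m. restrict (x (Suc m)) {1..d}) n A i"
  using assms
proof (induction n arbitrary: i)
  case (Suc n)
  then show ?case
    using Suc.IH[OF Suc.prems] Suc.IH[OF cyc_mem[OF Suc.prems]]
    by (simp add: side_def step_def algebra_simps)
qed simp

text \<open>Only the bounds \<open>1 / (k + 1)\<close> occur, so that countably many almost sure statements are enough.\<close>

lemma converges_to_flat_figureI:
  assumes d: "d \<ge> 1" and "\<And>k. \<forall>\<^sub>F n in sequentially. flat d (1 / real (Suc k)) (\<lambda>i. cplx (L n i))"
  shows "converges_to_flat_figure d L"
  unfolding converges_to_flat_figure_def
proof (rule tendstoI)
  fix e :: real assume e: "e > 0"
  let ?R = "\<lambda>n. measure lebesgue (polygon_region d (L n)) / (MAX j\<in>{1..d}. norm (side d (L n) j))\<^sup>2"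
  obtain k where k: "1 / real (Suc k) < e / (real d)\<^sup>2"
    using reals_Archimedean[of "e / (real d)\<^sup>2"] e d by (auto simp: inverse_eq_divide)
  show "\<forall>\<^sub>F n in sequentially. dist (?R n) 0 < e"
    using assms(2)[of k]
  proof eventually_elim
    case (elim n)
    let ?M = "MAX j\<in>{1..d}. norm (side d (L n) j)"
    have "measure lebesgue (polygon_region d (L n)) \<le> 1 / real (Suc k) * (real d * ?M)\<^sup>2"
      by (rule area_le_of_flat[OF d elim]) simp
    then have "?R n \<le> (1 / real (Suc k) * (real d * ?M)\<^sup>2) / ?M\<^sup>2"
      by (intro divide_right_mono) auto
    also have "\<dots> \<le> 1 / real (Suc k) * (real d)\<^sup>2"
      by (cases "?M = 0") (auto simp: power_mult_distrib)
    also have "\<dots> < e" using k d by (simp add: pos_less_divide_eq)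
    finally show ?case by (simp add: dist_norm)
  qed
qed

theorem theorem3p5:
  fixes d :: nat
    and N :: "'b measure" and \<xi> :: "'b \<Rightarrow> real"
    and M :: "'a measure" and X :: "nat \<Rightarrow> nat \<Rightarrow> 'a \<Rightarrow> real"
    and A :: "nat \<Rightarrow> real^2"
  assumes "d \<ge> 3"
    and "prob_space N" and "\<xi> \<in> borel_measurable N"
    and "law_support (distr N borel \<xi>) \<subseteq> {0..1}"
    and "\<P>(\<omega> in N. \<xi> \<omega> \<in> {0, 1}) = 0"
    and "\<exists>p q. p \<noteq> q \<and> {p, q} \<subseteq> law_support (distr N borel \<xi>) \<inter> {0<..<1}"
    and "even d \<Longrightarrow> AE x in PiM {1..d} (\<lambda>_. distr N borel \<xi>). (\<Prod>i=1..d. (1 - x i) / x i) \<noteq> 1"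
    and "prob_space M"
    and "prob_space.indep_vars M (\<lambda>_. borel) (\<lambda>(n, j). X n j) ({1..} \<times> {1..d})"
    and "\<And>n j. n \<ge> 1 \<Longrightarrow> j \<in> {1..d} \<Longrightarrow> distr M borel (X n j) = distr N borel \<xi>"
    and "convex_polygon d A"
  shows "AE \<omega> in M. converges_to_flat_figure d (subdivision d (\<lambda>n j. X n j \<omega>) A)"
proof -
  define \<mu> where "\<mu> = distr N borel \<xi>"
  interpret N: prob_space N by fact
  interpret M: prob_space M by fact
  have mu: "prob_space \<mu>" unfolding \<mu>_def by (rule N.prob_space_distr[OF assms(3)])
  have d1: "d \<ge> 1" using assms(1) by simp
  \<comment> \<open>A measure on the line is carried by its support: the complement is covered by countably many
    basic open sets of measure zero.\<close>
  have unit: "AE t in \<mu>. t \<in> {0<..<1}"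
  proof -
    obtain B :: "real set set" where B: "countable B" "topological_basis B"
      using ex_countable_basis by blast
    define Z where "Z = {b \<in> B. emeasure \<mu> b = 0}"
    have "AE t in \<mu>. \<forall>b\<in>Z. t \<notin> b"
    proof (rule AE_ball_countable[THEN iffD2])
      show "countable Z" using B(1) by (simp add: Z_def)
      show "\<forall>b\<in>Z. AE t in \<mu>. t \<notin> b"
      proof
        fix b assume b: "b \<in> Z"
        then have "open b" using B(2) by (auto simp: Z_def intro: topological_basis_open)
        then show "AE t in \<mu>. t \<notin> b"
          using b by (intro AE_not_in) (auto simp: Z_def null_sets_def \<mu>_def)
      qed
    qed
    moreover have "AE t in \<mu>. t \<notin> {0, 1}"
    proof (rule AE_not_in)
      have "emeasure \<mu> {0, 1} = emeasure N (\<xi> -` {0, 1} \<inter> space N)"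
        unfolding \<mu>_def by (rule emeasure_distr[OF assms(3)]) auto
      also have "\<xi> -` {0, 1} \<inter> space N = {\<omega>\<in>space N. \<xi> \<omega> \<in> {0, 1}}" by auto
      also have "emeasure N \<dots> = 0" using assms(5) by (simp add: N.emeasure_eq_measure)
      finally show "{0, 1} \<in> null_sets \<mu>" by (auto simp: null_sets_def \<mu>_def)
    qed
    ultimately show ?thesis
    proof eventually_elim
      case (elim t)
      have "t \<in> law_support \<mu>"
      proof (rule ccontr)
        assume "t \<notin> law_support \<mu>"
        then obtain U where U: "open U" "t \<in> U" "emeasure \<mu> U = 0" by (auto simp: law_support_def)
        obtain b where b: "b \<in> B" "t \<in> b" "b \<subseteq> U"
          using topological_basisE[OF B(2) U(1,2)] by blast
        have "emeasure \<mu> b \<le> emeasure \<mu> U" using b U(1) by (intro emeasure_mono) (auto simp: \<mu>_def)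
        then have "b \<in> Z" using b U(3) by (simp add: Z_def)
        with elim b show False by blast
      qed
      then have "t \<in> {0..1}" using assms(4) by (auto simp: \<mu>_def)
      with elim(2) show ?case by auto
    qed
  qed
  obtain p q where pq: "p \<noteq> q" "p \<in> law_support \<mu>" "q \<in> law_support \<mu>" "p \<in> {0<..<1}" "q \<in> {0<..<1}"
    using assms(6) unfolding \<mu>_def by blast
  have charged: "measure \<mu> U > 0" if "r \<in> law_support \<mu>" "open U" "r \<in> U" for r U
  proof -
    have "emeasure \<mu> U > 0" using that by (auto simp: law_support_def)
    then show ?thesis
      using prob_space.finite_measure[OF mu] by (simp add: finite_measure.emeasure_eq_measure)
  qed
  have sets_mu: "sets \<mu> = sets borel" by (simp add: \<mu>_def)
  have sd: "subdivision_law \<mu> d p q"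
    unfolding subdivision_law_def subdivision_law_axioms_def
    using mu unit assms(1) assms(7)[folded \<mu>_def] pq charged sets_mu by auto
  interpret subdivision_law \<mu> d p q by (rule sd)
  \<comment> \<open>The ratios of one step form an independent block; the sequence of blocks has the canonical law,
    to which the almost sure statement is transferred.\<close>
  define Y where "Y = (\<lambda>n \<omega>. \<lambda>j\<in>{1..d}. X (Suc n) j \<omega>)"
  have rvX: "X n j \<in> borel_measurable M" if "n \<ge> 1" "j \<in> {1..d}" for n j
    using assms(9) that unfolding M.indep_vars_def by auto
  have Ym: "Y n \<in> measurable M ratios" for n
    unfolding Y_def using rvX by (intro measurable_restrict) (auto cong: measurable_cong_sets)
  have Yind: "M.indep_vars (\<lambda>_. ratios) Y UNIV"
  proof -
    have "M.indep_vars (\<lambda>n. PiM ({Suc n} \<times> {1..d}) (\<lambda>_. borel))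
        (\<lambda>n \<omega>. restrict (\<lambda>i. (case i of (n, j) \<Rightarrow> X n j) \<omega>) ({Suc n} \<times> {1..d})) UNIV"
      by (rule M.indep_vars_restrict[OF assms(9)]) (auto simp: disjoint_family_on_def)
    then have "M.indep_vars (\<lambda>_. ratios)
        (\<lambda>n \<omega>. (\<lambda>g. \<lambda>j\<in>{1..d}. g (Suc n, j)) (restrict (\<lambda>i. (case i of (n, j) \<Rightarrow> X n j) \<omega>) ({Suc n} \<times> {1..d}))) UNIV"
    proof (rule M.indep_vars_compose2)
      fix n :: nat
      show "(\<lambda>g. \<lambda>j\<in>{1..d}. g (Suc n, j)) \<in> measurable (PiM ({Suc n} \<times> {1..d}) (\<lambda>_. borel)) ratios"
      proof (rule measurable_restrict)
        fix j assume "j \<in> {1..d}"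
        then have "(\<lambda>g. g (Suc n, j)) \<in> measurable (PiM ({Suc n} \<times> {1..d}) (\<lambda>_. borel)) (borel :: real measure)"
          by (intro measurable_component_singleton) auto
        then show "(\<lambda>g. g (Suc n, j)) \<in> measurable (PiM ({Suc n} \<times> {1..d}) (\<lambda>_. borel)) \<mu>"
          by (simp cong: measurable_cong_sets)
      qed
    qed
    moreover have "(\<lambda>n \<omega>. (\<lambda>g. \<lambda>j\<in>{1..d}. g (Suc n, j)) (restrict (\<lambda>i. (case i of (n, j) \<Rightarrow> X n j) \<omega>) ({Suc n} \<times> {1..d}))) = Y"
      by (auto simp: Y_def fun_eq_iff restrict_def)
    ultimately show ?thesis by simp
  qed
  have Ylaw: "distr M ratios (Y n) = ratios" for n
  proof -
    have "M.indep_vars (\<lambda>j. PiM {(Suc n, j)} (\<lambda>_. borel))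
        (\<lambda>j \<omega>. restrict (\<lambda>i. (case i of (n, j) \<Rightarrow> X n j) \<omega>) {(Suc n, j)}) {1..d}"
      by (rule M.indep_vars_restrict[OF assms(9)]) (auto simp: disjoint_family_on_def)
    then have "M.indep_vars (\<lambda>_. borel)
        (\<lambda>j \<omega>. restrict (\<lambda>i. (case i of (n, j) \<Rightarrow> X n j) \<omega>) {(Suc n, j)} (Suc n, j)) {1..d}"
      by (rule M.indep_vars_compose2[where Y = "\<lambda>j g. g (Suc n, j)"]) (intro measurable_component_singleton, simp)
    then have "M.indep_vars (\<lambda>_. borel) (\<lambda>j. X (Suc n) j) {1..d}" by simp
    then have "distr M (PiM {1..d} (\<lambda>_. borel)) (\<lambda>\<omega>. \<lambda>j\<in>{1..d}. X (Suc n) j \<omega>) =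
        PiM {1..d} (\<lambda>j. distr M borel (X (Suc n) j))"
      using d1 rvX by (intro M.indep_vars_iff_distr_eq_PiM'[THEN iffD1]) auto
    also have "\<dots> = ratios"
      using assms(10) by (intro PiM_cong) (auto simp: \<mu>_def)
    also have "distr M (PiM {1..d} (\<lambda>_. borel)) (\<lambda>\<omega>. \<lambda>j\<in>{1..d}. X (Suc n) j \<omega>) = distr M ratios (Y n)"
      by (intro distr_cong sets_PiM_cong) (auto simp: Y_def)
    finally show ?thesis .
  qed
  have seq_law: "distr M seqs (\<lambda>\<omega> n. Y n \<omega>) = seqs"
  proof -
    have "distr M seqs (\<lambda>\<omega>. \<lambda>n\<in>UNIV. Y n \<omega>) = PiM UNIV (\<lambda>n. distr M ratios (Y n))"
      using Yind Ym by (intro M.indep_vars_iff_distr_eq_PiM'[THEN iffD1]) auto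
    then show ?thesis by (simp add: Ylaw restrict_UNIV)
  qed
  have seq_meas: "(\<lambda>\<omega> n. Y n \<omega>) \<in> measurable M seqs"
    using measurable_restrict[of UNIV Y M "\<lambda>_. ratios"] Ym by (simp add: restrict_UNIV)
  have nc: "nonconstant (\<lambda>i. cplx (A i))"
  proof -
    have "A 2 \<noteq> A 1"
    proof -
      have "inj_on A {1..d}" using assms(11) by (simp add: convex_polygon_def)
      from inj_onD[OF this, of 2 1] show ?thesis using assms(1) by auto
    qed
    then have "cplx (A 2) \<noteq> cplx (A 1)"
      using norm_cplx[of "A 2 - A 1"] by (auto simp: linear_diff[OF linear_cplx])
    then show ?thesis unfolding nonconstant_def using assms(1) by (intro bexI[of _ 2]) auto
  qed
  have "AE \<omega> in seqs. \<forall>k. \<forall>\<^sub>F n in sequentially. flat d (1 / real (Suc k)) (evolve d \<omega> n (\<lambda>i. cplx (A i)))"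
    by (subst AE_all_countable) (intro allI eventually_flat nc, simp)
  then have "AE \<omega> in distr M seqs (\<lambda>\<omega> n. Y n \<omega>). \<forall>k. \<forall>\<^sub>F n in sequentially. flat d (1 / real (Suc k)) (evolve d \<omega> n (\<lambda>i. cplx (A i)))"
    unfolding seq_law .
  then have "AE \<omega> in M. \<forall>k. \<forall>\<^sub>F n in sequentially. flat d (1 / real (Suc k)) (evolve d (\<lambda>n. Y n \<omega>) n (\<lambda>i. cplx (A i)))"
    by (rule AE_distrD[OF seq_meas])
  then show ?thesis
  proof eventually_elim
    case (elim \<omega>)
    show ?case
    proof (rule converges_to_flat_figureI[OF d1])
      fix k
      have "flat d \<delta> (\<lambda>i. cplx (subdivision d (\<lambda>n j. X n j \<omega>) A n i)) = flat d \<delta> (evolve d (\<lambda>n. Y n \<omega>) n (\<lambda>i. cplx (A i)))" for \<delta> n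
      proof -
        have eq: "cplx (subdivision d (\<lambda>n j. X n j \<omega>) A n i) = evolve d (\<lambda>n. Y n \<omega>) n (\<lambda>i. cplx (A i)) i" if "i \<in> {1..d}" for i
          unfolding subdivision_eq_evolve[OF that] evolve_commute[OF linear_cplx] Y_def ..
        have "narrow d \<delta> (\<lambda>i. u * cplx (subdivision d (\<lambda>n j. X n j \<omega>) A n i)) =
            narrow d \<delta> (\<lambda>i. u * evolve d (\<lambda>n. Y n \<omega>) n (\<lambda>i. cplx (A i)) i)" for u
          unfolding narrow_def by (intro arg_cong2[where f = "(<)"] arg_cong2[where f = "(*)"] osc_cong refl) (simp_all only: eq)
        then show ?thesis unfolding flat_def by simp
      qed
      then show "\<forall>\<^sub>F n in sequentially. flat d (1 / real (Suc k)) (\<lambda>i. cplx (subdivision d (\<lambda>n j. X n j \<omega>) A n i))"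
        using elim by simp
    qed
  qed
qed

end
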